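(* Let $k$ be an algebraically closed field of characteristic $p>0$, let $(\mathfrak{g},[p])$ be a finite-dimensional restricted Lie algebra over $k$ with connected automorphism group $G=\mathrm{Aut}_p(\mathfrak{g})^\circ$. If $\mathfrak{t}\in\mathrm{Tor}(\mathfrak{g})$ is a generic torus, then the map $$\mathrm{Nor}_G(\mathfrak{t})\longrightarrow\mathrm{Aut}_p(\mathfrak{t}),\qquad g\mapsto g|_{\mathfrak{t}},$$ induces an isomorphism $W(\mathfrak{g},\mathfrak{t})\cong S(\mathfrak{g},\mathfrak{t})$ of groups.
   Context: $\mathrm{Aut}_p(\mathfrak{g})$ is the algebraic group of automorphisms of the restricted Lie algebra $\mathfrak{g}$, $\mathrm{Aut}_p(\mathfrak{g})^\circ$ its identity component. A torus is an abelian $p$-subalgebra consisting of semisimple elements ($x$ is semisimple if it lies in the $p$-subalgebra generated by $x^{[p]}$). $\mu(\mathfrak{g})$ is the maximal dimension of a torus, and $\mathrm{Tor}(\mathfrak{g})$ is the set of tori of dimension $\mu(\mathfrak{g})$, an irreducible locally closed subset of the Grassmannian $\mathrm{Gr}_{\mu(\mathfrak{g})}(\mathfrak{g})$ on which $G$ acts by $g\cdot\mathfrak{t}=g(\mathfrak{t})$. A torus $\mathfrak{t}\in\mathrm{Tor}(\mathfrak{g})$ is generic if $G\cdot\mathfrak{t}$ is dense in $\mathrm{Tor}(\mathfrak{g})$. For $\mathfrak{t}\in\mathrm{Tor}(\mathfrak{g})$, $\mathrm{Nor}_G(\mathfrak{t})=\{g\in G: g(\mathfrak{t})=\mathfrak{t}\}$,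 $\mathrm{Cent}_G(\mathfrak{t})=\{g\in G: g|_{\mathfrak{t}}=\mathrm{id}\}$, and $W(\mathfrak{g},\mathfrak{t})=\mathrm{Nor}_G(\mathfrak{t})/\mathrm{Cent}_G(\mathfrak{t})$ is the Weyl group of $\mathfrak{g}$ relative to $\mathfrak{t}$. Let $\mathcal{T}_{\mathfrak{g}}(k)$ be the variety (a smooth affine variety, with Zariski topology from $\mathrm{Hom}_k(\mathfrak{t},\mathfrak{g})$) of injective homomorphisms $\mathfrak{t}\to\mathfrak{g}$ of restricted Lie algebras, and $\mathcal{X}_{\mathfrak{t}}(k)$ its irreducible (equivalently, connected) component containing the inclusion $\mathfrak{t}\hookrightarrow\mathfrak{g}$. The finite group $\mathrm{Aut}_p(\mathfrak{t})$ of automorphisms of the restricted Lie algebra $\mathfrak{t}$ acts by $h\cdot\varphi=\varphi\circ h^{-1}$, and $S(\mathfrak{g},\mathfrak{t})=\mathrm{Stab}_{\mathrm{Aut}_p(\mathfrak{t})}(\mathcal{X}_{\mathfrak{t}}(k))$. *)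

theory Defs
  imports
    "HOL-Analysis.Abstract_Topology_2"
    "HOL-Computational_Algebra.Polynomial"
    "HOL-Algebra.Bij"
    "HOL-Algebra.Coset"
begin

section \<open>Zariski topologies\<close>

text \<open>
  \<open>F\<close> is a set of coordinate functions on points of type \<open>'x\<close>; the polynomial functions are
  the \<open>'k\<close>-algebra generated by \<open>F\<close>. It is enough that \<open>F\<close> generates the usual coordinate ring,
  so no basis has to be chosen.
\<close>

inductive_set polyfuns :: "('x \<Rightarrow> 'k::field) set \<Rightarrow> ('x \<Rightarrow> 'k) set"
  for F :: "('x \<Rightarrow> 'k) set"
where
  polyfuns_const: "(\<lambda>_. c) \<in> polyfuns F"
| polyfuns_coord: "f \<in> F \<Longrightarrow> f \<in> polyfuns F"
| polyfuns_add: "f \<in> polyfuns F \<Longrightarrow> g \<in> polyfuns F \<Longrightarrow> (\<lambda>x. f x + g x) \<in> polyfuns F"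
| polyfuns_mult: "f \<in> polyfuns F \<Longrightarrow> g \<in> polyfuns F \<Longrightarrow> (\<lambda>x. f x * g x) \<in> polyfuns F"

definition zero_locus :: "'x set \<Rightarrow> ('x \<Rightarrow> 'k::field) set \<Rightarrow> 'x set" where
  "zero_locus X S = {x \<in> X. \<forall>f\<in>S. f x = 0}"

definition zariski :: "'x set \<Rightarrow> ('x \<Rightarrow> 'k::field) set \<Rightarrow> 'x topology" where
  "zariski X F = topology (\<lambda>U. \<exists>S \<subseteq> polyfuns F. U = X - zero_locus X S)"

lemma istopology_zariski:
  "istopology (\<lambda>U. \<exists>S \<subseteq> polyfuns F. U = X - zero_locus X S)"
  unfolding istopology_def
proof (intro conjI allI impI)
  fix U V
  assume "\<exists>S \<subseteq> polyfuns F. U = X - zero_locus X S" and "\<exists>S \<subseteq> polyfuns F. V = X - zero_locus X S"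
  then obtain S T where S: "S \<subseteq> polyfuns F" "U = X - zero_locus X S"
    and T: "T \<subseteq> polyfuns F" "V = X - zero_locus X T" by blast
  let ?R = "{(\<lambda>x. f x * g x) | f g. f \<in> S \<and> g \<in> T}"
  have "?R \<subseteq> polyfuns F"
    using S(1) T(1) polyfuns_mult by blast
  moreover have "U \<inter> V = X - zero_locus X ?R"
  proof (rule Set.set_eqI)
    fix x
    have I: "(\<exists>h\<in>?R. h x \<noteq> 0) \<longleftrightarrow> (\<exists>f\<in>S. f x \<noteq> 0) \<and> (\<exists>g\<in>T. g x \<noteq> 0)"
    proof
      assume "\<exists>h\<in>?R. h x \<noteq> 0"
      then obtain f g where "f \<in> S" "g \<in> T" "f x * g x \<noteq> 0" by blast
      then show "(\<exists>f\<in>S. f x \<noteq> 0) \<and> (\<exists>g\<in>T. g x \<noteq> 0)" by (metis mult_zero_left mult_zero_right)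
    next
      assume "(\<exists>f\<in>S. f x \<noteq> 0) \<and> (\<exists>g\<in>T. g x \<noteq> 0)"
      then obtain f g where fg: "f \<in> S" "g \<in> T" "f x * g x \<noteq> 0" by (metis mult_eq_0_iff)
      then have "(\<lambda>x. f x * g x) \<in> ?R" by blast
      then show "\<exists>h\<in>?R. h x \<noteq> 0" using fg(3) by (intro bexI[where x = "\<lambda>x. f x * g x"])
    qed
    have Z: "x \<in> X - zero_locus X A \<longleftrightarrow> x \<in> X \<and> (\<exists>f\<in>A. f x \<noteq> 0)" for A :: "('a \<Rightarrow> 'b) set"
      unfolding zero_locus_def by blast
    show "x \<in> U \<inter> V \<longleftrightarrow> x \<in> X - zero_locus X ?R"
      by (simp only: S(2) T(2) Int_iff Z I) blast
  qed
  ultimately show "\<exists>R \<subseteq> polyfuns F. U \<inter> V = X - zero_locus X R" by blast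
next
  fix \<K>
  assume "\<forall>K\<in>\<K>. \<exists>S \<subseteq> polyfuns F. K = X - zero_locus X S"
  then have "\<forall>K\<in>\<K>. \<exists>S. S \<subseteq> polyfuns F \<and> K = X - zero_locus X S" by blast
  from bchoice[OF this] obtain S
    where S: "\<forall>K\<in>\<K>. S K \<subseteq> polyfuns F \<and> K = X - zero_locus X (S K)" ..
  note S1 = conjunct1[OF S[rule_format]] and S2 = conjunct2[OF S[rule_format]]
  have "\<Union>(S ` \<K>) \<subseteq> polyfuns F" by (rule UN_least[OF S1])
  moreover have "\<Union>\<K> = (\<Union>K\<in>\<K>. X - zero_locus X (S K))" 
  proof -
    have "(\<lambda>K. K) ` \<K> = (\<lambda>K. X - zero_locus X (S K)) ` \<K>"
      by (rule image_cong[OF refl S2])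
    then show ?thesis by (simp only: image_ident)
  qed
  moreover have "(\<Union>K\<in>\<K>. X - zero_locus X (S K)) = X - zero_locus X (\<Union>(S ` \<K>))"
    unfolding zero_locus_def by blast
  ultimately show "\<exists>R \<subseteq> polyfuns F. \<Union>\<K> = X - zero_locus X R"
    by (intro exI[of _ "\<Union>(S ` \<K>)"] conjI) (simp_all only:)
qed

lemma openin_zariski:
  "openin (zariski X F) U \<longleftrightarrow> (\<exists>S \<subseteq> polyfuns F. U = X - zero_locus X S)"
  unfolding zariski_def topology_inverse'[OF istopology_zariski] ..

lemma topspace_zariski [simp]: "topspace (zariski X F) = X"
proof
  have "{\<lambda>_. 1} \<subseteq> polyfuns F" by (simp add: polyfuns_const)
  moreover have "X = X - zero_locus X {\<lambda>_. 1 :: 'b}" by (simp add: zero_locus_def)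
  ultimately have "openin (zariski X F) X" unfolding openin_zariski by blast
  then show "X \<subseteq> topspace (zariski X F)" by (rule openin_subset)
  have "openin (zariski X F) (topspace (zariski X F))" by (rule openin_topspace)
  then show "topspace (zariski X F) \<subseteq> X" unfolding openin_zariski by blast
qed

lemma closedin_zariski:
  "closedin (zariski X F) C \<longleftrightarrow> (\<exists>S \<subseteq> polyfuns F. C = zero_locus X S)"
proof -
  have "zero_locus X S \<subseteq> X" for S :: "('a \<Rightarrow> 'b) set" by (auto simp: zero_locus_def)
  then have "C \<subseteq> X \<and> X - C = X - zero_locus X S \<longleftrightarrow> C = zero_locus X S" for S :: "('a \<Rightarrow> 'b) set"
    by blast
  then show ?thesis
    unfolding closedin_def topspace_zariski openin_zariski by blast
qed

lemma polyfuns_comp: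
  assumes "f \<in> polyfuns F" and c: "\<And>c. c \<in> F \<Longrightarrow> c \<circ> a \<in> polyfuns F'"
  shows "f \<circ> a \<in> polyfuns F'"
  using assms(1)
proof induction
  case (polyfuns_const c)
  show ?case using polyfuns.polyfuns_const[of c F'] by (simp add: o_def)
next
  case (polyfuns_coord f)
  then show ?case by (rule c)
next
  case (polyfuns_add f g)
  then show ?case using polyfuns.polyfuns_add[of "f \<circ> a" F' "g \<circ> a"] by (simp add: o_def)
next
  case (polyfuns_mult f g)
  then show ?case using polyfuns.polyfuns_mult[of "f \<circ> a" F' "g \<circ> a"] by (simp add: o_def)
qed

lemma continuous_map_zariski:
  assumes "a \<in> X \<rightarrow> Y" and "\<And>c. c \<in> F' \<Longrightarrow> c \<circ> a \<in> polyfuns F"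
  shows "continuous_map (zariski X F) (zariski Y F') a"
  unfolding continuous_map_closedin
proof (intro conjI allI impI)
  show "a \<in> topspace (zariski X F) \<rightarrow> topspace (zariski Y F')" using assms(1) by simp
  fix C assume "closedin (zariski Y F') C"
  then obtain S where S: "S \<subseteq> polyfuns F'" "C = zero_locus Y S"
    unfolding closedin_zariski by blast
  have "(\<lambda>f. f \<circ> a) ` S \<subseteq> polyfuns F"
    using S(1) polyfuns_comp[OF _ assms(2)] by blast
  moreover have "{x \<in> X. a x \<in> C} = zero_locus X ((\<lambda>f. f \<circ> a) ` S)"
    using S(2) assms(1) by (auto simp: zero_locus_def)
  ultimately show "closedin (zariski X F) {x \<in> topspace (zariski X F). a x \<in> C}"
    unfolding closedin_zariski topspace_zariski by blast
qed

definition irreduciblein :: "'x topology \<Rightarrow> 'x set \<Rightarrow> bool" where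
  "irreduciblein X S \<longleftrightarrow> S \<subseteq> topspace X \<and> S \<noteq> {} \<and>
     (\<forall>A B. closedin X A \<and> closedin X B \<and> S \<subseteq> A \<union> B \<longrightarrow> S \<subseteq> A \<or> S \<subseteq> B)"

definition irreducible_components_of :: "'x topology \<Rightarrow> 'x set set" where
  "irreducible_components_of X =
     {C. irreduciblein X C \<and> (\<forall>D. irreduciblein X D \<and> C \<subseteq> D \<longrightarrow> D = C)}"


section \<open>Restricted Lie algebras\<close>

text \<open>
  \<open>jacobson_coeff br x y n j\<close> is the coefficient of \<open>T ^ j\<close> in \<open>(ad (T x + y)) ^ n (x)\<close>, computed in
  the Lie algebra of polynomials in \<open>T\<close> over the given Lie algebra.
\<close>

primrec jacobson_coeff :: "('g \<Rightarrow> 'g \<Rightarrow> 'g::ab_group_add) \<Rightarrow> 'g \<Rightarrow> 'g \<Rightarrow> nat \<Rightarrow> nat \<Rightarrow> 'g" where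
  "jacobson_coeff br x y 0 = (\<lambda>j. if j = 0 then x else 0)"
| "jacobson_coeff br x y (Suc n) = (\<lambda>j. br y (jacobson_coeff br x y n j) +
     (if j = 0 then 0 else br x (jacobson_coeff br x y n (j - 1))))"

text \<open>
  In \<open>pmap_add\<close> the summand with index \<open>i\<close> is Jacobson's \<open>s\<^sub>i(x,y)\<close>, determined by
  \<open>(ad (T x + y)) ^ (p-1) (x) = (\<Sum>i=1..p-1. i s\<^sub>i(x,y) T ^ (i-1))\<close>.
\<close>

locale restricted_lie_algebra = finite_dimensional_vector_space scale Basis
  for scale :: "'k::field \<Rightarrow> 'g::ab_group_add \<Rightarrow> 'g" (infixr \<open>*s\<close> 75)
    and Basis :: "'g set" +
  fixes bracket :: "'g \<Rightarrow> 'g \<Rightarrow> 'g"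
    and pmap :: "'g \<Rightarrow> 'g"
  assumes char_pos: "CHAR('k) > 0"
    and bracket_linear_left: "Vector_Spaces.linear scale scale (\<lambda>x. bracket x y)"
    and bracket_linear_right: "Vector_Spaces.linear scale scale (\<lambda>y. bracket x y)"
    and bracket_self: "bracket x x = 0"
    and jacobi: "bracket x (bracket y z) + bracket y (bracket z x) + bracket z (bracket x y) = 0"
    and ad_pmap: "bracket (pmap x) y = (bracket x ^^ CHAR('k)) y"
    and pmap_scale: "pmap (c *s x) = c ^ CHAR('k) *s pmap x"
    and pmap_add: "pmap (x + y) = pmap x + pmap y +
      (\<Sum>i = 1..CHAR('k) - 1.
         inverse (of_nat i) *s jacobson_coeff bracket x y (CHAR('k) - 1) (i - 1))"
begin

subsection \<open>Tori\<close>

definition p_subalgebra :: "'g set \<Rightarrow> bool" where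
  "p_subalgebra H \<longleftrightarrow> subspace H \<and> (\<forall>x\<in>H. \<forall>y\<in>H. bracket x y \<in> H) \<and> (\<forall>x\<in>H. pmap x \<in> H)"

definition semisimple :: "'g \<Rightarrow> bool" where
  "semisimple x \<longleftrightarrow> x \<in> p_subalgebra hull {pmap x}"

definition torus :: "'g set \<Rightarrow> bool" where
  "torus t \<longleftrightarrow> p_subalgebra t \<and> (\<forall>x\<in>t. \<forall>y\<in>t. bracket x y = 0) \<and> (\<forall>x\<in>t. semisimple x)"

definition max_torus_dim :: nat  (\<open>\<mu>\<close>) where
  "\<mu> = Max {dim t | t. torus t}"

definition Tor :: "'g set set" where
  "Tor = {t. torus t \<and> dim t = \<mu>}"

subsection \<open>Automorphisms and embeddings\<close>

definition hom_on :: "'g set \<Rightarrow> ('g \<Rightarrow> 'g) \<Rightarrow> bool" where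
  "hom_on A f \<longleftrightarrow>
     (\<forall>x\<in>A. \<forall>y\<in>A. f (x + y) = f x + f y) \<and> (\<forall>c. \<forall>x\<in>A. f (c *s x) = c *s f x) \<and>
     (\<forall>x\<in>A. \<forall>y\<in>A. f (bracket x y) = bracket (f x) (f y)) \<and> (\<forall>x\<in>A. f (pmap x) = pmap (f x))"

text \<open>Maps with domain \<open>A\<close> are represented by elements of \<^term>\<open>extensional A\<close>.\<close>

definition Autp :: "'g set \<Rightarrow> ('g \<Rightarrow> 'g) set" where
  "Autp A = {f \<in> Bij A. hom_on A f}"

abbreviation Autp_group :: "'g set \<Rightarrow> ('g \<Rightarrow> 'g) monoid" where
  "Autp_group A \<equiv> BijGroup A\<lparr>carrier := Autp A\<rparr>"

text \<open>
  Functions \<open>\<phi> \<mapsto> l (\<phi> i)\<close> for \<open>i \<in> I\<close> and linear forms \<open>l\<close>. For \<open>I\<close> a subspace they span the linear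
  forms on the space of linear maps \<open>I \<rightarrow> \<gg>\<close>; for \<open>I = {..<d}\<close> those on \<open>\<gg>\<^sup>d\<close>.
\<close>

definition eval_coords :: "'i set \<Rightarrow> (('i \<Rightarrow> 'g) \<Rightarrow> 'k) set" where
  "eval_coords I = {(\<lambda>\<phi>. l (\<phi> i)) | l i. i \<in> I \<and> Vector_Spaces.linear scale (*) l}"

text \<open>
  Every zero set on \<open>GL(\<gg>)\<close> of functions in the coordinate ring of \<open>GL(\<gg>)\<close>, i.e. matrix
  coefficients and \<open>1 / det\<close>, is also cut out by polynomials in the matrix coefficients alone.
\<close>

definition Aut_top :: "('g \<Rightarrow> 'g) topology" where
  "Aut_top = zariski (Autp UNIV) (eval_coords UNIV)"

definition G :: "('g \<Rightarrow> 'g) set" where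
  "G = connected_component_of_set Aut_top id"

definition embeddings :: "'g set \<Rightarrow> ('g \<Rightarrow> 'g) set" where
  "embeddings t = {\<phi> \<in> extensional t. hom_on t \<phi> \<and> inj_on \<phi> t}"

definition embeddings_top :: "'g set \<Rightarrow> ('g \<Rightarrow> 'g) topology" where
  "embeddings_top t = zariski (embeddings t) (eval_coords t)"

text \<open>The variety of embeddings of a torus of maximal dimension is smooth, so the component is unique.\<close>

definition X_comp :: "'g set \<Rightarrow> ('g \<Rightarrow> 'g) set" where
  "X_comp t = (THE C. C \<in> irreducible_components_of (embeddings_top t) \<and> (\<lambda>x\<in>t. x) \<in> C)"

definition Aut_act :: "'g set \<Rightarrow> ('g \<Rightarrow> 'g) \<Rightarrow> ('g \<Rightarrow> 'g) \<Rightarrow> ('g \<Rightarrow> 'g)" where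
  "Aut_act t h \<phi> = compose t \<phi> (inv\<^bsub>Autp_group t\<^esub> h)"

definition S :: "'g set \<Rightarrow> ('g \<Rightarrow> 'g) set" where
  "S t = {h \<in> Autp t. Aut_act t h ` X_comp t = X_comp t}"

abbreviation S_group :: "'g set \<Rightarrow> ('g \<Rightarrow> 'g) monoid" where
  "S_group t \<equiv> BijGroup t\<lparr>carrier := S t\<rparr>"

subsection \<open>Grassmannians and generic tori\<close>

definition Gr :: "nat \<Rightarrow> 'g set set" where
  "Gr d = {V. subspace V \<and> dim V = d}"

definition frames :: "nat \<Rightarrow> (nat \<Rightarrow> 'g) set" where
  "frames d = {v \<in> extensional {..<d}. inj_on v {..<d} \<and> independent (v ` {..<d})}"

text \<open>
  The Grassmannian carries the quotient topology of the space of frames by \<open>GL\<^sub>d\<close>; this is its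
  Zariski topology, as the quotient map from frames to subspaces is open and surjective.
\<close>

definition Gr_top :: "nat \<Rightarrow> 'g set topology" where
  "Gr_top d = topology (\<lambda>U. U \<subseteq> Gr d \<and>
     openin (zariski (frames d) (eval_coords {..<d})) {v \<in> frames d. span (v ` {..<d}) \<in> U})"

lemma openin_Gr_top:
  "openin (Gr_top d) U \<longleftrightarrow> U \<subseteq> Gr d \<and>
     openin (zariski (frames d) (eval_coords {..<d})) {v \<in> frames d. span (v ` {..<d}) \<in> U}"
proof -
  let ?Z = "zariski (frames d) (eval_coords {..<d})"
  let ?P = "\<lambda>U. {v \<in> frames d. span (v ` {..<d}) \<in> U}"
  have "istopology (\<lambda>U. U \<subseteq> Gr d \<and> openin ?Z (?P U))"
    unfolding istopology_def
  proof (intro conjI allI impI)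
    fix U V
    assume *: "U \<subseteq> Gr d \<and> openin ?Z (?P U)" "V \<subseteq> Gr d \<and> openin ?Z (?P V)"
    then show "U \<inter> V \<subseteq> Gr d" by blast
    have "?P (U \<inter> V) = ?P U \<inter> ?P V" by blast
    with * show "openin ?Z (?P (U \<inter> V))" by auto
  next
    fix \<K> assume *: "\<forall>K\<in>\<K>. K \<subseteq> Gr d \<and> openin ?Z (?P K)"
    then show "\<Union>\<K> \<subseteq> Gr d" by blast
    have "?P (\<Union>\<K>) = \<Union>(?P ` \<K>)" by blast
    with * show "openin ?Z (?P (\<Union>\<K>))" by auto
  qed
  then show ?thesis unfolding Gr_top_def by (simp add: topology_inverse')
qed

lemma span_frame_in_Gr: "v \<in> frames d \<Longrightarrow> span (v ` {..<d}) \<in> Gr d"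
  by (auto simp: frames_def Gr_def dim_eq_card_independent card_image)

lemma topspace_Gr_top [simp]: "topspace (Gr_top d) = Gr d"
proof -
  have "{v \<in> frames d. span (v ` {..<d}) \<in> Gr d} = topspace (zariski (frames d) (eval_coords {..<d}))"
    using span_frame_in_Gr by auto
  then have "openin (Gr_top d) (Gr d)"
    unfolding openin_Gr_top by (simp del: topspace_zariski)
  then show ?thesis
    unfolding topspace_def using openin_Gr_top by blast
qed

definition generic_torus :: "'g set \<Rightarrow> bool" where
  "generic_torus t \<longleftrightarrow> t \<in> Tor \<and>
     subtopology (Gr_top \<mu>) Tor closure_of ((\<lambda>g. g ` t) ` G) = Tor"

subsection \<open>Weyl groups\<close>

definition Nor :: "'g set \<Rightarrow> ('g \<Rightarrow> 'g) set" where
  "Nor t = {g \<in> G. g ` t = t}"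

definition Cent :: "'g set \<Rightarrow> ('g \<Rightarrow> 'g) set" where
  "Cent t = {g \<in> G. \<forall>x\<in>t. g x = x}"

abbreviation Nor_group :: "'g set \<Rightarrow> ('g \<Rightarrow> 'g) monoid" where
  "Nor_group t \<equiv> BijGroup UNIV\<lparr>carrier := Nor t\<rparr>"

definition W :: "'g set \<Rightarrow> ('g \<Rightarrow> 'g) set monoid" where
  "W t = Nor_group t Mod Cent t"

subsection \<open>The group structures are well defined\<close>

lemma Autp_subgroup:
  assumes "p_subalgebra A"
  shows "subgroup (Autp A) (BijGroup A)"
proof (rule group.subgroupI[OF group_BijGroup])
  note A = assms[unfolded p_subalgebra_def]
  show "Autp A \<subseteq> carrier (BijGroup A)" by (auto simp: Autp_def BijGroup_def)
  have "(\<lambda>x\<in>A. x) \<in> Autp A"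
    using A subspace_add[of A] subspace_scale[of A] id_Bij[of A]
    by (auto simp: Autp_def hom_on_def)
  then show "Autp A \<noteq> {}" by blast
  fix f assume "f \<in> Autp A"
  then have f: "f \<in> Bij A" "hom_on A f" by (auto simp: Autp_def)
  have ff: "f ` A = A" "inj_on f A" using f(1) by (auto simp: Bij_def bij_betw_def)
  let ?g = "restrict (inv_into A f) A"
  have g: "?g x \<in> A" "f (?g x) = x" if "x \<in> A" for x
    using that ff by (auto simp: inv_into_into f_inv_into_f)
  have gf: "?g y = x" if "x \<in> A" "f x = y" for x y
    using that ff by auto
  have "hom_on A ?g"
    unfolding hom_on_def
    using A f(2)[unfolded hom_on_def] g subspace_add[of A] subspace_scale[of A]
    by (intro conjI ballI allI gf) auto
  then show "inv\<^bsub>BijGroup A\<^esub> f \<in> Autp A"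
    using f(1) by (simp add: inv_BijGroup Autp_def restrict_inv_into_Bij)
  fix h assume "h \<in> Autp A"
  then have h: "h \<in> Bij A" "hom_on A h" by (auto simp: Autp_def)
  have hA: "\<And>x. x \<in> A \<Longrightarrow> h x \<in> A" using h(1) by (auto simp: Bij_def bij_betw_def)
  have "hom_on A (compose A f h)"
    using A f(2) h(2) hA subspace_add[of A] subspace_scale[of A]
    by (auto simp: hom_on_def compose_def)
  then show "f \<otimes>\<^bsub>BijGroup A\<^esub> h \<in> Autp A"
    using f(1) h(1) by (simp add: BijGroup_def Autp_def compose_Bij)
qed

lemma group_Autp: "p_subalgebra A \<Longrightarrow> group (Autp_group A)"
  by (rule subgroup.subgroup_is_group[OF Autp_subgroup group_BijGroup])

lemma Bij_UNIV: "Bij UNIV = {f. bij f}"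
  by (auto simp: Bij_def)

lemma BijGroup_UNIV [simp]:
  "carrier (BijGroup (UNIV :: 'g set)) = {f. bij f}"
  "\<one>\<^bsub>BijGroup (UNIV :: 'g set)\<^esub> = id"
  "bij f \<Longrightarrow> bij g \<Longrightarrow> f \<otimes>\<^bsub>BijGroup UNIV\<^esub> g = f \<circ> (g :: 'g \<Rightarrow> 'g)"
  "bij f \<Longrightarrow> inv\<^bsub>BijGroup UNIV\<^esub> f = inv_into UNIV (f :: 'g \<Rightarrow> 'g)"
proof -
  show "bij f \<Longrightarrow> inv\<^bsub>BijGroup UNIV\<^esub> f = inv_into UNIV (f :: 'g \<Rightarrow> 'g)"
    using inv_BijGroup[of f UNIV] by (simp add: Bij_UNIV restrict_def)
qed (auto simp: BijGroup_def Bij_UNIV compose_def restrict_def)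

lemma p_subalgebra_UNIV: "p_subalgebra UNIV"
  by (simp add: p_subalgebra_def)

lemma Autp_UNIV:
  "id \<in> Autp UNIV"
  "f \<in> Autp UNIV \<Longrightarrow> bij f"
  "f \<in> Autp UNIV \<Longrightarrow> Vector_Spaces.linear scale scale f"
  "f \<in> Autp UNIV \<Longrightarrow> g \<in> Autp UNIV \<Longrightarrow> f \<circ> g \<in> Autp UNIV"
  "f \<in> Autp UNIV \<Longrightarrow> inv_into UNIV f \<in> Autp UNIV"
proof -
  note sg = Autp_subgroup[OF p_subalgebra_UNIV]
  show "id \<in> Autp UNIV" using subgroup.one_closed[OF sg] by simp
  show b: "bij f" if "f \<in> Autp UNIV" for f using that by (simp add: Autp_def Bij_UNIV)
  show "Vector_Spaces.linear scale scale f" if "f \<in> Autp UNIV"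
    using that by (simp add: Vector_Spaces.linear_iff vector_space_axioms Autp_def hom_on_def)
  show "f \<circ> g \<in> Autp UNIV" if "f \<in> Autp UNIV" "g \<in> Autp UNIV"
    using subgroup.m_closed[OF sg that] b that by simp
  show "inv_into UNIV f \<in> Autp UNIV" if "f \<in> Autp UNIV"
    using subgroup.m_inv_closed[OF sg that] b that by simp
qed

lemma G_subset: "G \<subseteq> Autp UNIV"
  using connected_component_of_subset_topspace[of Aut_top id] by (simp add: G_def Aut_top_def)

lemma id_in_G: "id \<in> G"
  by (simp add: G_def connected_component_of_refl Aut_top_def Autp_UNIV)

lemma G_translate:
  assumes a: "a \<in> Autp UNIV" and b: "b \<in> G" "a \<circ> b \<in> G" and c: "c \<in> G"
  shows "a \<circ> c \<in> G"
proof -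
  have "continuous_map Aut_top Aut_top (\<lambda>f. a \<circ> f)"
    unfolding Aut_top_def
  proof (rule continuous_map_zariski)
    show "(\<lambda>f. a \<circ> f) \<in> Autp UNIV \<rightarrow> Autp UNIV" using a Autp_UNIV(4) by blast
    fix q assume "q \<in> eval_coords (UNIV :: 'g set)"
    then obtain l x where q: "q = (\<lambda>\<phi>. l (\<phi> x))" "Vector_Spaces.linear scale (*) l"
      by (auto simp: eval_coords_def)
    have "Vector_Spaces.linear scale (*) (l \<circ> a)"
      by (rule Vector_Spaces.linear_compose[OF Autp_UNIV(3)[OF a] q(2)])
    then have "(\<lambda>\<phi>. (l \<circ> a) (\<phi> x)) \<in> eval_coords (UNIV :: 'g set)"
      unfolding eval_coords_def by blast
    then show "q \<circ> (\<lambda>f. a \<circ> f) \<in> polyfuns (eval_coords (UNIV :: 'g set))"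
      using q(1) by (auto simp: o_def intro: polyfuns_coord)
  qed
  moreover have "connectedin Aut_top G"
    unfolding G_def by (rule connectedin_connected_component_of)
  ultimately have "connectedin Aut_top ((\<lambda>f. a \<circ> f) ` G)"
    by (rule connectedin_continuous_map_image)
  then have "connected_component_of Aut_top (a \<circ> b) (a \<circ> c)"
    unfolding connected_component_of_def using b c by blast
  with b(2) show ?thesis
    unfolding G_def by (auto intro: connected_component_of_trans)
qed

lemma G_subgroup: "subgroup G (BijGroup UNIV)"
proof (rule group.subgroupI[OF group_BijGroup])
  show "G \<subseteq> carrier (BijGroup UNIV)" using G_subset Autp_UNIV(2) by auto
  show "G \<noteq> {}" using id_in_G by blast
  fix a assume a: "a \<in> G"
  then have a': "a \<in> Autp UNIV" "bij a" using G_subset Autp_UNIV(2) by auto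
  have "inv_into UNIV a \<circ> a = id" using a'(2) by (simp add: bij_is_inj)
  then show "inv\<^bsub>BijGroup UNIV\<^esub> a \<in> G"
    using G_translate[OF Autp_UNIV(5)[OF a'(1)] a _ id_in_G] id_in_G a'(2) by simp
  fix b assume b: "b \<in> G"
  then have "bij b" using G_subset Autp_UNIV(2) by auto
  then show "a \<otimes>\<^bsub>BijGroup UNIV\<^esub> b \<in> G"
    using G_translate[OF a'(1) id_in_G _ b] a a'(2) by simp
qed

lemma Nor_subgroup: "subgroup (Nor t) (BijGroup UNIV)"
proof (rule group.subgroupI[OF group_BijGroup])
  note sg = G_subgroup
  show "Nor t \<subseteq> carrier (BijGroup UNIV)"
    using subgroup.subset[OF sg] by (auto simp: Nor_def)
  show "Nor t \<noteq> {}" using id_in_G by (auto simp: Nor_def)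
  fix a assume a: "a \<in> Nor t"
  then have aG: "a \<in> G" "a ` t = t" by (auto simp: Nor_def)
  have ba: "bij a" using G_subset Autp_UNIV(2) aG by blast
  have "inv_into UNIV a ` t = inv_into UNIV a ` a ` t" using aG by simp
  also have "\<dots> = t" using ba by (simp add: image_comp bij_is_inj)
  finally show "inv\<^bsub>BijGroup UNIV\<^esub> a \<in> Nor t"
    using subgroup.m_inv_closed[OF sg aG(1)] ba by (simp add: Nor_def)
  fix b assume b: "b \<in> Nor t"
  then have bG: "b \<in> G" "b ` t = t" by (auto simp: Nor_def)
  have bb: "bij b" using G_subset Autp_UNIV(2) bG by blast
  have "(a \<circ> b) ` t = t" unfolding image_comp[symmetric] aG(2) bG(2) ..
  then show "a \<otimes>\<^bsub>BijGroup UNIV\<^esub> b \<in> Nor t"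
    using subgroup.m_closed[OF sg aG(1) bG(1)] ba bb
    by (simp add: Nor_def)
qed

lemma group_Nor: "group (Nor_group t)"
  by (rule subgroup.subgroup_is_group[OF Nor_subgroup group_BijGroup])

lemma Nor_bij: "a \<in> Nor t \<Longrightarrow> bij a"
  using G_subset Autp_UNIV(2) by (auto simp: Nor_def)

lemma Cent_normal: "Cent t \<lhd> Nor_group t"
proof -
  interpret N: group "Nor_group t" by (rule group_Nor)
  have sub: "Cent t \<subseteq> Nor t" by (auto simp: Cent_def Nor_def)
  have invN: "inv\<^bsub>Nor_group t\<^esub> a = inv_into UNIV a" if "a \<in> Nor t" for a
    using group.m_inv_consistent[OF group_BijGroup Nor_subgroup that] Nor_bij[OF that] by simp
  have mulN: "a \<otimes>\<^bsub>Nor_group t\<^esub> b = a \<circ> b" if "a \<in> Nor t" "b \<in> Nor t" for a b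
    using that Nor_bij by simp
  have closed: "inv_into UNIV a \<in> Nor t" "a \<circ> b \<in> Nor t" if "a \<in> Nor t" "b \<in> Nor t" for a b
    using N.inv_closed[of a] N.m_closed[of a b] invN[OF that(1)] mulN[OF that] that by auto
  show ?thesis
  proof (rule N.normalI)
    show "subgroup (Cent t) (Nor_group t)"
    proof (rule N.subgroupI)
      show "Cent t \<subseteq> carrier (Nor_group t)" using sub by simp
      show "Cent t \<noteq> {}" using id_in_G by (auto simp: Cent_def)
      fix a assume a: "a \<in> Cent t"
      then have aN: "a \<in> Nor t" using sub by blast
      have "inv_into UNIV a x = x" if "x \<in> t" for x
        using a that Nor_bij[OF aN] by (auto simp: Cent_def bij_is_inj inv_f_eq)
      then show "inv\<^bsub>Nor_group t\<^esub> a \<in> Cent t"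
        using closed(1)[OF aN aN] invN[OF aN] by (auto simp: Cent_def Nor_def)
      fix b assume b: "b \<in> Cent t"
      then have bN: "b \<in> Nor t" using sub by blast
      show "a \<otimes>\<^bsub>Nor_group t\<^esub> b \<in> Cent t"
        using a b closed(2)[OF aN bN] mulN[OF aN bN] by (auto simp: Cent_def Nor_def)
    qed
    show "\<forall>x\<in>carrier (Nor_group t). Cent t #>\<^bsub>Nor_group t\<^esub> x = x <#\<^bsub>Nor_group t\<^esub> Cent t"
    proof
      fix x assume "x \<in> carrier (Nor_group t)"
      then have x: "x \<in> Nor t" by simp
      have bx: "bij x" by (rule Nor_bij[OF x])
      have xt: "x ` t = t" using x by (simp add: Nor_def)
      have ix: "inv_into UNIV x \<in> Nor t" by (rule closed(1)[OF x x])
      have ixt: "inv_into UNIV x ` t = t" using ix by (simp add: Nor_def)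
      have c1: "inv_into UNIV x \<circ> c \<circ> x \<in> Cent t" "x \<circ> c \<circ> inv_into UNIV x \<in> Cent t" if c: "c \<in> Cent t" for c
      proof -
        have cN: "c \<in> Nor t" using c sub by blast
        have "inv_into UNIV x \<circ> c \<circ> x \<in> G" "x \<circ> c \<circ> inv_into UNIV x \<in> G"
          using closed(2)[OF closed(2)[OF ix cN] x] closed(2)[OF closed(2)[OF x cN] ix]
          by (auto simp: Nor_def)
        moreover have "(inv_into UNIV x \<circ> c \<circ> x) y = y" "(x \<circ> c \<circ> inv_into UNIV x) y = y" if "y \<in> t" for y
        proof -
          have "x y \<in> t" "inv_into UNIV x y \<in> t" using that xt ixt by blast+
          then show "(inv_into UNIV x \<circ> c \<circ> x) y = y" "(x \<circ> c \<circ> inv_into UNIV x) y = y"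
            using c bx by (auto simp: Cent_def bij_is_inj bij_is_surj surj_f_inv_f)
        qed
        ultimately show "inv_into UNIV x \<circ> c \<circ> x \<in> Cent t" "x \<circ> c \<circ> inv_into UNIV x \<in> Cent t"
          by (auto simp: Cent_def)
      qed
      have eq: "c \<circ> x = x \<circ> (inv_into UNIV x \<circ> c \<circ> x)" "x \<circ> c = (x \<circ> c \<circ> inv_into UNIV x) \<circ> x" for c
        using bx by (auto simp: fun_eq_iff bij_is_inj bij_is_surj surj_f_inv_f)
      have L: "Cent t #>\<^bsub>Nor_group t\<^esub> x = (\<lambda>c. c \<circ> x) ` Cent t"
        using mulN x sub by (auto simp: r_coset_def image_iff subset_iff)
      have R: "x <#\<^bsub>Nor_group t\<^esub> Cent t = (\<lambda>c. x \<circ> c) ` Cent t"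
        using mulN x sub by (auto simp: l_coset_def image_iff subset_iff)
      show "Cent t #>\<^bsub>Nor_group t\<^esub> x = x <#\<^bsub>Nor_group t\<^esub> Cent t"
        unfolding L R using c1 eq by blast
    qed
  qed
qed

lemma group_W: "group (W t)"
  unfolding W_def by (rule normal.factorgroup_is_group[OF Cent_normal])

end

end

theory Submission
  imports
    Defs
    "HOL-Library.Function_Algebras"
    "Jordan_Normal_Form.Determinant"
begin

text \<open>
  The group \<open>G\<close> is irreducible, hence so is the closure \<open>X0\<close> of the \<open>G\<close>-orbit of the inclusion of
  \<open>t\<close>. By genericity the embeddings of \<open>t\<close> with image in \<open>G \<cdot> t\<close> are dense among all embeddings.
  Indeed, relative to a frame of its image, an embedding is a tuple \<open>c\<close> of coefficients of toral
  elements, which satisfies equations expressing \<open>c\<^sup>p\<close> linearly in \<open>c\<close>. A polynomial function can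
  thus be reduced to degree less than \<open>p\<close> in each coefficient, and as a torus of dimension \<open>d\<close>
  carries \<open>p\<^sup>d\<close> toral elements, the reduced function vanishes on all tuples over a torus only if
  its coefficients vanish at the frame. So a function vanishing over the dense set \<open>G \<cdot> t\<close> vanishes.

  The embeddings with image in \<open>G \<cdot> t\<close> form the finitely many \<open>G\<close>-orbits of automorphisms of \<open>t\<close>, so
  the variety of embeddings is covered by the translates of \<open>X0\<close> under \<open>Aut\<^sub>p(t)\<close>, and \<open>X0\<close> is the
  component of the inclusion. If \<open>h\<close> stabilizes \<open>X0\<close>, the \<open>G\<close>-orbits of the inclusion and of its
  translate by \<open>h\<close> are both dense in \<open>X0\<close>. They are constructible, so they meet, and
  \<open>h\<close> is the restriction of an element of \<open>G\<close>. The converse is immediate.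
\<close>

section \<open>Algebras of polynomial functions\<close>

text \<open>Genericity is density among subspaces, in the Grassmannian, whereas
  \<open>X_comp\<close> lives in the space of embeddings. Density of a set of tori lifts to the
  embeddings only if passing from an embedding to its image is open in a suitable sense, and the
  reduction modulo the p-th power equations is an explicit substitute for that openness. It rests on
  an exact count: a d-tuple of toral elements has d * d coefficients, so there are p^(d * d) reduced
  monomials, and a torus of dimension d carries equally many such tuples; evaluation at the tuples
  therefore determines every coefficient. The count must admit all tuples, also the linearly
  dependent ones, which define no embedding; a determinant factor makes the function vanish there.
  Solving for the p-th powers costs a second determinant, which is 1 at the frame under
  consideration because the members of that frame are toral. Algebraic closedness serves two
  purposes: it provides a toral basis of every torus, and it allows the elimination of quantifiers
  by which orbits become constructible.\<close>

lemma polyfuns_uminus: "f \<in> polyfuns F \<Longrightarrow> (\<lambda>x. - f x) \<in> polyfuns F"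
  using polyfuns_mult[OF polyfuns_const[of "-1"], of f] by simp

lemma polyfuns_diff:
  "f \<in> polyfuns F \<Longrightarrow> g \<in> polyfuns F \<Longrightarrow> (\<lambda>x. f x - g x) \<in> polyfuns F"
  using polyfuns_add[OF _ polyfuns_uminus, of f F g] by simp

lemma polyfuns_power: "f \<in> polyfuns F \<Longrightarrow> (\<lambda>x. f x ^ n) \<in> polyfuns F"
  by (induction n) (auto intro: polyfuns_const polyfuns_mult)

lemma polyfuns_sum:
  "(\<And>i. i \<in> A \<Longrightarrow> f i \<in> polyfuns F) \<Longrightarrow> (\<lambda>x. \<Sum>i\<in>A. f i x) \<in> polyfuns F"
  by (induction A rule: infinite_finite_induct) (auto intro: polyfuns_const polyfuns_add)

lemma polyfuns_prod:
  "(\<And>i. i \<in> A \<Longrightarrow> f i \<in> polyfuns F) \<Longrightarrow> (\<lambda>x. \<Prod>i\<in>A. f i x) \<in> polyfuns F"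
  by (induction A rule: infinite_finite_induct) (auto intro: polyfuns_const polyfuns_mult)

lemma polyfuns_if:
  "f \<in> polyfuns F \<Longrightarrow> g \<in> polyfuns F \<Longrightarrow> (\<lambda>x. if b then f x else g x) \<in> polyfuns F"
  by (cases b) auto

lemmas polyfuns_intros =
  polyfuns_const polyfuns_add polyfuns_mult polyfuns_uminus polyfuns_diff polyfuns_power
  polyfuns_sum polyfuns_prod polyfuns_if

lemma polyfuns_mono: "F \<subseteq> F' \<Longrightarrow> f \<in> polyfuns F \<Longrightarrow> f \<in> polyfuns F'"
  using polyfuns_comp[of f F id F'] by (auto simp: o_def intro: polyfuns_coord)

lemma polyfuns_subst:
  "f \<in> polyfuns F \<Longrightarrow> (\<And>c. c \<in> F \<Longrightarrow> (\<lambda>x. c (a x)) \<in> polyfuns F') \<Longrightarrow> (\<lambda>x. f (a x)) \<in> polyfuns F'"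
  using polyfuns_comp[of f F a F'] by (simp add: o_def)

section \<open>Univariate polynomials over an algebra of functions\<close>

text \<open>A pointwise stand-in for an element of A[T] with A = \<open>polyfuns F\<close>. The
  bound \<open>n\<close> is strict and formal: the true degree may drop at points where a leading
  coefficient vanishes, and \<open>n = 0\<close> forces the zero polynomial.\<close>

definition poly_family :: "('x \<Rightarrow> 'k::field) set \<Rightarrow> nat \<Rightarrow> ('x \<Rightarrow> 'k poly) \<Rightarrow> bool" where
  "poly_family F n P \<longleftrightarrow>
     (\<forall>i. (\<lambda>x. coeff (P x) i) \<in> polyfuns F) \<and> (\<forall>x. \<forall>i\<ge>n. coeff (P x) i = 0)"

lemma poly_family_coeff: "poly_family F n P \<Longrightarrow> (\<lambda>x. coeff (P x) i) \<in> polyfuns F"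
  and poly_family_bound: "poly_family F n P \<Longrightarrow> i \<ge> n \<Longrightarrow> coeff (P x) i = 0"
  by (auto simp: poly_family_def)

lemma poly_family_mono: "poly_family F n P \<Longrightarrow> n \<le> m \<Longrightarrow> poly_family F m P"
  by (auto simp: poly_family_def)

lemma poly_family_const: "a \<in> polyfuns F \<Longrightarrow> poly_family F 1 (\<lambda>x. [:a x:])"
  unfolding poly_family_def
proof (intro conjI allI impI)
  fix i assume a: "a \<in> polyfuns F"
  show "(\<lambda>x. coeff [:a x:] i) \<in> polyfuns F"
    using a by (cases i) (auto intro: polyfuns_const)
qed (simp add: coeff_eq_0)

lemma poly_family_X: "poly_family F 2 (\<lambda>x. [:0, 1:])"
  by (auto simp: poly_family_def intro: polyfuns_const coeff_eq_0)

lemma poly_family_add: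
  "poly_family F n P \<Longrightarrow> poly_family F m Q \<Longrightarrow> poly_family F (max n m) (\<lambda>x. P x + Q x)"
  by (auto simp: poly_family_def intro: polyfuns_add)

lemma poly_family_diff:
  "poly_family F n P \<Longrightarrow> poly_family F m Q \<Longrightarrow> poly_family F (max n m) (\<lambda>x. P x - Q x)"
  by (auto simp: poly_family_def intro: polyfuns_diff)

lemma poly_family_mult:
  assumes "poly_family F n P" "poly_family F m Q"
  shows "poly_family F (n + m) (\<lambda>x. P x * Q x)"
  unfolding poly_family_def
proof (intro conjI allI impI)
  show "(\<lambda>x. coeff (P x * Q x) i) \<in> polyfuns F" for i
    unfolding coeff_mult using assms by (intro polyfuns_intros poly_family_coeff)
  fix x i assume i: "i \<ge> n + m"
  have "coeff (P x) j * coeff (Q x) (i - j) = 0" if "j \<le> i" for j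
    using poly_family_bound[OF assms(1), of j x] poly_family_bound[OF assms(2), of "i - j" x] i
    by (cases "j \<ge> n") auto
  then show "coeff (P x * Q x) i = 0" unfolding coeff_mult by (intro sum.neutral) auto
qed

lemma poly_family_smult:
  "a \<in> polyfuns F \<Longrightarrow> poly_family F n P \<Longrightarrow> poly_family F n (\<lambda>x. Polynomial.smult (a x) (P x))"
  by (auto simp: poly_family_def intro: polyfuns_mult)

lemma poly_family_power:
  "poly_family F n P \<Longrightarrow> \<exists>m. poly_family F m (\<lambda>x. P x ^ k)"
proof (induction k)
  case 0
  then show ?case using poly_family_const[OF polyfuns_const[of 1]] by (auto simp: one_pCons)
next
  case (Suc k)
  then obtain m where "poly_family F m (\<lambda>x. P x ^ k)" by blast
  from poly_family_mult[OF Suc.prems this] show ?case by auto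
qed

lemma poly_family_monom_mult:
  assumes "poly_family F n P"
  shows "poly_family F (k + n) (\<lambda>x. monom 1 k * P x)"
  unfolding poly_family_def
proof (intro conjI allI impI)
  show "(\<lambda>x. coeff (monom 1 k * P x) i) \<in> polyfuns F" for i
    using poly_family_coeff[OF assms, of "i - k"]
    by (cases "i < k") (simp_all add: coeff_monom_mult polyfuns_const)
qed (use assms in \<open>auto simp: poly_family_def coeff_monom_mult\<close>)

text \<open>Being polynomial in one distinguished quantity \<open>y x s\<close> is stable under the
  ring operations, so it suffices to check generators. The quantity is the adjoined generator in the
  basis theorem and a free scalar \<open>s\<close> in the elimination of coordinates.\<close>

lemma polyfuns_extend_coord:
  assumes "f \<in> polyfuns F'"
    and "\<And>c. c \<in> F' \<Longrightarrow> \<exists>n P. poly_family F n P \<and> (\<forall>x s. c (a x s) = poly (P x) (y x s))"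
  shows "\<exists>n P. poly_family F n P \<and> (\<forall>x s. f (a x s) = poly (P x) (y x s))"
  using assms(1)
proof induction
  case (polyfuns_const c)
  then show ?case
    using poly_family_const[OF polyfuns.polyfuns_const[of c F]]
    by (intro exI[of _ 1] exI[of _ "\<lambda>_. [:c:]"]) simp
next
  case (polyfuns_coord f)
  then show ?case by (rule assms(2))
next
  case (polyfuns_add f g)
  then obtain n P m Q where "poly_family F n P" "poly_family F m Q"
    "\<forall>x s. f (a x s) = poly (P x) (y x s)" "\<forall>x s. g (a x s) = poly (Q x) (y x s)" by blast
  then show ?case
    by (intro exI[of _ "max n m"] exI[of _ "\<lambda>x. P x + Q x"]) (simp add: poly_family_add)
next
  case (polyfuns_mult f g)
  then obtain n P m Q where "poly_family F n P" "poly_family F m Q"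
    "\<forall>x s. f (a x s) = poly (P x) (y x s)" "\<forall>x s. g (a x s) = poly (Q x) (y x s)" by blast
  then show ?case
    by (intro exI[of _ "n + m"] exI[of _ "\<lambda>x. P x * Q x"]) (simp add: poly_family_mult)
qed


subsection \<open>Hilbert's basis theorem\<close>

inductive_set ideal_gen :: "('x \<Rightarrow> 'k::field) set \<Rightarrow> ('x \<Rightarrow> 'k) set \<Rightarrow> ('x \<Rightarrow> 'k) set"
  for A B :: "('x \<Rightarrow> 'k) set"
where
  ideal_gen_zero: "(\<lambda>_. 0) \<in> ideal_gen A B"
| ideal_gen_step: "u \<in> A \<Longrightarrow> b \<in> B \<Longrightarrow> f \<in> ideal_gen A B \<Longrightarrow> (\<lambda>x. u x * b x + f x) \<in> ideal_gen A B"

lemma ideal_gen_mono: "B \<subseteq> B' \<Longrightarrow> f \<in> ideal_gen A B \<Longrightarrow> f \<in> ideal_gen A B'"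
  by (rotate_tac 1, induction rule: ideal_gen.induct) (auto intro: ideal_gen.intros)

lemma ideal_gen_add: "f \<in> ideal_gen A B \<Longrightarrow> g \<in> ideal_gen A B \<Longrightarrow> (\<lambda>x. f x + g x) \<in> ideal_gen A B"
proof (induction rule: ideal_gen.induct)
  case (ideal_gen_step u b f)
  then have "(\<lambda>x. u x * b x + (f x + g x)) \<in> ideal_gen A B"
    by (intro ideal_gen.ideal_gen_step) auto
  then show ?case by (simp add: add.assoc)
qed simp

lemma ideal_gen_mult:
  assumes "v \<in> polyfuns F"
  shows "f \<in> ideal_gen (polyfuns F) B \<Longrightarrow> (\<lambda>x. v x * f x) \<in> ideal_gen (polyfuns F) B"
proof (induction rule: ideal_gen.induct)
  case ideal_gen_zero
  then show ?case by (simp add: ideal_gen.ideal_gen_zero)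
next
  case (ideal_gen_step u b f)
  have "(\<lambda>x. (v x * u x) * b x + v x * f x) \<in> ideal_gen (polyfuns F) B"
    using ideal_gen_step assms by (intro ideal_gen.ideal_gen_step) (auto intro: polyfuns_mult)
  then show ?case by (simp add: algebra_simps)
qed

lemma ideal_gen_base: "b \<in> B \<Longrightarrow> b \<in> ideal_gen (polyfuns F) B"
  using ideal_gen_step[OF polyfuns_const _ ideal_gen_zero, of b B 1 F] by simp

lemma ideal_gen_diff:
  assumes "f \<in> ideal_gen (polyfuns F) B" "g \<in> ideal_gen (polyfuns F) B"
  shows "(\<lambda>x. f x - g x) \<in> ideal_gen (polyfuns F) B"
  using ideal_gen_add[OF assms(1) ideal_gen_mult[OF polyfuns_const[of "-1"] assms(2)]] by simp

lemma ideal_gen_trans: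
  "f \<in> ideal_gen (polyfuns F) B \<Longrightarrow> B \<subseteq> ideal_gen (polyfuns F) C \<Longrightarrow> f \<in> ideal_gen (polyfuns F) C"
proof (induction rule: ideal_gen.induct)
  case (ideal_gen_step u b f)
  then show ?case by (intro ideal_gen_add ideal_gen_mult) auto
qed (rule ideal_gen_zero)

lemma ideal_gen_finite_subset:
  "f \<in> ideal_gen A B \<Longrightarrow> \<exists>C\<subseteq>B. finite C \<and> f \<in> ideal_gen A C"
proof (induction rule: ideal_gen.induct)
  case ideal_gen_zero
  then show ?case using ideal_gen.ideal_gen_zero by blast
next
  case (ideal_gen_step u b f)
  then obtain C where C: "C \<subseteq> B" "finite C" "f \<in> ideal_gen A C" by blast
  have "f \<in> ideal_gen A (insert b C)" using C(3) ideal_gen_mono by blast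
  then have "(\<lambda>x. u x * b x + f x) \<in> ideal_gen A (insert b C)"
    using ideal_gen_step(1) by (intro ideal_gen.ideal_gen_step) auto
  then show ?case using C ideal_gen_step(2) by (intro exI[of _ "insert b C"]) auto
qed

text \<open>The finitely many generators are taken from \<open>S\<close> itself, so that a system of
  equations can later be replaced by a finite subsystem.\<close>

definition noetherian_alg :: "('x \<Rightarrow> 'k::field) set \<Rightarrow> bool" where
  "noetherian_alg F \<longleftrightarrow>
     (\<forall>S\<subseteq>polyfuns F. \<exists>C\<subseteq>S. finite C \<and> S \<subseteq> ideal_gen (polyfuns F) C)"

lemma noetherian_alg_empty: "noetherian_alg ({} :: ('x \<Rightarrow> 'k::field) set)"
  unfolding noetherian_alg_def
proof (intro allI impI)
  fix S :: "('x \<Rightarrow> 'k) set" assume S: "S \<subseteq> polyfuns {}"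
  have const: "\<exists>c. f = (\<lambda>_. c)" if "f \<in> polyfuns {}" for f :: "'x \<Rightarrow> 'k"
    using that by induction auto
  show "\<exists>C\<subseteq>S. finite C \<and> S \<subseteq> ideal_gen (polyfuns {}) C"
  proof (cases "S \<subseteq> {\<lambda>_. 0}")
    case True
    then show ?thesis using ideal_gen_zero by (intro exI[of _ "{}"]) auto
  next
    case False
    then obtain f where f: "f \<in> S" "f \<noteq> (\<lambda>_. 0)" by blast
    then obtain c where c: "f = (\<lambda>_. c)" "c \<noteq> 0" using const S by blast
    have "g \<in> ideal_gen (polyfuns {}) {f}" if g: "g \<in> S" for g
    proof -
      obtain b where b: "g = (\<lambda>_. b)" using const S g by blast
      have "(\<lambda>x. (b / c) * f x) \<in> ideal_gen (polyfuns {}) {f}"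
        by (intro ideal_gen_mult ideal_gen_base polyfuns_const) auto
      then show ?thesis using b c by simp
    qed
    then show ?thesis using f(1) by (intro exI[of _ "{f}"]) auto
  qed
qed

text \<open>
  If an ideal is not finitely generated, choose successively elements \<open>f\<^sub>N\<close> of least degree in the
  last variable that do not lie in the ideal generated by their predecessors. The leading
  coefficients generate a finitely generated ideal, so some \<open>f\<^sub>N\<close> can be replaced by one of lower
  degree.
\<close>

lemma noetherian_alg_insert:
  fixes F :: "('x \<Rightarrow> 'k::field) set"
  assumes "noetherian_alg F"
  shows "noetherian_alg (insert y F)"
  unfolding noetherian_alg_def
proof (rule ccontr)
  let ?A = "polyfuns F" and ?B = "polyfuns (insert y F)"
  \<comment> \<open>The generator \<open>y\<close> may satisfy relations over \<open>F\<close>, so a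
    function has many representing polynomials. Degrees are minimised over all
    representations.\<close>
  define rep where "rep n f P \<longleftrightarrow> poly_family F n P \<and> (\<forall>x. f x = poly (P x) (y x))" for n f P
  have repB: "\<exists>n P. rep n f P" if f: "f \<in> ?B" for f
  proof -
    have "\<exists>n P. poly_family F n P \<and> (\<forall>x (s :: unit). f x = poly (P x) (y x))"
    proof (rule polyfuns_extend_coord[where a = "\<lambda>x _. x" and y = "\<lambda>x _. y x", OF f])
      fix c assume "c \<in> insert y F"
      then show "\<exists>n P. poly_family F n P \<and> (\<forall>x (s :: unit). c x = poly (P x) (y x))"
      proof (elim insertE)
        assume c: "c = y"
        show ?thesis
          unfolding c by (intro exI[of _ 2] exI[of _ "\<lambda>_. [:0,1:]"] conjI poly_family_X allI) simp
      next
        assume c: "c \<in> F"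
        show ?thesis
          by (intro exI[of _ 1] exI[of _ "\<lambda>x. [:c x:]"] conjI poly_family_const[OF polyfuns_coord[OF c]] allI) simp
      qed
    qed
    then show ?thesis unfolding rep_def by (elim exE conjE) (intro exI conjI, assumption, simp)
  qed
  assume "\<not> (\<forall>S\<subseteq>?B. \<exists>C\<subseteq>S. finite C \<and> S \<subseteq> ideal_gen ?B C)"
  then obtain S where S: "S \<subseteq> ?B" and nofg: "\<And>C. C \<subseteq> S \<Longrightarrow> finite C \<Longrightarrow> \<not> S \<subseteq> ideal_gen ?B C"
    unfolding not_all not_imp not_ex by (elim exE conjE) (rule that, assumption, simp)
  let ?J = "ideal_gen ?B S"
  have JB: "f \<in> ?B" if "f \<in> ?J" for f
    using that
  proof induction
    case (ideal_gen_step u b f)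
    then show ?case using subsetD[OF S] by (intro polyfuns_add polyfuns_mult) auto
  qed (rule polyfuns_const)
  \<comment> \<open>Generators taken from \<open>?J\<close> are no better than generators taken from
    \<open>S\<close>: each of them involves only finitely many elements of \<open>S\<close>.\<close>
  have ex: "\<exists>f. f \<in> ?J \<and> f \<notin> ideal_gen ?B C" if C: "finite C" "C \<subseteq> ?J" for C
  proof (rule ccontr)
    assume "\<not> ?thesis"
    then have sub: "?J \<subseteq> ideal_gen ?B C" by blast
    have "\<forall>c\<in>C. \<exists>D. D \<subseteq> S \<and> finite D \<and> c \<in> ideal_gen ?B D"
    proof
      fix c assume "c \<in> C"
      then have "c \<in> ?J" by (rule subsetD[OF C(2)])
      then show "\<exists>D. D \<subseteq> S \<and> finite D \<and> c \<in> ideal_gen ?B D"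
        by (rule ideal_gen_finite_subset)
    qed
    then obtain D where D: "\<And>c. c \<in> C \<Longrightarrow> D c \<subseteq> S \<and> finite (D c) \<and> c \<in> ideal_gen ?B (D c)"
      by metis
    let ?D = "\<Union>(D ` C)"
    have CD: "C \<subseteq> ideal_gen ?B ?D"
    proof
      fix c assume c: "c \<in> C"
      show "c \<in> ideal_gen ?B ?D"
        by (rule ideal_gen_mono[of "D c"]) (use D[OF c] c in auto)
    qed
    have "S \<subseteq> ideal_gen ?B ?D"
    proof
      fix g assume "g \<in> S"
      then have "g \<in> ideal_gen ?B C" using sub ideal_gen_base by blast
      then show "g \<in> ideal_gen ?B ?D" using CD by (rule ideal_gen_trans)
    qed
    then show False using nofg[of ?D] D C(1) by auto
  qed
  define good where "good C f n \<longleftrightarrow> f \<in> ?J \<and> f \<notin> ideal_gen ?B C \<and> (\<exists>P. rep n f P)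
     \<and> (\<forall>g m Q. g \<in> ?J \<and> g \<notin> ideal_gen ?B C \<and> rep m g Q \<longrightarrow> n \<le> m)" for C f n
  have goodD: "f \<in> ?J" "f \<notin> ideal_gen ?B C" "\<exists>P. rep n f P" if "good C f n" for C f n
    using that unfolding good_def by simp_all
  have good_le: "n \<le> m" if "good C f n" "g \<in> ?J" "g \<notin> ideal_gen ?B C" "rep m g Q" for C f n g m Q
  proof -
    have "\<forall>g m Q. g \<in> ?J \<and> g \<notin> ideal_gen ?B C \<and> rep m g Q \<longrightarrow> n \<le> m"
      using that(1) unfolding good_def by (elim conjE)
    then show ?thesis by (elim allE[of _ g] allE[of _ m] allE[of _ Q] impE) (intro conjI that)
  qed
  have good_ex: "\<exists>f n. good C f n" if C: "finite C" "C \<subseteq> ?J" for C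
  proof -
    let ?T = "\<lambda>n. \<exists>f P. f \<in> ?J \<and> f \<notin> ideal_gen ?B C \<and> rep n f P"
    obtain f where f: "f \<in> ?J" "f \<notin> ideal_gen ?B C" using ex[OF C] by (elim exE conjE) (rule that)
    obtain n P where P: "rep n f P" using repB[OF JB[OF f(1)]] by (elim exE) (rule that)
    have "?T n" by (rule exI[of _ f], rule exI[of _ P]) (intro conjI f P)
    then have "\<exists>n. ?T n" by (rule exI)
    then have "?T (LEAST n. ?T n)" by (rule LeastI_ex)
    then obtain f P where f: "f \<in> ?J" "f \<notin> ideal_gen ?B C" "rep (LEAST n. ?T n) f P"
      by (elim exE conjE) (rule that)
    have "(LEAST n. ?T n) \<le> m" if "g \<in> ?J \<and> g \<notin> ideal_gen ?B C \<and> rep m g Q" for g m Q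
      by (rule Least_le) (rule exI[of _ g], rule exI[of _ Q], rule that)
    then have "good C f (LEAST n. ?T n)"
      unfolding good_def by (intro conjI allI impI exI[of _ P] f)
    then show ?thesis by (intro exI)
  qed
  define nxt where "nxt C = (SOME f. \<exists>n. good C f n)" for C
  have nxt: "\<exists>n. good C (nxt C) n" if "finite C" "C \<subseteq> ?J" for C
    unfolding nxt_def using good_ex[OF that] by (rule someI_ex)
  define Cs where "Cs = rec_nat {} (\<lambda>_ C. insert (nxt C) C)"
  have Cs0: "Cs 0 = {}" and CsS: "Cs (Suc i) = insert (nxt (Cs i)) (Cs i)" for i
    by (simp_all add: Cs_def)
  have Cs: "finite (Cs i) \<and> Cs i \<subseteq> ?J" for i
  proof (induction i)
    case (Suc i)
    then have fin: "finite (Cs i)" and sub: "Cs i \<subseteq> ?J" by (rule conjunct1, rule conjunct2)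
    from nxt[OF fin sub] obtain m where m: "good (Cs i) (nxt (Cs i)) m" ..
    show ?case unfolding CsS using fin sub goodD(1)[OF m] by (intro conjI insert_subsetI) auto
  qed (simp add: Cs0)
  define f where "f i = nxt (Cs i)" for i
  have Cs_f: "Cs i = f ` {..<i}" for i
    by (induction i) (auto simp: Cs0 CsS f_def lessThan_Suc)
  have "\<forall>i. \<exists>n. good (Cs i) (f i) n" unfolding f_def
    by (intro allI nxt conjunct1[OF Cs] conjunct2[OF Cs])
  then obtain n where n: "\<And>i. good (Cs i) (f i) (n i)" by metis
  have "\<forall>i. \<exists>P. rep (n i) (f i) P" by (intro allI goodD(3)[OF n])
  then obtain P where P: "\<And>i. rep (n i) (f i) (P i)" by metis
  have npos: "n i > 0" for i
  proof (rule ccontr)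
    assume "\<not> n i > 0"
    then have "P i x = 0" for x
      using P[of i] by (intro poly_eqI) (auto simp: rep_def poly_family_def)
    then have "f i = (\<lambda>_. 0)" using P[of i] by (auto simp: rep_def)
    with goodD(2)[OF n, of i] show False by (simp add: ideal_gen_zero)
  qed
  \<comment> \<open>The later element avoids a larger ideal, hence competes for the minimum defining
    \<open>n i\<close>.\<close>
  have nmono: "n i \<le> n j" if "i \<le> j" for i j
  proof -
    have sub: "Cs i \<subseteq> Cs j" unfolding Cs_f by (rule image_mono) (use that in simp)
    have "f j \<notin> ideal_gen ?B (Cs i)"
    proof
      assume "f j \<in> ideal_gen ?B (Cs i)"
      from ideal_gen_mono[OF sub this] goodD(2)[OF n[of j]] show False by contradiction
    qed
    then show ?thesis by (rule good_le[OF n goodD(1)[OF n] _ P])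
  qed
  \<comment> \<open>Since \<open>n i\<close> is a strict bound, the formal leading coefficient sits
    in degree \<open>n i - 1\<close>.\<close>
  define a where "a i = (\<lambda>x. coeff (P i x) (n i - 1))" for i
  have aA: "a i \<in> ?A" for i
    unfolding a_def using P[of i] by (auto simp: rep_def intro: poly_family_coeff)
  then have "range a \<subseteq> ?A" by auto
  with assms have "\<exists>C\<subseteq>range a. finite C \<and> range a \<subseteq> ideal_gen ?A C"
    unfolding noetherian_alg_def by simp
  then obtain C where C: "C \<subseteq> range a" "finite C" "range a \<subseteq> ideal_gen ?A C" by (elim exE conjE)
  obtain I where I: "finite I" "C = a ` I" using C(1,2) by (metis finite_subset_image)
  \<comment> \<open>Inserting \<open>0\<close> gives the maximum a meaning when \<open>I\<close> is
    empty.\<close>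
  define N where "N = Suc (Max (insert 0 I))"
  have IN: "i < N" if "i \<in> I" for i using that I(1) by (auto simp: N_def less_Suc_eq_le)
  \<comment> \<open>A combination of leading coefficients is realised by the same combination of the
    \<open>f i\<close>, each shifted by a power of \<open>y\<close> so that all formal degrees
    become that of \<open>f N\<close>.\<close>
  have lift: "\<exists>g R. g \<in> ideal_gen ?B (Cs N) \<and> rep (n N) g R \<and> (\<forall>x. coeff (R x) (n N - 1) = b x)"
    if "b \<in> ideal_gen ?A C" for b
    using that
  proof induction
    case ideal_gen_zero
    have "rep (n N) (\<lambda>_. 0) (\<lambda>_. 0)" by (simp add: rep_def poly_family_def polyfuns_const)
    then show ?case using ideal_gen.ideal_gen_zero[of ?B "Cs N"]
      by (intro exI[of _ "\<lambda>_. 0"] conjI) auto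
  next
    case (ideal_gen_step u b h)
    then obtain g R where g: "g \<in> ideal_gen ?B (Cs N)" "rep (n N) g R"
      "\<And>x. coeff (R x) (n N - 1) = h x" by blast
    obtain i where i: "i \<in> I" "b = a i" using ideal_gen_step(2) I(2) by blast
    let ?k = "n N - n i"
    have nn: "?k + n i = n N" using nmono[of i N] IN[OF i(1)] by simp
    let ?R = "\<lambda>x. Polynomial.smult (u x) (monom 1 ?k * P i x) + R x"
    let ?g = "\<lambda>x. (u x * y x ^ ?k) * f i x + g x"
    have Pi: "poly_family F (n i) (P i)" using P by (simp add: rep_def)
    have "poly_family F (n N) (\<lambda>x. Polynomial.smult (u x) (monom 1 ?k * P i x))"
      using poly_family_smult[OF ideal_gen_step(1) poly_family_monom_mult[OF Pi]] nn by metis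
    then have "poly_family F (n N) ?R"
      using g(2) poly_family_add by (metis rep_def max.idem)
    moreover have "?g x = poly (?R x) (y x)" for x
      using g(2) P[of i] by (simp add: rep_def poly_monom)
    moreover have "?g \<in> ideal_gen ?B (Cs N)"
    proof (intro ideal_gen.ideal_gen_step g(1) polyfuns_mult polyfuns_power)
      show "u \<in> ?B" by (rule polyfuns_mono[OF subset_insertI ideal_gen_step(1)])
      show "f i \<in> Cs N" using IN[OF i(1)] by (auto simp: Cs_f)
    qed (auto intro: polyfuns_coord)
    moreover have "coeff (?R x) (n N - 1) = u x * b x + h x" for x
    proof -
      have "n N - 1 - ?k = n i - 1" "?k \<le> n N - 1" using nn npos[of i] by linarith+
      then show ?thesis using g(3) by (simp add: i(2) a_def coeff_monom_mult)
    qed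
    ultimately show ?case unfolding rep_def by (intro exI[of _ ?g] exI[of _ ?R]) auto
  qed
  from lift[OF subsetD[OF C(3) rangeI[of a N]]]
  obtain g R where g: "g \<in> ideal_gen ?B (Cs N)" "rep (n N) g R"
      "\<forall>x. coeff (R x) (n N - 1) = a N x"
    by (elim exE conjE)
  \<comment> \<open>The formal leading terms cancel, so the difference has a smaller bound than
    \<open>f N\<close> although it is still outside the ideal of the predecessors.\<close>
  let ?h = "\<lambda>x. f N x - g x" and ?H = "\<lambda>x. P N x - R x"
  have "coeff (?H x) i = 0" if "i \<ge> n N - 1" for x i
  proof (cases "i = n N - 1")
    case True
    then show ?thesis using g(3) by (simp add: a_def)
  next
    case False
    then have "i \<ge> n N" using that by simp
    then show ?thesis using g(2) P[of N] by (simp add: rep_def poly_family_def)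
  qed
  moreover have "poly_family F (n N) ?H"
    using poly_family_diff[of F "n N" "P N" "n N" R] g(2) P[of N] by (simp add: rep_def)
  ultimately have "poly_family F (n N - 1) ?H"
    unfolding poly_family_def by simp
  then have "rep (n N - 1) ?h ?H"
    using g(2) P[of N] by (simp add: rep_def)
  moreover have "?h \<notin> ideal_gen ?B (Cs N)"
  proof
    assume "?h \<in> ideal_gen ?B (Cs N)"
    from ideal_gen_add[OF this g(1)] have "f N \<in> ideal_gen ?B (Cs N)" by simp
    with goodD(2)[OF n] show False ..
  qed
  moreover have "?h \<in> ?J"
    by (intro ideal_gen_diff goodD(1)[OF n] ideal_gen_trans[OF g(1)] conjunct2[OF Cs])
  ultimately have "n N \<le> n N - 1" by (intro good_le[OF n[of N]])
  then show False using npos[of N] by simp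
qed

theorem hilbert_basis: "finite F \<Longrightarrow> noetherian_alg F"
  by (induction rule: finite_induct) (auto intro: noetherian_alg_empty noetherian_alg_insert)

section \<open>Zero loci cut out by finitely many equations\<close>

definition noetherian_locus :: "'x set \<Rightarrow> ('x \<Rightarrow> 'k::field) set \<Rightarrow> bool" where
  "noetherian_locus X F \<longleftrightarrow>
     (\<forall>S\<subseteq>polyfuns F. \<exists>C\<subseteq>S. finite C \<and> zero_locus X C = zero_locus X S)"

lemma noetherian_locusD:
  assumes "noetherian_locus X F" "S \<subseteq> polyfuns F"
  obtains C where "C \<subseteq> S" "finite C" "zero_locus X C = zero_locus X S"
  using assms unfolding noetherian_locus_def by metis

lemma noetherian_locus_finite:
  assumes "finite F"
  shows "noetherian_locus X F"
  unfolding noetherian_locus_def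
proof (intro allI impI)
  fix S assume "S \<subseteq> polyfuns F"
  then obtain C where C: "C \<subseteq> S" "finite C" "S \<subseteq> ideal_gen (polyfuns F) C"
    using hilbert_basis[OF assms] unfolding noetherian_alg_def by blast
  have van: "f x = 0" if "f \<in> ideal_gen (polyfuns F) C" "\<forall>g\<in>C. g x = 0" for f x
    using that by (induction rule: ideal_gen.induct) auto
  have "zero_locus X C = zero_locus X S"
    using subsetD[OF C(1)] van[OF subsetD[OF C(3)]] by (auto simp: zero_locus_def)
  with C show "\<exists>C\<subseteq>S. finite C \<and> zero_locus X C = zero_locus X S" by blast
qed

text \<open>Coordinate sets such as \<open>eval_coords UNIV\<close> are infinite, so the basis
  theorem does not apply to them directly. Equations are pulled back to a parametrising space with
  finitely many coordinates, thinned out there, and read again on the image.\<close>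

lemma noetherian_locus_image:
  assumes "noetherian_locus Y F'" "X \<subseteq> a ` Y"
    and "\<And>c. c \<in> F \<Longrightarrow> (\<lambda>y. c (a y)) \<in> polyfuns F'"
  shows "noetherian_locus X F"
  unfolding noetherian_locus_def
proof (intro allI impI)
  fix S assume S: "S \<subseteq> polyfuns F"
  let ?S = "(\<lambda>f y. f (a y)) ` S"
  have "?S \<subseteq> polyfuns F'"
    by (intro image_subsetI polyfuns_subst[OF _ assms(3)]) (rule subsetD[OF S])
  from noetherian_locusD[OF assms(1) this]
  obtain C where C: "C \<subseteq> ?S" "finite C" "zero_locus Y C = zero_locus Y ?S" .
  from finite_subset_image[OF C(2,1)]
  obtain D' where D': "D' \<subseteq> S" "finite D'" "C = (\<lambda>f y. f (a y)) ` D'" by (elim exE conjE)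
  define D where "D = D'"
  have D: "D \<subseteq> S" "finite D" "zero_locus Y ((\<lambda>f y. f (a y)) ` D) = zero_locus Y ?S"
    using D' C(3) by (simp_all add: D_def)
  have "zero_locus X D \<subseteq> zero_locus X S"
  proof
    fix x assume x: "x \<in> zero_locus X D"
    then obtain y where y: "y \<in> Y" "x = a y" using assms(2) by (auto simp: zero_locus_def)
    then have "y \<in> zero_locus Y ((\<lambda>f y. f (a y)) ` D)" using x by (auto simp: zero_locus_def)
    then have "y \<in> zero_locus Y ?S" using D(3) by simp
    then show "x \<in> zero_locus X S" using x y by (auto simp: zero_locus_def)
  qed
  moreover have "zero_locus X S \<subseteq> zero_locus X D" using D(1) by (auto simp: zero_locus_def)
  ultimately show "\<exists>C\<subseteq>S. finite C \<and> zero_locus X C = zero_locus X S" using D by blast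
qed

section \<open>Constructible sets\<close>

text \<open>Boolean combinations of equations in negation-free form. The sets live in the whole
  type; the variety in question is intersected with them separately.\<close>

inductive_set constructible :: "('x \<Rightarrow> 'k::field) set \<Rightarrow> 'x set set"
  for F :: "('x \<Rightarrow> 'k) set"
where
  constructible_zero: "f \<in> polyfuns F \<Longrightarrow> {x. f x = 0} \<in> constructible F"
| constructible_nonzero: "f \<in> polyfuns F \<Longrightarrow> {x. f x \<noteq> 0} \<in> constructible F"
| constructible_Un: "C \<in> constructible F \<Longrightarrow> D \<in> constructible F \<Longrightarrow> C \<union> D \<in> constructible F"
| constructible_Int: "C \<in> constructible F \<Longrightarrow> D \<in> constructible F \<Longrightarrow> C \<inter> D \<in> constructible F"

lemma constructible_empty: "{} \<in> constructible F"
  using constructible_nonzero[OF polyfuns_const, of 0 F] by simp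

lemma constructible_UNIV: "UNIV \<in> constructible F"
  using constructible_zero[OF polyfuns_const, of 0 F] by simp

lemma constructible_UN:
  "finite I \<Longrightarrow> (\<And>i. i \<in> I \<Longrightarrow> C i \<in> constructible F) \<Longrightarrow> (\<Union>i\<in>I. C i) \<in> constructible F"
  by (induction rule: finite_induct) (auto intro: constructible_empty constructible_Un)

lemma constructible_zero_locus:
  "finite P \<Longrightarrow> P \<subseteq> polyfuns F \<Longrightarrow> zero_locus UNIV P \<in> constructible F"
proof (induction rule: finite_induct)
  case empty
  then show ?case using constructible_UNIV by (simp add: zero_locus_def)
next
  case (insert f P)
  have "zero_locus UNIV (insert f P) = {x. f x = 0} \<inter> zero_locus UNIV P"
    by (auto simp: zero_locus_def)
  then show ?case using insert by (simp add: constructible_Int constructible_zero)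
qed

lemma constructible_vimage:
  assumes "C \<in> constructible F'" and c: "\<And>c. c \<in> F' \<Longrightarrow> (\<lambda>x. c (a x)) \<in> polyfuns F"
  shows "{x. a x \<in> C} \<in> constructible F"
  using assms(1)
proof induction
  case (constructible_zero f)
  then show ?case
    using constructible.constructible_zero[OF polyfuns_subst[OF constructible_zero c]] by simp
next
  case (constructible_nonzero f)
  then show ?case
    using constructible.constructible_nonzero[OF polyfuns_subst[OF constructible_nonzero c]] by simp
next
  case (constructible_Un C D)
  then show ?case using constructible.constructible_Un[of "{x. a x \<in> C}" F "{x. a x \<in> D}"]
    by (simp add: Un_def)
next
  case (constructible_Int C D)
  then show ?case using constructible.constructible_Int[of "{x. a x \<in> C}" F "{x. a x \<in> D}"]
    by (simp add: Int_def)
qed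

text \<open>Several inequations amount to a single one for their product, so one function in the
  second component is enough.\<close>

definition basic_locus :: "('x \<Rightarrow> 'k::field) set \<times> ('x \<Rightarrow> 'k) \<Rightarrow> 'x set" where
  "basic_locus k = {x. (\<forall>f\<in>fst k. f x = 0) \<and> snd k x \<noteq> 0}"

definition basic_data :: "('x \<Rightarrow> 'k::field) set \<Rightarrow> (('x \<Rightarrow> 'k) set \<times> ('x \<Rightarrow> 'k)) set" where
  "basic_data F = {k. finite (fst k) \<and> fst k \<subseteq> polyfuns F \<and> snd k \<in> polyfuns F}"

lemma constructible_normal_form:
  "C \<in> constructible F \<Longrightarrow> \<exists>K. finite K \<and> K \<subseteq> basic_data F \<and> C = (\<Union>k\<in>K. basic_locus k)"
proof (induction rule: constructible.induct)
  case (constructible_zero f)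
  then show ?case
    by (intro exI[of _ "{({f}, \<lambda>_. 1)}"])
       (auto simp: basic_data_def basic_locus_def polyfuns_const)
next
  case (constructible_nonzero f)
  then show ?case
    by (intro exI[of _ "{({}, f)}"]) (auto simp: basic_data_def basic_locus_def)
next
  case (constructible_Un C D)
  then obtain K L where "finite K" "K \<subseteq> basic_data F" "C = (\<Union>k\<in>K. basic_locus k)"
    "finite L" "L \<subseteq> basic_data F" "D = (\<Union>k\<in>L. basic_locus k)" by (elim exE conjE)
  then show ?case by (intro exI[of _ "K \<union> L"]) auto
next
  case (constructible_Int C D)
  then obtain K L where K: "finite K" "K \<subseteq> basic_data F" "C = (\<Union>k\<in>K. basic_locus k)"
    and L: "finite L" "L \<subseteq> basic_data F" "D = (\<Union>k\<in>L. basic_locus k)" by (elim exE conjE)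
  define m where "m k l = (fst k \<union> fst l, \<lambda>x. snd k x * snd l x)"
    for k l :: "('a \<Rightarrow> 'b) set \<times> ('a \<Rightarrow> 'b)"
  have m: "basic_locus (m k l) = basic_locus k \<inter> basic_locus l" for k l
    by (auto simp: m_def basic_locus_def)
  have "m k l \<in> basic_data F" if "k \<in> K" "l \<in> L" for k l
    using subsetD[OF K(2) that(1)] subsetD[OF L(2) that(2)]
    by (auto simp: m_def basic_data_def intro!: polyfuns_mult)
  then have "(\<lambda>(k, l). m k l) ` (K \<times> L) \<subseteq> basic_data F" by auto
  moreover have "C \<inter> D = (\<Union>k\<in>(\<lambda>(k, l). m k l) ` (K \<times> L). basic_locus k)"
    unfolding K(3) L(3) by (auto simp: m)
  ultimately show ?case using K(1) L(1) by (intro exI conjI) auto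
qed


subsection \<open>Quantifier elimination over algebraically closed fields\<close>

text \<open>A root \<open>c\<close> of \<open>T Q - 1\<close>, which has positive degree, satisfies
  \<open>c * Q(c) = 1\<close>.\<close>

lemma exists_nonroot:
  fixes Q :: "'k::alg_closed_field poly"
  assumes "Q \<noteq> 0"
  shows "\<exists>c. poly Q c \<noteq> 0"
proof -
  have "degree (pCons (-1) Q) > 0" using assms by simp
  then obtain c where "poly (pCons (-1) Q) c = 0" using alg_closed_imp_poly_has_root by blast
  then have "c * poly Q c = 1" by (simp add: eq_neg_iff_add_eq_0)
  then show ?thesis by (metis mult_zero_right zero_neq_one)
qed

text \<open>\<open>P\<close> splits into linear factors, \<open>degree P\<close> of them with
  multiplicity. If every root of \<open>P\<close> is a root of \<open>Q\<close>, each factor divides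
  \<open>Q\<close>, and their product divides that power of \<open>Q\<close>. Divisibility, unlike
  the existence of a root, can be tested on coefficients.\<close>

lemma exists_root_nonroot_iff:
  fixes P Q :: "'k::alg_closed_field poly"
  assumes P: "P \<noteq> 0"
  shows "(\<exists>c. poly P c = 0 \<and> poly Q c \<noteq> 0) \<longleftrightarrow> \<not> P dvd Q ^ degree P"
proof
  assume "\<exists>c. poly P c = 0 \<and> poly Q c \<noteq> 0"
  then obtain c where c: "poly P c = 0" "poly Q c \<noteq> 0" by blast
  show "\<not> P dvd Q ^ degree P"
  proof
    assume "P dvd Q ^ degree P"
    then obtain R where "Q ^ degree P = P * R" by (elim dvdE)
    then have "poly Q c ^ degree P = 0" using c(1) by (metis poly_mult poly_power mult_zero_left)
    then show False using c(2) by simp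
  qed
next
  assume *: "\<not> P dvd Q ^ degree P"
  show "\<exists>c. poly P c = 0 \<and> poly Q c \<noteq> 0"
  proof (rule ccontr)
    assume roots: "\<not> ?thesis"
    obtain A where A: "size A = degree P" "P = Polynomial.smult (lead_coeff P) (\<Prod>x\<in>#A. [:-x, 1:])"
      using alg_closed_imp_factorization[OF P] by blast
    have "[:-x, 1:] dvd P" if "x \<in># A" for x
    proof -
      have "[:-x, 1:] dvd (\<Prod>x\<in>#A. [:-x, 1:])" using that by (intro dvd_prod_mset) auto
      then show ?thesis by (subst A(2)) (rule dvd_smult)
    qed
    then have Q: "[:-x, 1:] dvd Q" if "x \<in># A" for x
      using that roots by (metis poly_eq_0_iff_dvd)
    have "(\<Prod>x\<in>#B. [:-x, 1:]) dvd Q ^ size B" if "B \<subseteq># A" for B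
      using that
    proof (induction B)
      case (add x B)
      have "x \<in># A" by (rule mset_subset_eqD[OF add.prems]) simp
      moreover have "B \<subseteq># A" using add.prems by (rule subset_mset.order_trans[rotated]) simp
      ultimately show ?case using mult_dvd_mono[OF Q add.IH] by simp
    qed simp
    from this[of A] have "(\<Prod>x\<in>#A. [:-x, 1:]) dvd Q ^ degree P" by (simp add: A(1))
    then have "P dvd Q ^ degree P" using P by (subst A(2)) (simp add: smult_dvd_iff)
    with * show False ..
  qed
qed

text \<open>Cross multiplication cancels the formal leading terms without division, because the
  coefficients are functions that may vanish at some points.\<close>

lemma poly_family_reduce:
  assumes P: "poly_family F (Suc m) P" and Q: "poly_family F (Suc n) Q" and mn: "m \<le> n"
  shows "poly_family F n (\<lambda>x. Polynomial.smult (coeff (P x) m) (Q x)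
           - Polynomial.smult (coeff (Q x) n) (monom 1 (n - m) * P x))" (is "poly_family F n ?R")
proof -
  have "poly_family F (Suc n) ?R"
    using poly_family_diff[OF poly_family_smult[OF poly_family_coeff[OF P, of m] Q]
        poly_family_smult[OF poly_family_coeff[OF Q, of n] poly_family_monom_mult[OF P, of "n - m"]]] mn
    by simp
  moreover have "coeff (?R x) n = 0" for x using mn by (simp add: coeff_monom_mult)
  moreover have "i = n \<or> i \<ge> Suc n" if "i \<ge> n" for i using that by auto
  ultimately show ?thesis unfolding poly_family_def by (smt (verit))
qed

text \<open>The exponent \<open>N\<close> counts the reductions and is the same for all points, so
  the remainder is again a polynomial family.\<close>

lemma poly_family_pseudo_remainder:
  assumes P: "poly_family F (Suc m) P"
  shows "poly_family F n Q \<Longrightarrow> \<exists>N R. poly_family F m R \<and>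
    (\<forall>x. P x dvd Polynomial.smult (coeff (P x) m ^ N) (Q x) - R x)"
proof (induction n arbitrary: Q)
  case 0
  then show ?case
    using poly_family_mono[of F 0 Q m] by (intro exI[of _ 0] exI[of _ Q]) auto
next
  case (Suc n)
  show ?case
  proof (cases "m \<le> n")
    case False
    then show ?thesis
      using poly_family_mono[OF Suc.prems, of m] by (intro exI[of _ 0] exI[of _ Q]) auto
  next
    case True
    let ?a = "\<lambda>x. coeff (P x) m"
    let ?M = "\<lambda>x. Polynomial.smult (coeff (Q x) n) (monom 1 (n - m) * P x)"
    let ?Q = "\<lambda>x. Polynomial.smult (?a x) (Q x) - ?M x"
    obtain N R where R: "poly_family F m R"
      "\<And>x. P x dvd Polynomial.smult (?a x ^ N) (?Q x) - R x"
      using Suc.IH[OF poly_family_reduce[OF P Suc.prems True]] by blast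
    have "P x dvd Polynomial.smult (?a x ^ Suc N) (Q x) - R x" for x
    proof -
      have "P x dvd Polynomial.smult (?a x ^ N) (?M x)" by (intro dvd_smult) simp
      from dvd_add[OF R(2) this] show ?thesis
        by (simp add: smult_diff_right algebra_simps)
    qed
    then show ?thesis using R(1) by blast
  qed
qed

text \<open>A polynomial of least formal degree is singled out. Where its formal leading coefficient
  vanishes, its bound can be lowered; elsewhere it reduces any other polynomial of the system. A
  system with a single polynomial is decided by divisibility, hence by a pseudo-remainder, and the
  empty system by \<open>exists_nonroot\<close>.\<close>

lemma constructible_exists_common_root:
  fixes Ps :: "(nat \<times> ('x \<Rightarrow> 'k::alg_closed_field poly)) multiset"
  assumes Q: "poly_family F l Q"
  shows "(\<And>p. p \<in># Ps \<Longrightarrow> poly_family F (fst p) (snd p)) \<Longrightarrow>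
    {x. \<exists>c. (\<forall>p\<in>#Ps. poly (snd p x) c = 0) \<and> poly (Q x) c \<noteq> 0} \<in> constructible F"
\<comment> \<open>The summand is \<open>Suc (fst p)\<close> and not \<open>fst p\<close>, so that
  discarding a polynomial of bound 0 also decreases the measure.\<close>
proof (induction "\<Sum>p\<in>#Ps. Suc (fst p)" arbitrary: Ps rule: less_induct)
  case less
  let ?E = "\<lambda>Ps. {x. \<exists>c. (\<forall>p\<in>#Ps. poly (snd p x) c = 0) \<and> poly (Q x) c \<noteq> 0}"
  have nz: "{x. R x \<noteq> 0} \<in> constructible F" if "poly_family F n R" for n R
  proof -
    have "{x. R x \<noteq> 0} = (\<Union>i\<in>{..<n}. {x. coeff (R x) i \<noteq> 0})"
      using poly_family_bound[OF that] by (auto simp: poly_eq_iff Bex_def) (meson not_le)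
    then show ?thesis
      using poly_family_coeff[OF that] by (auto intro!: constructible_UN constructible_nonzero)
  qed
  show ?case
  proof (cases "Ps = {#}")
    case True
    then have "?E Ps = {x. Q x \<noteq> 0}" using exists_nonroot by auto
    then show ?thesis using nz[OF Q] by simp
  next
    case False
    then have "Min (fst ` set_mset Ps) \<in> fst ` set_mset Ps" by (intro Min_in) auto
    then obtain p where p: "p \<in># Ps" "fst p = Min (fst ` set_mset Ps)" by auto
    have pmin: "fst p \<le> fst q" if "q \<in># Ps" for q using p(2) that by simp
    obtain n P where nP: "p = (n, P)" by (cases p)
    obtain R where R: "Ps = add_mset (n, P) R" using p(1) nP by (metis multi_member_split)
    have P: "poly_family F n P" and PR: "\<And>p. p \<in># R \<Longrightarrow> poly_family F (fst p) (snd p)"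
      using less.prems[of "(n, P)"] less.prems R by auto
    show ?thesis
    proof (cases n)
      case 0
      then have "P x = 0" for x using P by (auto simp: poly_family_def poly_eq_iff)
      then have "?E Ps = ?E R" by (simp add: R)
      moreover have "?E R \<in> constructible F" using PR by (intro less.hyps) (auto simp: R)
      ultimately show ?thesis by simp
    next
      case (Suc m)
      note P = P[unfolded Suc]
      let ?a = "\<lambda>x. coeff (P x) m"
      have a: "?a \<in> polyfuns F" by (rule poly_family_coeff[OF P])
      let ?P' = "\<lambda>x. P x - monom (?a x) m"
      have P': "poly_family F m ?P'"
        unfolding poly_family_def
      proof (intro conjI allI impI)
        show "(\<lambda>x. coeff (?P' x) i) \<in> polyfuns F" for i
          using poly_family_coeff[OF P] by (cases "i = m") (simp_all add: polyfuns_const)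
        show "coeff (?P' x) i = 0" if "m \<le> i" for x i
          using that poly_family_bound[OF P, of i x] by (cases "i = m") auto
      qed
      have E0: "?E (add_mset (m, ?P') R) \<in> constructible F"
        using PR P' by (intro less.hyps) (auto simp: R Suc)
      have E1: "{x. ?a x \<noteq> 0} \<inter> ?E Ps \<in> constructible F"
      proof (cases "R = {#}")
        case True
        \<comment> \<open>Where \<open>?a x\<close> is nonzero the degree of \<open>P x\<close> is
          exactly \<open>m\<close>, so the divisibility criterion concerns the fixed power
          \<open>Q x ^ m\<close>.\<close>
        obtain l' where "poly_family F l' (\<lambda>x. Q x ^ m)" using poly_family_power[OF Q] by blast
        then obtain N R' where R': "poly_family F m R'"
          "\<And>x. P x dvd Polynomial.smult (?a x ^ N) (Q x ^ m) - R' x"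
          using poly_family_pseudo_remainder[OF P] by blast
        have "(\<exists>c. poly (P x) c = 0 \<and> poly (Q x) c \<noteq> 0) \<longleftrightarrow> R' x \<noteq> 0" if ax: "?a x \<noteq> 0" for x
        proof -
          have deg: "degree (P x) = m"
            using ax poly_family_bound[OF P, of _ x]
            by (intro antisym degree_le le_degree) auto
          have P0: "P x \<noteq> 0" using ax by auto
          have "P x dvd Q x ^ m \<longleftrightarrow> P x dvd Polynomial.smult (?a x ^ N) (Q x ^ m)"
            using ax by (simp add: dvd_smult_iff)
          also have "\<dots> \<longleftrightarrow> P x dvd R' x"
            using R'(2)[of x] by (metis dvd_diff_right_iff dvd_diff_left_iff)
          also have "\<dots> \<longleftrightarrow> R' x = 0"
          proof
            assume d: "P x dvd R' x"
            show "R' x = 0"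
            proof (rule ccontr)
              assume nz: "R' x \<noteq> 0"
              have "m \<le> degree (R' x)" using dvd_imp_degree_le[OF d nz] deg by simp
              then have "lead_coeff (R' x) = 0" by (rule poly_family_bound[OF R'(1)])
              then show False using nz by simp
            qed
          qed simp
          finally show ?thesis using exists_root_nonroot_iff[OF P0, of "Q x"] deg by simp
        qed
        then have "{x. ?a x \<noteq> 0} \<inter> ?E Ps = {x. ?a x \<noteq> 0} \<inter> {x. R' x \<noteq> 0}"
          by (auto simp: R True)
        then show ?thesis using constructible_Int[OF constructible_nonzero[OF a] nz[OF R'(1)]] by simp
      next
        case False
        then obtain q R2 where q: "R = add_mset q R2" by (metis multiset_cases)
        obtain k P2 where kP: "q = (k, P2)" by (cases q)
        have "Suc m \<le> k" using pmin[of q] by (simp add: R q nP Suc kP)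
        then obtain j where j: "k = Suc j" "m \<le> j" by (cases k) auto
        have P2: "poly_family F (Suc j) P2" using PR[of q] by (simp add: q kP j)
        let ?P3 = "\<lambda>x. Polynomial.smult (?a x) (P2 x)
           - Polynomial.smult (coeff (P2 x) j) (monom 1 (j - m) * P x)"
        have "?E (add_mset (Suc m, P) (add_mset (j, ?P3) R2)) \<in> constructible F"
          using PR P poly_family_reduce[OF P P2 j(2)]
          by (intro less.hyps) (auto simp: R Suc q kP j)
        \<comment> \<open>At a root of \<open>P x\<close> the subtracted multiple vanishes and
          \<open>?a x\<close> is invertible, so exchanging \<open>P2\<close> for \<open>?P3\<close>
          does not change the common roots.\<close>
        moreover have "{x. ?a x \<noteq> 0} \<inter> ?E Ps =
          {x. ?a x \<noteq> 0} \<inter> ?E (add_mset (Suc m, P) (add_mset (j, ?P3) R2))"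
          by (auto simp: R Suc q kP) 
        ultimately show ?thesis using constructible_Int[OF constructible_nonzero[OF a]] by simp
      qed
      have "?E Ps = ({x. ?a x = 0} \<inter> ?E (add_mset (m, ?P') R)) \<union> ({x. ?a x \<noteq> 0} \<inter> ?E Ps)"
        by (auto simp: R)
      then show ?thesis
        using constructible_Un[OF constructible_Int[OF constructible_zero[OF a] E0] E1] by simp
    qed
  qed
qed

section \<open>Chevalley's theorem for projections\<close>

definition pair_coords :: "('x \<Rightarrow> 'k) set \<Rightarrow> 'i set \<Rightarrow> ('x \<times> ('i \<Rightarrow> 'k) \<Rightarrow> 'k) set" where
  "pair_coords F I = {(\<lambda>z. f (fst z)) | f. f \<in> F} \<union> {(\<lambda>z. snd z i) | i. i \<in> I}"

text \<open>The quantifier distributes over the basic pieces of \<open>C\<close>. In each of them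
  the coordinate \<open>i\<close> becomes the variable of univariate polynomials whose coefficients
  are functions of the remaining coordinates, which is a common root problem.\<close>

lemma constructible_exists_coord:
  fixes F :: "('x \<Rightarrow> 'k::alg_closed_field) set" and i :: 'i
  assumes C: "C \<in> constructible (pair_coords F (insert i I))" and i: "i \<notin> I"
  shows "{z. \<exists>c. (fst z, (snd z)(i := c)) \<in> C} \<in> constructible (pair_coords F I)"
proof -
  let ?F = "pair_coords F I"
  obtain K where K: "finite K" "K \<subseteq> basic_data (pair_coords F (insert i I))"
    "C = (\<Union>k\<in>K. basic_locus k)"
    using constructible_normal_form[OF C] by blast
  let ?u = "\<lambda>z c. (fst z, (snd z)(i := c))"
  have fam: "\<exists>n P. poly_family ?F n P \<and> (\<forall>z c. f (?u z c) = poly (P z) c)"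
    if f: "f \<in> polyfuns (pair_coords F (insert i I))" for f
  proof (rule polyfuns_extend_coord[OF f])
    fix c :: "'x \<times> ('i \<Rightarrow> 'k) \<Rightarrow> 'k" assume c: "c \<in> pair_coords F (insert i I)"
    show "\<exists>n P. poly_family ?F n P \<and> (\<forall>z s. c (?u z s) = poly (P z) s)"
    proof (cases "c = (\<lambda>z. snd z i)")
      case True
      then show ?thesis
        using poly_family_X[of ?F] by (intro exI[of _ 2] exI[of _ "\<lambda>_. [:0,1:]"]) simp
    next
      case False
      then have cF: "c \<in> ?F" and "c (?u z s) = c z" for z s
        using c i by (auto simp: pair_coords_def)
      then show ?thesis
        using poly_family_const[OF polyfuns_coord[OF cF]]
        by (intro exI[of _ 1] exI[of _ "\<lambda>x. [:c x:]"]) simp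
    qed
  qed
  have "{z. \<exists>c. ?u z c \<in> basic_locus k} \<in> constructible ?F" if k: "k \<in> K" for k
  proof -
    have kd: "finite (fst k)" "fst k \<subseteq> polyfuns (pair_coords F (insert i I))"
      "snd k \<in> polyfuns (pair_coords F (insert i I))"
      using subsetD[OF K(2) k] by (auto simp: basic_data_def)
    have "\<forall>f\<in>fst k. \<exists>p. poly_family ?F (fst p) (snd p) \<and> (\<forall>z c. f (?u z c) = poly (snd p z) c)"
      using fam[OF subsetD[OF kd(2)]] by fastforce
    then obtain p where p: "\<And>f. f \<in> fst k \<Longrightarrow> poly_family ?F (fst (p f)) (snd (p f))"
      "\<And>f z c. f \<in> fst k \<Longrightarrow> f (?u z c) = poly (snd (p f) z) c" by metis
    obtain l Q where Q: "poly_family ?F l Q" "\<And>z c. snd k (?u z c) = poly (Q z) c"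
      using fam[OF kd(3)] by blast
    let ?Ps = "mset_set (p ` fst k)"
    have set: "set_mset ?Ps = p ` fst k" using kd(1) by simp
    have "{x. \<exists>c. (\<forall>p\<in>#?Ps. poly (snd p x) c = 0) \<and> poly (Q x) c \<noteq> 0} \<in> constructible ?F"
      by (rule constructible_exists_common_root[OF Q(1)]) (use p(1) set in auto)
    moreover have "{z. \<exists>c. ?u z c \<in> basic_locus k} =
        {x. \<exists>c. (\<forall>p\<in>#?Ps. poly (snd p x) c = 0) \<and> poly (Q x) c \<noteq> 0}"
      by (simp add: set basic_locus_def p(2) Q(2))
    ultimately show ?thesis by simp
  qed
  then have "(\<Union>k\<in>K. {z. \<exists>c. ?u z c \<in> basic_locus k}) \<in> constructible ?F"
    by (rule constructible_UN[OF K(1)])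
  moreover have "{z. \<exists>c. ?u z c \<in> C} = (\<Union>k\<in>K. {z. \<exists>c. ?u z c \<in> basic_locus k})"
    unfolding K(3) by blast
  ultimately show ?thesis by simp
qed

theorem constructible_projection:
  fixes F :: "('x \<Rightarrow> 'k::alg_closed_field) set" and C :: "('x \<times> ('i \<Rightarrow> 'k)) set"
  assumes "finite I" "C \<in> constructible (pair_coords F I)"
  shows "{x. \<exists>v. (x, v) \<in> C} \<in> constructible F"
  using assms
proof (induction arbitrary: C rule: finite_induct)
  case empty
  \<comment> \<open>Without fibre coordinates no function sees \<open>v\<close>, so membership in
    \<open>C\<close> can be tested at an arbitrary value, below \<open>undefined\<close>.\<close>
  have "f (x, v) = f (x, v')" if "f \<in> polyfuns (pair_coords F {})" for f x and v v' :: "'i \<Rightarrow> 'k"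
    using that by induction (auto simp: pair_coords_def)
  note inv = this
  have "\<forall>x v v'. (x, v) \<in> C \<longleftrightarrow> (x, v') \<in> C"
    using empty
  proof induction
    case (constructible_zero f)
    then show ?case using inv[OF constructible_zero] by (metis mem_Collect_eq)
  next
    case (constructible_nonzero f)
    then show ?case using inv[OF constructible_nonzero] by (metis mem_Collect_eq)
  qed blast+
  then have "{x. \<exists>v. (x, v) \<in> C} = {x. (x, undefined) \<in> C}" by blast
  moreover have "{x. (x, undefined) \<in> C} \<in> constructible F"
    by (rule constructible_vimage[OF empty]) (auto simp: pair_coords_def intro: polyfuns_coord)
  ultimately show ?case by simp
next
  case (insert i I)
  let ?C = "{z. \<exists>c. (fst z, (snd z)(i := c)) \<in> C}"
  have "{x. \<exists>v. (x, v) \<in> ?C} \<in> constructible F"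
    by (rule insert.IH[OF constructible_exists_coord[OF insert.prems insert.hyps(2)]])
  moreover have "(\<exists>v. (x, v) \<in> C) \<longleftrightarrow> (\<exists>v c. (x, v(i := c)) \<in> C)" for x
    by (metis fun_upd_triv)
  ultimately show ?case by simp
qed

section \<open>Irreducible sets\<close>

lemma irreduciblein_finite_cover:
  assumes "irreduciblein X S"
  shows "finite \<A> \<Longrightarrow> (\<And>A. A \<in> \<A> \<Longrightarrow> closedin X A) \<Longrightarrow> S \<subseteq> \<Union>\<A> \<Longrightarrow> \<exists>A\<in>\<A>. S \<subseteq> A"
proof (induction rule: finite_induct)
  case empty
  then show ?case using assms by (simp add: irreduciblein_def)
next
  case (insert A \<A>)
  have "closedin X (\<Union>\<A>)" using insert by (intro closedin_Union) auto
  then have "S \<subseteq> A \<or> S \<subseteq> \<Union>\<A>"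
    using assms insert.prems unfolding irreduciblein_def by simp
  then show ?case using insert by blast
qed

lemma irreduciblein_image:
  assumes "irreduciblein X S" "continuous_map X Y f"
  shows "irreduciblein Y (f ` S)"
  unfolding irreduciblein_def
proof (intro conjI allI impI)
  have S: "S \<subseteq> topspace X" "S \<noteq> {}" using assms(1) by (auto simp: irreduciblein_def)
  show "f ` S \<subseteq> topspace Y" using S continuous_map_image_subset_topspace[OF assms(2)] by blast
  show "f ` S \<noteq> {}" using S by simp
  fix A B assume AB: "closedin Y A \<and> closedin Y B \<and> f ` S \<subseteq> A \<union> B"
  let ?v = "\<lambda>A. {x \<in> topspace X. f x \<in> A}"
  have "closedin X (?v A)" "closedin X (?v B)" "S \<subseteq> ?v A \<union> ?v B"
    using AB S closedin_continuous_map_preimage[OF assms(2)] by auto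
  then have "S \<subseteq> ?v A \<or> S \<subseteq> ?v B" using assms(1) unfolding irreduciblein_def by simp
  then show "f ` S \<subseteq> A \<or> f ` S \<subseteq> B" by auto
qed

lemma irreduciblein_closure_of:
  assumes "irreduciblein X S"
  shows "irreduciblein X (X closure_of S)"
  unfolding irreduciblein_def
proof (intro conjI allI impI)
  have S: "S \<subseteq> topspace X" "S \<noteq> {}" using assms by (auto simp: irreduciblein_def)
  have sub: "S \<subseteq> X closure_of S" by (rule closure_of_subset[OF S(1)])
  show "X closure_of S \<noteq> {}" using S(2) sub by blast
  fix A B assume AB: "closedin X A \<and> closedin X B \<and> X closure_of S \<subseteq> A \<union> B"
  then have "S \<subseteq> A \<union> B" using sub by (meson subset_trans)
  then have "S \<subseteq> A \<or> S \<subseteq> B" using assms AB unfolding irreduciblein_def by simp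
  then show "X closure_of S \<subseteq> A \<or> X closure_of S \<subseteq> B" using AB closure_of_minimal by metis
qed (rule closure_of_subset_topspace)

lemma irreduciblein_connectedin: "irreduciblein X S \<Longrightarrow> connectedin X S"
  unfolding connectedin_closedin
proof (intro conjI notI)
  assume S: "irreduciblein X S"
  then show "S \<subseteq> topspace X" by (simp add: irreduciblein_def)
  assume "\<exists>A B. closedin X A \<and> closedin X B \<and> S \<subseteq> A \<union> B \<and> A \<inter> B \<inter> S = {} \<and> A \<inter> S \<noteq> {} \<and> B \<inter> S \<noteq> {}"
  then obtain A B where AB: "closedin X A" "closedin X B" "S \<subseteq> A \<union> B" "A \<inter> B \<inter> S = {}"
    "A \<inter> S \<noteq> {}" "B \<inter> S \<noteq> {}" by (elim exE conjE)
  then have "S \<subseteq> A \<or> S \<subseteq> B" using S by (simp add: irreduciblein_def)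
  then show False using AB(4-6) by auto
qed

section \<open>Noetherian Zariski topologies\<close>

text \<open>The vanishing ideals \<open>T i\<close> increase. Finitely many equations cut out the
  zero locus of their union, and these already lie in one \<open>T n\<close>.\<close>

lemma zariski_noetherian_descending_chain:
  fixes F :: "('x \<Rightarrow> 'k::field) set"
  assumes N: "noetherian_locus X F" and Z: "\<And>i::nat. closedin (zariski X F) (Z i)"
    and desc: "\<And>i. Z (Suc i) \<subseteq> Z i"
  shows "\<exists>n. Z (Suc n) = Z n"
proof -
  define T where "T i = {f \<in> polyfuns F. \<forall>x\<in>Z i. f x = 0}" for i
  have ZT: "zero_locus X (T i) = Z i" for i
  proof -
    obtain S where "S \<subseteq> polyfuns F" "Z i = zero_locus X S"
      using Z[of i] unfolding closedin_zariski by (elim exE conjE)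
    then show ?thesis by (auto simp: T_def zero_locus_def)
  qed
  have mono: "T i \<subseteq> T j" if "i \<le> j" for i j
    by (rule lift_Suc_mono_le[OF _ that]) (use desc in \<open>auto simp: T_def\<close>)
  have "(\<Union>i. T i) \<subseteq> polyfuns F" by (auto simp: T_def)
  from noetherian_locusD[OF N this]
  obtain C where C: "C \<subseteq> (\<Union>i. T i)" "finite C" "zero_locus X C = zero_locus X (\<Union>i. T i)" .
  have "\<exists>n. C \<subseteq> T n"
    using C(2,1)
  proof (induction rule: finite_induct)
    case (insert f C)
    then obtain n m where nm: "C \<subseteq> T n" "f \<in> T m" by auto
    have "insert f C \<subseteq> T (max n m)"
      using nm mono[of n "max n m"] mono[of m "max n m"] by auto
    then show ?case ..
  qed simp
  then obtain n where n: "C \<subseteq> T n" ..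
  have "Z n \<subseteq> zero_locus X C" using n ZT[of n] by (auto simp: zero_locus_def)
  also have "\<dots> \<subseteq> Z (Suc n)" unfolding C(3) ZT[of "Suc n", symmetric] by (auto simp: zero_locus_def)
  finally show ?thesis using desc[of n] by blast
qed

text \<open>Noetherian induction: a closed set without such a cover is reducible and has a proper
  closed subset without one, which would start an infinite strictly descending chain.\<close>

lemma zariski_noetherian_finite_irreducible_cover:
  fixes F :: "('x \<Rightarrow> 'k::field) set"
  assumes N: "noetherian_locus X F"
  shows "\<exists>\<A>. finite \<A> \<and> (\<forall>A\<in>\<A>. closedin (zariski X F) A \<and> irreduciblein (zariski X F) A) \<and> \<Union>\<A> = X"
proof -
  let ?T = "zariski X F"
  define ok where "ok Z \<longleftrightarrow> (\<exists>\<A>. finite \<A> \<and> (\<forall>A\<in>\<A>. closedin ?T A \<and> irreduciblein ?T A) \<and> \<Union>\<A> = Z)"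
    for Z
  have split: "\<exists>Z'. closedin ?T Z' \<and> \<not> ok Z' \<and> Z' \<subset> Z" if Z: "closedin ?T Z" "\<not> ok Z" for Z
  proof -
    have "\<not> irreduciblein ?T Z"
    proof
      assume "irreduciblein ?T Z"
      then have "ok Z" unfolding ok_def using Z(1) by (intro exI[of _ "{Z}"]) simp
      with Z(2) show False ..
    qed
    moreover have "Z \<noteq> {}"
    proof
      assume "Z = {}"
      then have "ok Z" unfolding ok_def by (intro exI[of _ "{}"]) simp
      with Z(2) show False ..
    qed
    moreover have "Z \<subseteq> topspace ?T" by (rule closedin_subset[OF Z(1)])
    ultimately obtain A B where AB: "closedin ?T A" "closedin ?T B" "Z \<subseteq> A \<union> B"
      "\<not> Z \<subseteq> A" "\<not> Z \<subseteq> B" unfolding irreduciblein_def by metis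
    have "\<not> (ok (Z \<inter> A) \<and> ok (Z \<inter> B))"
    proof
      assume "ok (Z \<inter> A) \<and> ok (Z \<inter> B)"
      then obtain \<A> \<B> where
        "finite \<A>" "\<forall>A\<in>\<A>. closedin ?T A \<and> irreduciblein ?T A" "\<Union>\<A> = Z \<inter> A"
        "finite \<B>" "\<forall>A\<in>\<B>. closedin ?T A \<and> irreduciblein ?T A" "\<Union>\<B> = Z \<inter> B"
        unfolding ok_def by (elim exE conjE)
      then have "finite (\<A> \<union> \<B>) \<and> (\<forall>A\<in>\<A> \<union> \<B>. closedin ?T A \<and> irreduciblein ?T A) \<and> \<Union>(\<A> \<union> \<B>) = Z"
        using AB(3) by (simp add: ball_Un Union_Un_distrib Int_Un_distrib[symmetric] Int_absorb2)
      then have "ok Z" unfolding ok_def by (rule exI)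
      with Z(2) show False ..
    qed
    moreover have "closedin ?T (Z \<inter> A)" "closedin ?T (Z \<inter> B)"
      using Z(1) AB(1,2) by (auto intro: closedin_Int)
    moreover have "Z \<inter> A \<subset> Z" "Z \<inter> B \<subset> Z" using AB(4,5) by auto
    ultimately show ?thesis by metis
  qed
  have "ok X"
  proof (rule ccontr)
    assume X: "\<not> ok X"
    define nxt where "nxt Z = (SOME Z'. closedin ?T Z' \<and> \<not> ok Z' \<and> Z' \<subset> Z)" for Z
    have nxt: "closedin ?T (nxt Z) \<and> \<not> ok (nxt Z) \<and> nxt Z \<subset> Z" if "closedin ?T Z" "\<not> ok Z" for Z
      unfolding nxt_def by (rule someI_ex[OF split[OF that]])
    define Z where "Z i = (nxt ^^ i) X" for i :: nat
    have Z: "closedin ?T (Z i) \<and> \<not> ok (Z i)" for i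
    proof (induction i)
      case 0
      show ?case using X closedin_topspace[of ?T] by (simp add: Z_def)
    next
      case (Suc i)
      then show ?case using nxt[of "Z i"] by (simp add: Z_def)
    qed
    have desc: "Z (Suc i) \<subset> Z i" for i using nxt[of "Z i"] Z[of i] by (simp add: Z_def)
    have "\<exists>n. Z (Suc n) = Z n"
      by (rule zariski_noetherian_descending_chain[OF N]) (use Z desc in auto)
    then show False using desc by blast
  qed
  then show ?thesis unfolding ok_def .
qed

text \<open>
  In an irredundant cover by irreducible closed sets some point lies on only one member, hence by
  homogeneity every point does; the members are then disjoint, and therefore open as well.
\<close>

lemma homogeneous_connected_component_irreducible:
  assumes fin: "finite \<A>" and cl: "\<And>A. A \<in> \<A> \<Longrightarrow> closedin T A"
    and irr: "\<And>A. A \<in> \<A> \<Longrightarrow> irreduciblein T A" and cov: "\<Union>\<A> = topspace T"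
    and hom: "\<And>x y. x \<in> topspace T \<Longrightarrow> y \<in> topspace T \<Longrightarrow>
      \<exists>f g. continuous_map T T f \<and> continuous_map T T g \<and> (\<forall>z\<in>topspace T. g (f z) = z) \<and> f x = y"
    and x: "x \<in> topspace T"
  shows "irreduciblein T (connected_component_of_set T x)"
proof -
  define good where "good \<B> \<longleftrightarrow> \<B> \<subseteq> \<A> \<and> \<Union>\<B> = topspace T" for \<B>
  have "good \<A>" using cov by (simp add: good_def)
  then obtain \<B> where B: "good \<B>" and Bmin: "\<And>\<C>. good \<C> \<Longrightarrow> card \<B> \<le> card \<C>"
    using ex_has_least_nat[of good \<A> card] by blast
  have BA: "\<B> \<subseteq> \<A>" and Bcov: "\<Union>\<B> = topspace T" using B by (auto simp: good_def)
  have finB: "finite \<B>" using BA fin finite_subset by blast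
  have clB: "closedin T A" and irrB: "irreduciblein T A" if "A \<in> \<B>" for A
    using cl irr BA that by auto
  have irred: "\<not> \<Union>(\<B> - {A}) = topspace T" if A: "A \<in> \<B>" for A
  proof
    assume "\<Union>(\<B> - {A}) = topspace T"
    then have "good (\<B> - {A})" using BA by (auto simp: good_def)
    from Bmin[OF this] show False using A finB by (meson card_Diff1_less not_le)
  qed
  have antichain: "A = A'" if A: "A \<in> \<B>" "A' \<in> \<B>" "A \<subseteq> A'" for A A'
  proof (rule ccontr)
    assume "A \<noteq> A'"
    then have "\<Union>(\<B> - {A}) = \<Union>\<B>" using A by blast
    with irred[OF A(1)] Bcov show False by simp
  qed
  have sub: "\<exists>A\<in>\<B>. D \<subseteq> A" if D: "irreduciblein T D" for D
    by (rule irreduciblein_finite_cover[OF D finB])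
       (use clB Bcov D in \<open>auto simp: irreduciblein_def\<close>)
  have "\<B> \<noteq> {}" using x Bcov by auto
  then obtain A0 where A0: "A0 \<in> \<B>" by blast
  obtain z where z: "z \<in> topspace T" "z \<notin> \<Union>(\<B> - {A0})"
    using irred[OF A0] Bcov by blast
  have uniq: "A = B" if AB: "A \<in> \<B>" "B \<in> \<B>" "y \<in> A" "y \<in> B" for A B y
  proof -
    have y: "y \<in> topspace T" using AB Bcov by blast
    obtain f g where f: "continuous_map T T f" and g: "continuous_map T T g"
      and gf: "\<And>u. u \<in> topspace T \<Longrightarrow> g (f u) = u" and fy: "f y = z"
      using hom[OF y z(1)] by blast
    \<comment> \<open>The image of \<open>C\<close> under \<open>f\<close> is irreducible and
      contains \<open>z\<close>, so it lies in \<open>A0\<close>, the only member through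
      \<open>z\<close>. Applying \<open>g\<close> puts \<open>C\<close> inside \<open>A''\<close>,
      and no member of an irredundant cover is contained in another.\<close>
    have key: "C = A''" if C: "C \<in> \<B>" "y \<in> C" and A'': "A'' \<in> \<B>" "g ` A0 \<subseteq> A''" for C A''
    proof -
      have "irreduciblein T (f ` C)" by (rule irreduciblein_image[OF irrB[OF C(1)] f])
      from sub[OF this] obtain A' where A': "A' \<in> \<B>" "f ` C \<subseteq> A'" by blast
      have "f y \<in> f ` C" using C(2) by simp
      then have "z \<in> A'" using A'(2) by (auto simp: fy)
      then have "A' = A0" using z(2) A'(1) by auto
      then have "f ` C \<subseteq> A0" using A'(2) by simp
      then have "g ` f ` C \<subseteq> g ` A0" by (rule image_mono)
      then have "g ` f ` C \<subseteq> A''" using A''(2) by (rule subset_trans)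
      moreover have "g (f u) = u" if "u \<in> C" for u
        by (rule gf) (use closedin_subset[OF clB[OF C(1)]] that in auto)
      then have "(\<lambda>u. g (f u)) ` C = (\<lambda>u. u) ` C" by (intro image_cong) auto
      then have "g ` f ` C = C" by (simp add: image_image)
      ultimately show ?thesis using antichain C(1) A''(1) by simp
    qed
    from sub[OF irreduciblein_image[OF irrB[OF A0] g]]
    obtain A'' where A'': "A'' \<in> \<B>" "g ` A0 \<subseteq> A''" ..
    from key[OF AB(1,3) A''] key[OF AB(2,4) A''] show ?thesis by (rule trans[OF _ sym])
  qed
  obtain A where A: "A \<in> \<B>" "x \<in> A" using x Bcov by blast
  have "closedin T (\<Union>(\<B> - {A}))" using finB clB by (intro closedin_Union) auto
  moreover have "topspace T - A = \<Union>(\<B> - {A})"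
  proof (intro equalityI subsetI)
    fix y assume "y \<in> \<Union>(\<B> - {A})"
    then obtain B where "B \<in> \<B>" "B \<noteq> A" "y \<in> B" by auto
    then show "y \<in> topspace T - A" using uniq[OF A(1), of B y] Bcov by auto
  qed (use Bcov in auto)
  ultimately have "openin T A" using clB[OF A(1)] by (simp add: openin_closedin_eq closedin_subset)
  have "connected_component_of_set T x \<subseteq> A"
  proof -
    have "connectedin T (connected_component_of_set T x)" by (rule connectedin_connected_component_of)
    moreover have "T frontier_of A = {}"
      using clopenin_eq_frontier_of[of T A] \<open>openin T A\<close> clB[OF A(1)] by simp
    moreover have "x \<in> connected_component_of_set T x" using x by (simp add: connected_component_of_refl)
    ultimately show ?thesis
      using connectedin_Int_frontier_of[of T "connected_component_of_set T x" A] A(2) by auto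
  qed
  moreover have "A \<subseteq> connected_component_of_set T x"
    by (rule connected_component_of_maximal[OF irreduciblein_connectedin[OF irrB[OF A(1)]] A(2)])
  ultimately show ?thesis using irrB[OF A(1)] by simp
qed

text \<open>By irreducibility one basic piece of the constructible set is dense in
  \<open>O'\<close>. Its equations then hold on the whole closure, so its inequation alone decides
  membership there.\<close>

lemma irreducible_constructible_open_in_closure:
  fixes F :: "('x \<Rightarrow> 'k::field) set"
  assumes C: "C \<in> constructible F" and O: "O' = X \<inter> C" and irr: "irreduciblein (zariski X F) O'"
  shows "\<exists>q\<in>polyfuns F. (\<exists>x\<in>O'. q x \<noteq> 0) \<and>
    (\<forall>y\<in>zariski X F closure_of O'. q y \<noteq> 0 \<longrightarrow> y \<in> O')"
proof -
  let ?T = "zariski X F"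
  obtain K where K: "finite K" "K \<subseteq> basic_data F" "C = (\<Union>k\<in>K. basic_locus k)"
    using constructible_normal_form[OF C] by (elim exE conjE)
  let ?cl = "\<lambda>k. ?T closure_of (X \<inter> basic_locus k)"
  have "X \<inter> basic_locus k \<subseteq> ?cl k" for k by (rule closure_of_subset) simp
  then have "O' \<subseteq> \<Union>(?cl ` K)" unfolding O K(3) by blast
  then obtain A where "A \<in> ?cl ` K" "O' \<subseteq> A"
    using irreduciblein_finite_cover[OF irr, of "?cl ` K"] K(1) closedin_closure_of by blast
  then obtain k where k: "k \<in> K" "O' \<subseteq> ?cl k" by blast
  have kd: "fst k \<subseteq> polyfuns F" "snd k \<in> polyfuns F"
    using subsetD[OF K(2) k(1)] by (auto simp: basic_data_def)
  have "O' \<noteq> {}" using irr by (simp add: irreduciblein_def)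
  then have "?cl k \<noteq> {}" using k(2) by blast
  then have "X \<inter> basic_locus k \<noteq> {}" by auto
  then obtain x where x: "x \<in> X" "x \<in> basic_locus k" by blast
  have "closedin ?T (zero_locus X (fst k))" using kd(1) by (auto simp: closedin_zariski)
  moreover have "X \<inter> basic_locus k \<subseteq> zero_locus X (fst k)"
    by (auto simp: basic_locus_def zero_locus_def)
  ultimately have clk: "?cl k \<subseteq> zero_locus X (fst k)" by (rule closure_of_minimal[rotated])
  have "?T closure_of O' \<subseteq> ?cl k" by (rule closure_of_minimal[OF k(2)]) simp
  then have sub: "?T closure_of O' \<subseteq> zero_locus X (fst k)" using clk by simp
  show ?thesis
  proof (intro bexI conjI ballI impI)
    show "snd k x \<noteq> 0" using x by (simp add: basic_locus_def)
    show "x \<in> O'" using x k(1) by (auto simp: O K(3))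
    show "snd k \<in> polyfuns F" by (rule kd(2))
    fix y assume y: "y \<in> ?T closure_of O'" "snd k y \<noteq> 0"
    then have "y \<in> zero_locus X (fst k)" using sub by blast
    then have "y \<in> X" "y \<in> basic_locus k" using y(2) by (auto simp: zero_locus_def basic_locus_def)
    then show "y \<in> O'" using k(1) by (auto simp: O K(3))
  qed
qed

section \<open>Reduction modulo additive equations\<close>

definition monom_fun :: "'i set \<Rightarrow> ('i \<Rightarrow> nat) \<Rightarrow> ('i \<Rightarrow> 'k::field) \<Rightarrow> 'k" where
  "monom_fun I \<alpha> c = (\<Prod>i\<in>I. c i ^ \<alpha> i)"

lemma monom_fun_add: "monom_fun I (\<lambda>i. \<alpha> i + \<beta> i) c = monom_fun I \<alpha> c * monom_fun I \<beta> c"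
  by (simp add: monom_fun_def power_add prod.distrib)

lemma monom_fun_single:
  assumes "finite I" "j \<in> I"
  shows "monom_fun I (\<lambda>i. if i = j then n else 0) c = c j ^ n"
proof -
  have "monom_fun I (\<lambda>i. if i = j then n else 0) c = (\<Prod>i\<in>I. if i = j then c i ^ n else 1)"
    unfolding monom_fun_def by (intro prod.cong) auto
  then show ?thesis using assms by (simp add: prod.delta)
qed

context
  fixes F :: "('w \<Rightarrow> 'k::field) set" and I :: "'i set" and p :: nat and \<delta> :: "'w \<Rightarrow> 'k"
    and B :: "'i \<Rightarrow> 'i \<Rightarrow> 'w \<Rightarrow> 'k" and M :: "('w \<times> ('i \<Rightarrow> 'k)) set"
  assumes I: "finite I" and p: "p \<ge> 2" and \<delta>: "\<delta> \<in> polyfuns F"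
    and B: "\<And>i j. B i j \<in> polyfuns F"
    and rel: "\<And>w c i. (w, c) \<in> M \<Longrightarrow> i \<in> I \<Longrightarrow> \<delta> w * c i ^ p = (\<Sum>j\<in>I. B i j w * c j)"
begin

private abbreviation "exps \<equiv> I \<rightarrow>\<^sub>E {..<p}"

text \<open>The relation can be solved for the p-th powers only after division by
  \<open>\<delta>\<close>. A power of \<open>\<delta>\<close> on the left keeps the coefficients
  \<open>h\<close> polynomial on the base.\<close>

private definition reducible :: "('w \<times> ('i \<Rightarrow> 'k) \<Rightarrow> 'k) \<Rightarrow> bool" where
  "reducible H \<longleftrightarrow> (\<exists>N h. (\<forall>\<alpha>. h \<alpha> \<in> polyfuns F) \<and>
     (\<forall>w c. (w, c) \<in> M \<longrightarrow> \<delta> w ^ N * H (w, c) = (\<Sum>\<alpha>\<in>exps. h \<alpha> w * monom_fun I \<alpha> c)))"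

private lemma reducibleE:
  assumes "reducible H"
  obtains N h where "\<And>\<alpha>. h \<alpha> \<in> polyfuns F"
    and "\<And>w c. (w, c) \<in> M \<Longrightarrow> \<delta> w ^ N * H (w, c) = (\<Sum>\<alpha>\<in>exps. h \<alpha> w * monom_fun I \<alpha> c)"
proof -
  from assms obtain N h where "(\<forall>\<alpha>. h \<alpha> \<in> polyfuns F) \<and>
     (\<forall>w c. (w, c) \<in> M \<longrightarrow> \<delta> w ^ N * H (w, c) = (\<Sum>\<alpha>\<in>exps. h \<alpha> w * monom_fun I \<alpha> c))"
    unfolding reducible_def by (elim exE)
  then show thesis by (intro that[of h N]) simp_all
qed

private lemma reducibleI:
  assumes "\<And>\<alpha>. h \<alpha> \<in> polyfuns F"
    and "\<And>w c. (w, c) \<in> M \<Longrightarrow> \<delta> w ^ N * H (w, c) = (\<Sum>\<alpha>\<in>exps. h \<alpha> w * monom_fun I \<alpha> c)"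
  shows "reducible H"
  unfolding reducible_def using assms by (intro exI[of _ N] exI[of _ h]) simp

private lemma reducible_add:
  assumes "reducible H" "reducible K"
  shows "reducible (\<lambda>z. H z + K z)"
proof -
  obtain N h where h: "\<And>\<alpha>. h \<alpha> \<in> polyfuns F"
    and H: "\<And>w c. (w, c) \<in> M \<Longrightarrow> \<delta> w ^ N * H (w, c) = (\<Sum>\<alpha>\<in>exps. h \<alpha> w * monom_fun I \<alpha> c)"
    by (rule reducibleE[OF assms(1)]) (rule that)
  obtain N' h' where h': "\<And>\<alpha>. h' \<alpha> \<in> polyfuns F"
    and K: "\<And>w c. (w, c) \<in> M \<Longrightarrow> \<delta> w ^ N' * K (w, c) = (\<Sum>\<alpha>\<in>exps. h' \<alpha> w * monom_fun I \<alpha> c)"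
    by (rule reducibleE[OF assms(2)]) (rule that)
  have "\<delta> w ^ (N + N') * (H (w, c) + K (w, c)) =
      (\<Sum>\<alpha>\<in>exps. (\<delta> w ^ N' * h \<alpha> w + \<delta> w ^ N * h' \<alpha> w) * monom_fun I \<alpha> c)" if "(w, c) \<in> M" for w c
  proof -
    have "\<delta> w ^ (N + N') * (H (w, c) + K (w, c)) =
      \<delta> w ^ N' * (\<delta> w ^ N * H (w, c)) + \<delta> w ^ N * (\<delta> w ^ N' * K (w, c))"
      by (simp add: power_add algebra_simps)
    then show ?thesis unfolding H[OF that] K[OF that]
      by (simp add: sum_distrib_left sum.distrib algebra_simps)
  qed
  moreover have "(\<lambda>w. \<delta> w ^ N' * h \<alpha> w + \<delta> w ^ N * h' \<alpha> w) \<in> polyfuns F" for \<alpha>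
    using h h' \<delta> by (intro polyfuns_add polyfuns_mult polyfuns_power)
  ultimately show ?thesis
    by (intro reducibleI[of "\<lambda>\<alpha> w. \<delta> w ^ N' * h \<alpha> w + \<delta> w ^ N * h' \<alpha> w" "N + N'"])
qed

private lemma reducible_scale:
  assumes "f \<in> polyfuns F" "reducible H"
  shows "reducible (\<lambda>z. f (fst z) * H z)"
proof -
  obtain N h where h: "\<And>\<alpha>. h \<alpha> \<in> polyfuns F"
    and H: "\<And>w c. (w, c) \<in> M \<Longrightarrow> \<delta> w ^ N * H (w, c) = (\<Sum>\<alpha>\<in>exps. h \<alpha> w * monom_fun I \<alpha> c)"
    by (rule reducibleE[OF assms(2)]) (rule that)
  have "\<delta> w ^ N * (f (fst (w, c)) * H (w, c)) = (\<Sum>\<alpha>\<in>exps. (f w * h \<alpha> w) * monom_fun I \<alpha> c)"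
    if "(w, c) \<in> M" for w c
  proof -
    have "\<delta> w ^ N * (f (fst (w, c)) * H (w, c)) = f w * (\<delta> w ^ N * H (w, c))" by simp
    then show ?thesis unfolding H[OF that] by (simp add: sum_distrib_left mult.assoc)
  qed
  moreover have "(\<lambda>w. f w * h \<alpha> w) \<in> polyfuns F" for \<alpha> using h assms(1) by (intro polyfuns_mult)
  ultimately show ?thesis by (intro reducibleI[of "\<lambda>\<alpha> w. f w * h \<alpha> w" N])
qed

private lemma reducible_zero: "reducible (\<lambda>_. 0)"
  unfolding reducible_def
  by (intro exI[of _ 0] exI[of _ "\<lambda>_ _. 0"]) (simp add: polyfuns_const)

private lemma reducible_sum:
  "(\<And>i. i \<in> A \<Longrightarrow> reducible (H i)) \<Longrightarrow> reducible (\<lambda>z. \<Sum>i\<in>A. H i z)"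
  by (induction A rule: infinite_finite_induct) (simp_all add: reducible_zero reducible_add)

private lemma reducible_cancel:
  assumes "reducible K" "\<And>w c. (w, c) \<in> M \<Longrightarrow> \<delta> w ^ n * H (w, c) = K (w, c)"
  shows "reducible H"
proof -
  obtain N h where h: "\<And>\<alpha>. h \<alpha> \<in> polyfuns F"
    and K: "\<And>w c. (w, c) \<in> M \<Longrightarrow> \<delta> w ^ N * K (w, c) = (\<Sum>\<alpha>\<in>exps. h \<alpha> w * monom_fun I \<alpha> c)"
    by (rule reducibleE[OF assms(1)]) (rule that)
  have "\<delta> w ^ (N + n) * H (w, c) = (\<Sum>\<alpha>\<in>exps. h \<alpha> w * monom_fun I \<alpha> c)" if "(w, c) \<in> M" for w c
    using K[OF that] assms(2)[OF that] by (simp add: power_add mult.assoc)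
  with h show ?thesis by (rule reducibleI)
qed

text \<open>Trading a factor \<open>c i ^ p\<close> for a linear form lowers the total degree by
  \<open>p - 1\<close>, which is positive because \<open>p\<close> is at least 2.\<close>

private lemma reducible_monom: "reducible (\<lambda>z. monom_fun I \<beta> (snd z))"
proof (induction "\<Sum>i\<in>I. \<beta> i" arbitrary: \<beta> rule: less_induct)
  case less
  show ?case
  proof (cases "\<forall>i\<in>I. \<beta> i < p")
    case True
    let ?\<beta> = "restrict \<beta> I"
    have "?\<beta> \<in> exps" using True by auto
    moreover have "finite exps" using I by (intro finite_PiE) auto
    moreover have "monom_fun I ?\<beta> c = monom_fun I \<beta> c" for c
      by (simp add: monom_fun_def)
    ultimately have *: "(\<Sum>\<alpha>\<in>exps. (if \<alpha> = ?\<beta> then 1 else 0) * monom_fun I \<alpha> c) = monom_fun I \<beta> c" for c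
      using sum.delta[of exps ?\<beta> "\<lambda>\<alpha>. monom_fun I \<alpha> c"]
      by (simp add: if_distrib[of "\<lambda>x. x * _"] cong: if_cong)
    have "(\<lambda>_. if \<alpha> = ?\<beta> then 1 else 0) \<in> polyfuns F" for \<alpha> by (rule polyfuns_const)
    then show ?thesis
      by (rule reducibleI[of "\<lambda>\<alpha> _. if \<alpha> = ?\<beta> then 1 else 0" 0]) (simp only: *, simp)
  next
    case False
    then obtain i where i: "i \<in> I" "\<beta> i \<ge> p" by (auto simp: not_less)
    define \<gamma> where "\<gamma> = \<beta>(i := \<beta> i - p)"
    define e where "e j = (\<lambda>k. if k = j then 1 else (0::nat))" for j :: 'i
    have \<beta>: "\<beta> = (\<lambda>k. \<gamma> k + (if k = i then p else 0))" using i(2) by (auto simp: \<gamma>_def)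
    have lt: "(\<Sum>k\<in>I. \<gamma> k + e j k) < (\<Sum>k\<in>I. \<beta> k)" if "j \<in> I" for j
      using i(1) that p I by (subst \<beta>) (simp add: sum.distrib e_def)
    have "reducible (\<lambda>z. B i j (fst z) * monom_fun I (\<lambda>k. \<gamma> k + e j k) (snd z))" if "j \<in> I" for j
      using less[OF lt[OF that]] B by (intro reducible_scale)
    then have "reducible (\<lambda>z. \<Sum>j\<in>I. B i j (fst z) * monom_fun I (\<lambda>k. \<gamma> k + e j k) (snd z))"
      by (rule reducible_sum)
    moreover have "\<delta> w ^ 1 * monom_fun I \<beta> (snd (w, c)) =
        (\<Sum>j\<in>I. B i j (fst (w, c)) * monom_fun I (\<lambda>k. \<gamma> k + e j k) (snd (w, c)))"
      if "(w, c) \<in> M" for w c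
    proof -
      have "\<delta> w ^ 1 * monom_fun I \<beta> c = monom_fun I \<gamma> c * (\<delta> w * c i ^ p)"
        by (subst \<beta>) (simp add: monom_fun_add monom_fun_single[OF I i(1)])
      also have "\<dots> = (\<Sum>j\<in>I. monom_fun I \<gamma> c * (B i j w * c j))"
        unfolding rel[OF that i(1)] sum_distrib_left ..
      also have "\<dots> = (\<Sum>j\<in>I. B i j w * monom_fun I (\<lambda>k. \<gamma> k + e j k) c)"
        by (intro sum.cong refl)
           (simp add: monom_fun_add e_def monom_fun_single[OF I, where n = 1, simplified])
      finally show ?thesis by simp
    qed
    ultimately show ?thesis by (rule reducible_cancel)
  qed
qed

text \<open>A product of two reduced monomials can have exponents beyond \<open>p - 1\<close>; the
  rewriting of monomials is therefore applied once more.\<close>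

private lemma reducible_mult:
  assumes "reducible H" "reducible K"
  shows "reducible (\<lambda>z. H z * K z)"
proof -
  obtain N h where h: "\<And>\<alpha>. h \<alpha> \<in> polyfuns F"
    and H: "\<And>w c. (w, c) \<in> M \<Longrightarrow> \<delta> w ^ N * H (w, c) = (\<Sum>\<alpha>\<in>exps. h \<alpha> w * monom_fun I \<alpha> c)"
    by (rule reducibleE[OF assms(1)]) (rule that)
  obtain N' h' where h': "\<And>\<alpha>. h' \<alpha> \<in> polyfuns F"
    and K: "\<And>w c. (w, c) \<in> M \<Longrightarrow> \<delta> w ^ N' * K (w, c) = (\<Sum>\<alpha>\<in>exps. h' \<alpha> w * monom_fun I \<alpha> c)"
    by (rule reducibleE[OF assms(2)]) (rule that)
  let ?S = "\<lambda>z. \<Sum>\<alpha>\<in>exps. \<Sum>\<beta>\<in>exps.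
    (\<lambda>w. h \<alpha> w * h' \<beta> w) (fst z) * monom_fun I (\<lambda>i. \<alpha> i + \<beta> i) (snd z)"
  have "reducible ?S"
    using h h' by (intro reducible_sum reducible_scale reducible_monom polyfuns_mult)
  moreover have "\<delta> w ^ (N + N') * (H (w, c) * K (w, c)) = ?S (w, c)" if "(w, c) \<in> M" for w c
  proof -
    have "\<delta> w ^ (N + N') * (H (w, c) * K (w, c)) = (\<delta> w ^ N * H (w, c)) * (\<delta> w ^ N' * K (w, c))"
      by (simp add: power_add)
    also have "\<dots> = ?S (w, c)" unfolding H[OF that] K[OF that] sum_product
      by (intro sum.cong refl) (simp add: monom_fun_add)
    finally show ?thesis .
  qed
  ultimately show ?thesis by (rule reducible_cancel)
qed

lemma additive_normal_form:
  assumes "H \<in> polyfuns (pair_coords F I)"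
  shows "\<exists>N h. (\<forall>\<alpha>. h \<alpha> \<in> polyfuns F) \<and>
     (\<forall>w c. (w, c) \<in> M \<longrightarrow> \<delta> w ^ N * H (w, c) = (\<Sum>\<alpha>\<in>I \<rightarrow>\<^sub>E {..<p}. h \<alpha> w * monom_fun I \<alpha> c))"
proof -
  have one: "reducible (\<lambda>z. f (fst z))" if "f \<in> polyfuns F" for f
    using reducible_scale[OF that reducible_monom[of "\<lambda>_. 0"]] by (simp add: monom_fun_def)
  have "reducible H"
    using assms
  proof induction
    case (polyfuns_const a)
    show ?case using one[OF polyfuns.polyfuns_const] .
  next
    case (polyfuns_coord f)
    then consider g where "g \<in> F" "f = (\<lambda>z. g (fst z))" | i where "i \<in> I" "f = (\<lambda>z. snd z i)"
      by (auto simp: pair_coords_def)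
    then show ?case
    proof cases
      case 1
      then show ?thesis using one[OF polyfuns.polyfuns_coord] by simp
    next
      case 2
      then show ?thesis
        using reducible_monom[of "\<lambda>k. if k = i then 1 else 0"]
        by (simp add: monom_fun_single[OF I, where n = 1, simplified])
    qed
  qed (auto intro: reducible_add reducible_mult)
  then show ?thesis unfolding reducible_def .
qed

end

section \<open>Interpolation by reduced monomials\<close>

lemma vector_space_fun: "vector_space (\<lambda>a (f :: 'x \<Rightarrow> 'k::field) x. a * f x)"
  by standard (auto simp: fun_eq_iff algebra_simps)

lemma sum_fun_apply: "(\<Sum>i\<in>A. f i) x = (\<Sum>i\<in>A. f i x)" for f :: "'i \<Rightarrow> 'x \<Rightarrow> 'k::comm_monoid_add"
  by (induction A rule: infinite_finite_induct) auto

text \<open>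
  The monomials with exponents below \<open>p\<close> span the functions on \<open>V\<close>. There are \<open>p ^ card I\<close> of
  them, which is at most the dimension \<open>card V\<close> of that space.
\<close>

lemma additive_monomials_independent:
  fixes V :: "('i \<Rightarrow> 'k::field) set"
  assumes I: "finite I" and p: "p \<ge> 2" and V: "finite V" "p ^ card I \<le> card V"
    and sep: "\<And>c c'. c \<in> V \<Longrightarrow> c' \<in> V \<Longrightarrow> (\<And>i. i \<in> I \<Longrightarrow> c i = c' i) \<Longrightarrow> c = c'"
    and rel: "\<And>c i. c \<in> V \<Longrightarrow> i \<in> I \<Longrightarrow> c i ^ p = (\<Sum>j\<in>I. B i j * c j)"
    and zero: "\<And>c. c \<in> V \<Longrightarrow> (\<Sum>\<alpha>\<in>I \<rightarrow>\<^sub>E {..<p}. u \<alpha> * monom_fun I \<alpha> c) = 0"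
    and \<alpha>0: "\<alpha>0 \<in> I \<rightarrow>\<^sub>E {..<p}"
  shows "u \<alpha>0 = 0"
proof (rule ccontr)
  assume u: "u \<alpha>0 \<noteq> 0"
  interpret fs: vector_space "\<lambda>a (f :: ('i \<Rightarrow> 'k) \<Rightarrow> 'k) x. a * f x" by (rule vector_space_fun)
  let ?A = "I \<rightarrow>\<^sub>E {..<p}"
  have finA: "finite ?A" using I by (intro finite_PiE) auto
  have cardA: "card ?A = p ^ card I" using I by (simp add: card_PiE)
  \<comment> \<open>Functions on \<open>V\<close> are modelled as functions that vanish off
    \<open>V\<close>.\<close>
  define m where "m \<alpha> = (\<lambda>c. if c \<in> V then monom_fun I \<alpha> c else 0)" for \<alpha>
  define ind where "ind c0 = (\<lambda>c. if c = c0 then 1 else 0 :: 'k)" for c0 :: "'i \<Rightarrow> 'k"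
  let ?W = "fs.span (m ` (?A - {\<alpha>0}))"
  \<comment> \<open>A relation involving the monomial of \<open>\<alpha>0\<close> makes it
    redundant, so one spanning function fewer than the count allows would suffice.\<close>
  have m0: "m \<alpha>0 \<in> ?W"
  proof -
    have "m \<alpha>0 = (\<Sum>\<alpha>\<in>?A - {\<alpha>0}. (\<lambda>c. (- u \<alpha> / u \<alpha>0) * m \<alpha> c))"
    proof
      fix c
      show "m \<alpha>0 c = (\<Sum>\<alpha>\<in>?A - {\<alpha>0}. (\<lambda>c. (- u \<alpha> / u \<alpha>0) * m \<alpha> c)) c"
      proof (cases "c \<in> V")
        case True
        have "u \<alpha>0 * monom_fun I \<alpha>0 c + (\<Sum>\<alpha>\<in>?A - {\<alpha>0}. u \<alpha> * monom_fun I \<alpha> c) = 0"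
          using zero[OF True] sum.remove[OF finA \<alpha>0, of "\<lambda>\<alpha>. u \<alpha> * monom_fun I \<alpha> c"] by simp
        then have "monom_fun I \<alpha>0 c = - (\<Sum>\<alpha>\<in>?A - {\<alpha>0}. u \<alpha> * monom_fun I \<alpha> c) / u \<alpha>0"
          using u by (simp add: field_simps eq_neg_iff_add_eq_0)
        then show ?thesis using True
          by (simp add: sum_fun_apply m_def sum_divide_distrib sum_negf)
      qed (simp add: m_def sum_fun_apply)
    qed
    then show ?thesis
      by (simp only:) (intro fs.span_sum fs.span_scale fs.span_base imageI)
  qed
  have mW: "m \<alpha> \<in> ?W" if "\<alpha> \<in> ?A" for \<alpha>
    using m0 that by (cases "\<alpha> = \<alpha>0") (auto intro: fs.span_base)
  have ind_W: "ind c0 \<in> ?W" if c0: "c0 \<in> V" for c0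
  proof -
    define s where "s c = (SOME i. i \<in> I \<and> c i \<noteq> c0 i)" for c
    have s: "s c \<in> I \<and> c (s c) \<noteq> c0 (s c)" if "c \<in> V - {c0}" for c
      unfolding s_def by (rule someI_ex) (use sep[of c c0] that c0 in auto)
    \<comment> \<open>Lagrange interpolation: \<open>s c\<close> is a coordinate separating
      \<open>c\<close> from \<open>c0\<close>, so the product is 1 at \<open>c0\<close> and 0 at the
      other points of \<open>V\<close>. It is then reduced over a one-point base with
      \<open>\<delta> = 1\<close>.\<close>
    define L where "L z = (\<Prod>c\<in>V - {c0}. (snd z (s c) - c (s c)) * inverse (c0 (s c) - c (s c)))"
      for z :: "unit \<times> ('i \<Rightarrow> 'k)"
    have "(\<lambda>z :: unit \<times> ('i \<Rightarrow> 'k). snd z (s c)) \<in> polyfuns (pair_coords {} I)" if "c \<in> V - {c0}" for c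
      using s[OF that] by (intro polyfuns_coord) (auto simp: pair_coords_def)
    then have "L \<in> polyfuns (pair_coords {} I)"
      unfolding L_def by (intro polyfuns_prod polyfuns_mult polyfuns_diff polyfuns_const)
    from additive_normal_form[OF I p polyfuns_const polyfuns_const _ this,
        of "UNIV \<times> V" 1 "\<lambda>i j. B i j"] rel
    obtain N :: nat and h where h: "\<And>c. c \<in> V \<Longrightarrow> 1 ^ N * L ((), c) = (\<Sum>\<alpha>\<in>?A. h \<alpha> () * monom_fun I \<alpha> c)"
      by auto
    have "ind c0 = (\<Sum>\<alpha>\<in>?A. (\<lambda>c. h \<alpha> () * m \<alpha> c))"
    proof
      fix c
      show "ind c0 c = (\<Sum>\<alpha>\<in>?A. (\<lambda>c. h \<alpha> () * m \<alpha> c)) c"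
      proof (cases "c \<in> V")
        case True
        have "L ((), c) = ind c0 c"
        proof (cases "c = c0")
          case True
          have "L ((), c) = (\<Prod>c\<in>V - {c0}. 1)"
            unfolding L_def True snd_conv
            by (intro prod.cong refl right_inverse) (metis s right_minus_eq)
          then show ?thesis using True by (simp add: ind_def)
        next
          case False
          then have "L ((), c) = 0" unfolding L_def using True V(1) by (intro prod_zero) auto
          then show ?thesis using False by (simp add: ind_def)
        qed
        then show ?thesis using h[OF True] True by (simp add: sum_fun_apply m_def)
      next
        case False
        then show ?thesis using c0 by (auto simp: ind_def m_def sum_fun_apply)
      qed
    qed
    then show ?thesis by (simp only:) (intro fs.span_sum fs.span_scale mW)
  qed
  have inj: "inj_on ind V" by (auto simp: inj_on_def ind_def fun_eq_iff split: if_splits)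
  have "fs.independent (ind ` V)"
  proof
    assume "fs.dependent (ind ` V)"
    then obtain a where a: "\<exists>v\<in>ind ` V. a v \<noteq> 0" "(\<Sum>v\<in>ind ` V. (\<lambda>x. a v * v x)) = 0"
      using fs.dependent_finite[of "ind ` V"] V(1) by auto
    have "a (ind c) = 0" if c: "c \<in> V" for c
    proof -
      have "0 = (\<Sum>v\<in>ind ` V. (\<lambda>x. a v * v x)) c" using a(2) by simp
      also have "\<dots> = (\<Sum>c'\<in>V. a (ind c') * ind c' c)"
        by (simp add: sum_fun_apply sum.reindex[OF inj])
      also have "\<dots> = (\<Sum>c'\<in>V. if c' = c then a (ind c') else 0)"
        by (intro sum.cong) (auto simp: ind_def)
      also have "\<dots> = a (ind c)" using V(1) c by simp
      finally show ?thesis by simp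
    qed
    then show False using a(1) by blast
  qed
  then have "card (ind ` V) \<le> card (m ` (?A - {\<alpha>0}))"
    using fs.independent_span_bound[of "m ` (?A - {\<alpha>0})" "ind ` V"] finA ind_W by auto
  also have "\<dots> \<le> card (?A - {\<alpha>0})" using finA by (intro card_image_le) auto
  also have "\<dots> < card ?A" using finA \<alpha>0 by (intro psubset_card_mono) auto
  finally show False using V(2) cardA card_image[OF inj] by simp
qed

section \<open>Tori\<close>

context restricted_lie_algebra
begin

abbreviation linform :: "('g \<Rightarrow> 'k) \<Rightarrow> bool" where
  "linform l \<equiv> Vector_Spaces.linear scale (*) l"

lemma linform_add: "linform l \<Longrightarrow> l (x + y) = l x + l y"
  and linform_scale: "linform l \<Longrightarrow> l (c *s x) = c * l x"
  by (simp_all add: Vector_Spaces.linear_iff)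

lemma linform_zero: "linform l \<Longrightarrow> l 0 = 0"
  using linform_scale[of l 0 0] by simp

lemma linform_sum: "linform l \<Longrightarrow> l (\<Sum>i\<in>A. f i) = (\<Sum>i\<in>A. l (f i))"
  by (induction A rule: infinite_finite_induct) (simp_all add: linform_zero linform_add)

lemmas linform_simps = linform_add linform_scale linform_zero linform_sum

lemma linform_coord: "linform (\<lambda>v. representation Basis v b)"
  by (rule linear_representation[OF independent_Basis span_Basis])

lemma Basis_expansion: "(\<Sum>b\<in>Basis. representation Basis v b *s b) = v"
  using sum_representation_eq[OF independent_Basis _ finite_Basis subset_refl, of v] span_Basis by simp

lemma dual_forms:
  assumes "inj_on x {..<d}" "independent (x ` {..<d})"
  obtains L where "\<And>i. linform (L i)" "\<And>i j. i < d \<Longrightarrow> j < d \<Longrightarrow> L i (x j) = (if i = j then 1 else 0)"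
proof -
  let ?B = "extend_basis (x ` {..<d})"
  have B: "independent ?B" "span ?B = UNIV" "x ` {..<d} \<subseteq> ?B"
    using assms(2) by (auto simp: independent_extend_basis extend_basis_superset)
  show thesis
  proof (rule that[of "\<lambda>i v. representation ?B v (x i)"])
    show "linform (\<lambda>v. representation ?B v (x i))" for i
      by (rule linear_representation[OF B(1,2)])
    fix i j assume ij: "i < d" "j < d"
    then have "x i = x j \<longleftrightarrow> i = j" using assms(1) by (auto simp: inj_on_def)
    then show "representation ?B (x j) (x i) = (if i = j then 1 else 0)"
      using ij B(1,3) by (subst representation_basis) auto
  qed
qed

lemma prime_CHAR: "prime CHAR('k)"
  by (rule prime_CHAR_semidom[OF char_pos])

lemma CHAR_ge_2: "CHAR('k) \<ge> 2"
  using prime_CHAR by (rule prime_ge_2_nat)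

lemma bracket_add_left: "bracket (x + y) z = bracket x z + bracket y z"
  and bracket_scale_left: "bracket (c *s x) z = c *s bracket x z"
  using bracket_linear_left[of z] by (simp_all add: Vector_Spaces.linear_iff)

lemma bracket_add_right: "bracket z (x + y) = bracket z x + bracket z y"
  and bracket_scale_right: "bracket z (c *s x) = c *s bracket z x"
  using bracket_linear_right[of z] by (simp_all add: Vector_Spaces.linear_iff)

lemma bracket_zero_left [simp]: "bracket 0 x = 0"
  and bracket_zero_right [simp]: "bracket x 0 = 0"
  using bracket_scale_left[of 0 0 x] bracket_scale_right[of x 0 0] by simp_all

lemma bracket_sum_left: "bracket (\<Sum>i\<in>A. f i) z = (\<Sum>i\<in>A. bracket (f i) z)"
  by (induction A rule: infinite_finite_induct) (simp_all add: bracket_add_left)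

lemma bracket_sum_right: "bracket z (\<Sum>i\<in>A. f i) = (\<Sum>i\<in>A. bracket z (f i))"
  by (induction A rule: infinite_finite_induct) (simp_all add: bracket_add_right)

lemma bracket_antisym: "bracket y x = - bracket x y"
proof -
  have "bracket x y + bracket y x = 0"
    using bracket_self[of "x + y"] bracket_self[of x] bracket_self[of y]
    by (simp add: bracket_add_left bracket_add_right add.commute)
  then show ?thesis by (simp add: eq_neg_iff_add_eq_0 add.commute)
qed

lemma pmap_zero [simp]: "pmap 0 = 0"
  using pmap_scale[of 0 0] char_pos by (simp add: power_0_left)

lemma jacobson_coeff_commuting:
  assumes "bracket x y = 0"
  shows "jacobson_coeff bracket x y (Suc n) j = 0"
proof (induction n arbitrary: j)
  case 0
  have "bracket y x = 0" using assms by (simp add: bracket_antisym[of y x])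
  then show ?case using bracket_self by simp
next
  case (Suc n)
  then show ?case by (subst jacobson_coeff.simps(2)) (simp del: jacobson_coeff.simps)
qed

text \<open>Jacobson's correction terms are iterated brackets with at least one bracket, because the
  exponent \<open>CHAR('k) - 1\<close> is positive. On a torus the p-map is therefore
  semilinear.\<close>

lemma pmap_add_commuting:
  assumes "bracket x y = 0"
  shows "pmap (x + y) = pmap x + pmap y"
proof -
  have "CHAR('k) - 1 = Suc (CHAR('k) - 2)" using CHAR_ge_2 by simp
  then have "jacobson_coeff bracket x y (CHAR('k) - 1) j = 0" for j
    using jacobson_coeff_commuting[OF assms] by simp
  then show ?thesis by (subst pmap_add) simp
qed

lemma torus_subspace: "torus T \<Longrightarrow> subspace T"
  and torus_pmap: "torus T \<Longrightarrow> x \<in> T \<Longrightarrow> pmap x \<in> T"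
  and torus_bracket: "torus T \<Longrightarrow> x \<in> T \<Longrightarrow> y \<in> T \<Longrightarrow> bracket x y = 0"
  by (auto simp: torus_def p_subalgebra_def)

lemma torus_pmap_add: "torus T \<Longrightarrow> x \<in> T \<Longrightarrow> y \<in> T \<Longrightarrow> pmap (x + y) = pmap x + pmap y"
  by (simp add: pmap_add_commuting torus_bracket)

lemma torus_sum:
  "torus T \<Longrightarrow> (\<And>i. i \<in> A \<Longrightarrow> x i \<in> T) \<Longrightarrow> (\<Sum>i\<in>A. c i *s x i) \<in> T"
  by (intro subspace_sum subspace_scale torus_subspace)

lemma torus_pmap_sum:
  assumes "torus T"
  shows "(\<And>i. i \<in> A \<Longrightarrow> x i \<in> T) \<Longrightarrow>
    pmap (\<Sum>i\<in>A. c i *s x i) = (\<Sum>i\<in>A. c i ^ CHAR('k) *s pmap (x i))"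
proof (induction A rule: infinite_finite_induct)
  case (insert a A)
  have "pmap (c a *s x a + (\<Sum>i\<in>A. c i *s x i)) = pmap (c a *s x a) + pmap (\<Sum>i\<in>A. c i *s x i)"
    using insert.prems by (intro torus_pmap_add[OF assms] torus_sum[OF assms]
        subspace_scale[OF torus_subspace[OF assms]]) auto
  then show ?case using insert by (simp add: pmap_scale)
qed simp_all

text \<open>Semisimplicity enters here: \<open>x\<close> lies in the p-subalgebra generated by its
  p-th power, which is zero. Injectivity of the p-map on a torus follows.\<close>

lemma torus_pmap_eq_zero:
  assumes "torus T" "x \<in> T" "pmap x = 0"
  shows "x = 0"
proof -
  have "x \<in> p_subalgebra hull {0}" using assms by (auto simp: torus_def semisimple_def)
  moreover have "p_subalgebra {0}" by (simp add: p_subalgebra_def)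
  then have "p_subalgebra hull {0} \<subseteq> {0}" by (intro hull_minimal) auto
  ultimately show ?thesis by blast
qed

lemma torus_pmap_inj:
  assumes T: "torus T" "x \<in> T" "y \<in> T" and eq: "pmap x = pmap y"
  shows "x = y"
proof -
  have xy: "x - y \<in> T" using T by (intro subspace_diff torus_subspace)
  have "pmap (x - y) + pmap y = pmap x"
    using torus_pmap_add[OF T(1) xy T(3)] by simp
  then have "pmap (x - y) = 0" using eq by simp
  then have "x - y = 0" by (rule torus_pmap_eq_zero[OF T(1) xy])
  then show ?thesis by simp
qed

lemma span_insert_lessThan_image:
  "x \<in> span (H \<union> f ` {..<n}) \<longleftrightarrow> (\<exists>a::nat \<Rightarrow> 'k. x - (\<Sum>i<n. a i *s f i) \<in> span H)"
proof (induction n arbitrary: x)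
  case (Suc n)
  have "H \<union> f ` {..<Suc n} = insert (f n) (H \<union> f ` {..<n})" by (auto simp: lessThan_Suc)
  then have "x \<in> span (H \<union> f ` {..<Suc n}) \<longleftrightarrow>
      (\<exists>k a. x - k *s f n - (\<Sum>i<n. a i *s f i) \<in> span H)"
    by (simp only: span_breakdown_eq Suc)
  also have "\<dots> \<longleftrightarrow> (\<exists>a. x - (\<Sum>i<Suc n. a i *s f i) \<in> span H)"
  proof
    assume "\<exists>k a. x - k *s f n - (\<Sum>i<n. a i *s f i) \<in> span H"
    then obtain k a where "x - k *s f n - (\<Sum>i<n. a i *s f i) \<in> span H" by (elim exE)
    moreover have "(\<Sum>i<n. (a(n := k)) i *s f i) = (\<Sum>i<n. a i *s f i)" by (intro sum.cong) auto
    ultimately have "x - (\<Sum>i<Suc n. (a(n := k)) i *s f i) \<in> span H"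
      by (simp add: algebra_simps)
    then show "\<exists>a. x - (\<Sum>i<Suc n. a i *s f i) \<in> span H" by (rule exI[of _ "a(n := k)"])
  next
    assume "\<exists>a. x - (\<Sum>i<Suc n. a i *s f i) \<in> span H"
    then obtain a where "x - (\<Sum>i<Suc n. a i *s f i) \<in> span H" by (elim exE)
    then have "x - a n *s f n - (\<Sum>i<n. a i *s f i) \<in> span H" by (simp add: algebra_simps)
    then show "\<exists>k a. x - k *s f n - (\<Sum>i<n. a i *s f i) \<in> span H" by (intro exI)
  qed
  finally show ?case .
qed simp

end

text \<open>
  The polynomials \<open>C\<^sub>i\<close> with \<open>C\<^sub>0 = a\<^sub>0 T\<^sup>p\<close> and \<open>C\<^sub>i = C\<^sub>i\<^sub>-\<^sub>1\<^sup>p + a\<^sub>i T\<^sup>p\<close> give the coefficients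
  \<open>c\<^sub>i = C\<^sub>i(t)\<close> of a fixed vector \<open>\<Sum>\<^sub>i\<^sub><\<^sub>n c\<^sub>i \<phi>\<^sup>i(v)\<close> of a \<open>p\<close>-semilinear map \<open>\<phi>\<close> with
  \<open>\<phi>\<^sup>n(v) = \<Sum>\<^sub>i\<^sub><\<^sub>n a\<^sub>i \<phi>\<^sup>i(v)\<close>, provided that \<open>C\<^sub>n\<^sub>-\<^sub>1(t) = t\<close>.
\<close>

primrec fixed_coeff :: "nat \<Rightarrow> (nat \<Rightarrow> 'k::field) \<Rightarrow> nat \<Rightarrow> 'k poly" where
  "fixed_coeff p a 0 = monom (a 0) p"
| "fixed_coeff p a (Suc i) = fixed_coeff p a i ^ p + monom (a (Suc i)) p"

lemma monom_dvd_fixed_coeff: "p > 0 \<Longrightarrow> monom 1 p dvd fixed_coeff p a i"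
proof (induction i)
  case 0
  have "fixed_coeff p a 0 = monom 1 p * [:a 0:]" by (simp add: smult_monom mult.commute)
  then show ?case by (rule dvdI)
next
  case (Suc i)
  have "monom (a (Suc i)) p = monom 1 p * [:a (Suc i):]" by (simp add: smult_monom mult.commute)
  then have "monom 1 p dvd monom (a (Suc i)) p" by (rule dvdI)
  moreover have "monom 1 p dvd fixed_coeff p a i ^ p"
    using Suc dvd_trans[OF _ dvd_power[of p "fixed_coeff p a i"]] by simp
  ultimately show ?case by simp
qed

text \<open>A nonzero \<open>C_i\<close> is divisible by \<open>T^p\<close>, so its p-th power has
  degree at least \<open>p * p\<close>, too large to be cancelled by the new term
  \<open>a_(i+1) T^p\<close>.\<close>

lemma fixed_coeff_nonzero:
  assumes p: "p \<ge> 2"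
  shows "\<exists>j\<le>i. a j \<noteq> 0 \<Longrightarrow> fixed_coeff p a i \<noteq> 0"
proof (induction i)
  case 0
  then show ?case by simp
next
  case (Suc i)
  show ?case
  proof (cases "fixed_coeff p a i = 0")
    case True
    then have "\<not> (\<exists>j\<le>i. a j \<noteq> 0)" using Suc.IH by blast
    then have "a (Suc i) \<noteq> 0" using Suc.prems le_Suc_eq by auto
    then show ?thesis using True p by (simp add: power_0_left)
  next
    case False
    have "degree (monom (1::'a) p) \<le> degree (fixed_coeff p a i)"
      using p by (intro dvd_imp_degree_le[OF monom_dvd_fixed_coeff False]) simp
    then have deg: "p \<le> degree (fixed_coeff p a i)" by (simp add: degree_monom_eq)
    have "degree (monom (a (Suc i)) p) \<le> p" by (rule degree_monom_le)
    also have "\<dots> < p * p" using p by simp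
    also have "\<dots> \<le> degree (fixed_coeff p a i ^ p)"
      using deg by (simp add: degree_power_eq[OF False])
    finally have lt: "degree (monom (a (Suc i)) p) < degree (fixed_coeff p a i ^ p)" .
    then have "degree (fixed_coeff p a (Suc i)) > 0" by (simp add: degree_add_eq_left)
    then show ?thesis by (intro notI) simp
  qed
qed

text \<open>Writing \<open>C_i = T^p R\<close>, a nonzero solution of \<open>C_i(t) = t\<close> is a
  root of \<open>T^(p-1) R - 1\<close>. This polynomial has positive degree, and its constant term
  -1 keeps the root away from 0.\<close>

lemma fixed_coeff_root:
  fixes a :: "nat \<Rightarrow> 'k::alg_closed_field"
  assumes p: "p \<ge> 2" and a: "\<exists>j\<le>i. a j \<noteq> 0"
  shows "\<exists>t. t \<noteq> 0 \<and> poly (fixed_coeff p a i) t = t"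
proof -
  obtain R where R: "fixed_coeff p a i = monom 1 p * R"
    using monom_dvd_fixed_coeff[of p a i] p by (auto elim: dvdE)
  have R0: "R \<noteq> 0" using fixed_coeff_nonzero[OF p a] R by auto
  let ?P = "monom 1 (p - 1) * R - 1"
  have "degree (monom 1 (p - 1) * R) \<ge> 1" using R0 p by (simp add: degree_mult_eq degree_monom_eq)
  then have "degree ?P > 0"
    using degree_add_eq_left[of "-1" "monom 1 (p - 1) * R"] by simp
  then obtain t where "poly ?P t = 0" using alg_closed_imp_poly_has_root by blast
  then have t: "t ^ (p - 1) * poly R t = 1" by (simp add: poly_monom)
  then have "t \<noteq> 0" using p by (intro notI) (simp add: power_0_left)
  moreover have "poly (fixed_coeff p a i) t = t * (t ^ (p - 1) * poly R t)"
    using p by (simp add: R poly_monom power_eq_if)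
  ultimately show ?thesis using t by auto
qed

text \<open>It provides, coefficient by coefficient, the correction that turns a vector fixed modulo
  the toral span into a fixed one.\<close>

lemma artin_schreier_root:
  fixes r :: "'k::alg_closed_field"
  assumes "p \<ge> 2"
  shows "\<exists>s. s ^ p + r = s"
proof -
  let ?P = "monom 1 p + [:r, -1:]"
  have "degree ?P = p" using assms by (subst degree_add_eq_left) (auto simp: degree_monom_eq)
  then obtain s where "poly ?P s = 0" using alg_closed_imp_poly_has_root[of ?P] assms by auto
  then have "s ^ p + r = s" by (simp add: poly_monom algebra_simps)
  then show ?thesis ..
qed

section \<open>Toral elements of a torus\<close>

locale restricted_lie_algebra_alg_closed = restricted_lie_algebra scale Basis bracket pmap
  for scale :: "'k::alg_closed_field \<Rightarrow> 'g::ab_group_add \<Rightarrow> 'g" (infixr "*s" 75)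
    and Basis bracket pmap
begin

text \<open>Modulo the span \<open>?V\<close> of the toral elements, the iterated p-th powers of a
  vector outside \<open>?V\<close> satisfy a first linear relation. The polynomials
  \<open>fixed_coeff\<close> yield a combination \<open>x\<close> of them fixed modulo
  \<open>?V\<close>, and an Artin-Schreier correction \<open>?y\<close> from \<open>?V\<close> makes
  \<open>x + ?y\<close> toral. Then \<open>x\<close> lies in \<open>?V\<close>, which is a shorter
  relation.\<close>

lemma torus_span_toral:
  assumes T: "torus T"
  shows "span {x \<in> T. pmap x = x} = T" (is "span ?Fix = T")
proof (rule ccontr)
  let ?p = "CHAR('k)"
  let ?V = "span ?Fix"
  have FT: "?Fix \<subseteq> T" by blast
  have VT: "?V \<subseteq> T" by (rule span_minimal[OF FT torus_subspace[OF T]])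
  assume "?V \<noteq> T"
  then obtain v where v: "v \<in> T" "v \<notin> ?V" using VT by blast
  define f where "f i = (pmap ^^ i) v" for i
  have f0: "f 0 = v" and fS: "f (Suc i) = pmap (f i)" for i by (simp_all add: f_def)
  have fT: "f i \<in> T" for i by (induction i) (use v torus_pmap[OF T] in \<open>simp_all add: f0 fS\<close>)
  have V_expand: "\<exists>A r. finite A \<and> A \<subseteq> ?Fix \<and> z = (\<Sum>a\<in>A. r a *s a)" if "z \<in> ?V" for z
    using that unfolding span_explicit by auto
  \<comment> \<open>Taking p-th roots of the coefficients gives a preimage inside \<open>?V\<close>,
    and injectivity of the p-map identifies it with \<open>x\<close>. Hence no iterate of
    \<open>v\<close> ever enters \<open>?V\<close>.\<close>
  have pV: "x \<in> ?V" if x: "x \<in> T" "pmap x \<in> ?V" for x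
  proof -
    obtain A r where A: "finite A" "A \<subseteq> ?Fix" "pmap x = (\<Sum>a\<in>A. r a *s a)"
      using V_expand[OF x(2)] by (elim exE conjE)
    have "\<forall>a. \<exists>s. s ^ ?p = r a" by (intro allI nth_root_exists[OF char_pos])
    from choice[OF this] obtain s where s: "\<forall>a. s a ^ ?p = r a" by (elim exE)
    let ?y = "\<Sum>a\<in>A. s a *s a"
    have "?y \<in> ?V" using A(2) by (intro span_sum span_scale span_base) auto
    have AT: "a \<in> T" "pmap a = a" if "a \<in> A" for a using subsetD[OF A(2) that] by simp_all
    have "pmap ?y = (\<Sum>a\<in>A. s a ^ ?p *s pmap a)" by (rule torus_pmap_sum[OF T AT(1)])
    then have "pmap ?y = pmap x"
      using s by (simp add: A(3) AT(2) cong: sum.cong)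
    with \<open>?y \<in> ?V\<close> VT have "?y = x" by (intro torus_pmap_inj[OF T _ x(1)]) auto
    with \<open>?y \<in> ?V\<close> show ?thesis by simp
  qed
  have fV: "f i \<notin> ?V" for i
    by (induction i) (use v pV fT in \<open>auto simp: f0 fS\<close>)
  let ?U = "\<lambda>n. span (?Fix \<union> f ` {..<n})"
  have "\<exists>n. f n \<in> ?U n"
  proof (rule ccontr)
    assume no: "\<nexists>n. f n \<in> ?U n"
    have "n \<le> dim (?Fix \<union> f ` {..<n})" for n
    proof (induction n)
      case (Suc n)
      have "?Fix \<union> f ` {..<Suc n} = insert (f n) (?Fix \<union> f ` {..<n})" by (auto simp: lessThan_Suc)
      then show ?case using Suc no by (simp add: dim_insert)
    qed simp
    from this[of "Suc dimension"] dim_subset_UNIV[of "?Fix \<union> f ` {..<Suc dimension}"] show False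
      by simp
  qed
  then obtain n where n: "f n \<in> ?U n" and least: "\<And>m. m < n \<Longrightarrow> f m \<notin> ?U m"
    using exists_least_iff[of "\<lambda>n. f n \<in> ?U n"] by blast
  have n0: "n > 0" using n fV by (cases n) auto
  obtain a where a: "f n - (\<Sum>i<n. a i *s f i) \<in> ?V"
    using n unfolding span_insert_lessThan_image by (elim exE)
  define z where "z = f n - (\<Sum>i<n. a i *s f i)"
  have zV: "z \<in> ?V" using a by (simp add: z_def)
  have fn: "f n = (\<Sum>i<n. a i *s f i) + z" by (simp add: z_def)
  \<comment> \<open>Otherwise \<open>f n\<close> would equal \<open>z\<close> and lie in
    \<open>?V\<close>.\<close>
  have "\<exists>j\<le>n - 1. a j \<noteq> 0"
  proof (rule ccontr)
    assume "\<not> ?thesis"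
    then have "(\<Sum>i<n. a i *s f i) = 0" by (intro sum.neutral) auto
    then show False using fV[of n] zV fn by simp
  qed
  then obtain t where t: "t \<noteq> 0" "poly (fixed_coeff ?p a (n - 1)) t = t"
    using fixed_coeff_root[OF CHAR_ge_2] by blast
  define c where "c i = poly (fixed_coeff ?p a i) t" for i
  have c0: "c 0 = t ^ ?p * a 0" and cS: "c (Suc i) = c i ^ ?p + t ^ ?p * a (Suc i)" for i
    by (simp_all add: c_def poly_monom mult.commute)
  have ct: "c (n - 1) = t" using t by (simp add: c_def)
  define x where "x = (\<Sum>i<n. c i *s f i)"
  have xT: "x \<in> T" unfolding x_def by (rule torus_sum[OF T fT])
  obtain m where m: "n = Suc m" using n0 gr0_implies_Suc by blast
  have "pmap x = (\<Sum>i<n. c i ^ ?p *s f (Suc i))"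
    unfolding x_def fS by (rule torus_pmap_sum[OF T fT])
  also have "\<dots> = (\<Sum>i<m. c i ^ ?p *s f (Suc i)) + t ^ ?p *s f n"
    using ct by (simp add: m)
  also have "\<dots> = (\<Sum>i<m. c i ^ ?p *s f (Suc i)) + (\<Sum>i<n. (t ^ ?p * a i) *s f i) + t ^ ?p *s z"
    unfolding fn by (simp add: scale_right_distrib scale_sum_right add.assoc)
  also have "(\<Sum>i<m. c i ^ ?p *s f (Suc i)) + (\<Sum>i<n. (t ^ ?p * a i) *s f i) = x"
  proof -
    have "x = c 0 *s f 0 + (\<Sum>i<m. c (Suc i) *s f (Suc i))"
      unfolding x_def m by (rule sum.lessThan_Suc_shift)
    also have "(\<Sum>i<m. c (Suc i) *s f (Suc i)) =
        (\<Sum>i<m. c i ^ ?p *s f (Suc i)) + (\<Sum>i<m. (t ^ ?p * a (Suc i)) *s f (Suc i))"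
      by (simp only: cS scale_left_distrib sum.distrib)
    finally show ?thesis
      unfolding m sum.lessThan_Suc_shift[of _ m] by (simp only: c0 add_ac)
  qed
  finally have px: "pmap x = x + t ^ ?p *s z" .
  have "t ^ ?p *s z \<in> ?V" using zV by (rule span_scale)
  from V_expand[OF this]
  obtain A r where A: "finite A" "A \<subseteq> ?Fix" "t ^ ?p *s z = (\<Sum>a\<in>A. r a *s a)"
    by (elim exE conjE)
  \<comment> \<open>The error of \<open>x\<close> is the combination with coefficients
    \<open>r\<close>, so \<open>?y\<close> has to satisfy \<open>pmap ?y + error = ?y\<close>; on
    toral vectors this separates into one scalar equation for each coefficient.\<close>
  have "\<forall>a. \<exists>s. s ^ ?p + r a = s" by (intro allI artin_schreier_root[OF CHAR_ge_2])
  from choice[OF this] obtain s where s: "\<forall>a. s a ^ ?p + r a = s a" by (elim exE)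
  let ?y = "\<Sum>a\<in>A. s a *s a"
  have yV: "?y \<in> ?V" using A(2) by (intro span_sum span_scale span_base) auto
  have AT: "a \<in> T" "pmap a = a" if "a \<in> A" for a using subsetD[OF A(2) that] by simp_all
  have "pmap ?y = (\<Sum>a\<in>A. s a ^ ?p *s pmap a)" by (rule torus_pmap_sum[OF T AT(1)])
  also have "\<dots> = (\<Sum>a\<in>A. s a ^ ?p *s a)"
    by (simp add: AT(2) cong: sum.cong)
  finally have "pmap ?y + t ^ ?p *s z = (\<Sum>a\<in>A. (s a ^ ?p + r a) *s a)"
    unfolding A(3) by (simp add: scale_left_distrib sum.distrib)
  then have py: "pmap ?y + t ^ ?p *s z = ?y" using s by simp
  have "pmap (x + ?y) = pmap x + pmap ?y"
    using yV VT by (intro torus_pmap_add[OF T xT]) auto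
  also have "\<dots> = x + (pmap ?y + t ^ ?p *s z)" unfolding px by (simp only: add_ac)
  also have "\<dots> = x + ?y" by (simp only: py)
  finally have "x + ?y \<in> ?Fix"
    using xT yV VT subspace_add[OF torus_subspace[OF T]] by blast
  then have "x + ?y \<in> ?V" by (rule span_base)
  from span_diff[OF this yV] have "x \<in> ?V" by simp
  \<comment> \<open>The last coefficient of \<open>x\<close> is \<open>t\<close>, which is nonzero,
    so \<open>f m\<close> depends on the earlier iterates modulo \<open>?V\<close>, against the
    minimality of \<open>n = Suc m\<close>.\<close>
  then have "t *s f m + (\<Sum>i<m. c i *s f i) \<in> ?V" using ct by (simp add: x_def m algebra_simps)
  then have "inverse t *s (t *s f m + (\<Sum>i<m. c i *s f i)) \<in> ?V" by (rule span_scale)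
  then have "f m - (\<Sum>i<m. (- inverse t * c i) *s f i) \<in> ?V"
    using t(1) by (simp add: scale_right_distrib scale_sum_right sum_negf)
  then have "f m \<in> ?U m"
    unfolding span_insert_lessThan_image by (rule exI[of _ "\<lambda>i. - inverse t * c i"])
  then show False using least[of m] m by simp
qed

lemma torus_toral_basis:
  assumes T: "torus T"
  obtains e where "e \<in> frames (dim T)" "span (e ` {..<dim T}) = T" "\<And>i. i < dim T \<Longrightarrow> pmap (e i) = e i"
proof -
  let ?Fix = "{x \<in> T. pmap x = x}"
  obtain B where B: "B \<subseteq> ?Fix" "independent B" "?Fix \<subseteq> span B" "card B = dim ?Fix"
    by (rule basis_exists)
  have sB: "span B = T"
    using torus_span_toral[OF T] span_mono[OF B(1)] span_minimal[OF B(3) subspace_span] by blast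
  have cB: "card B = dim T" using dim_eq_card_independent[OF B(2)] dim_span[of B] sB by simp
  have "finite B" by (rule finiteI_independent[OF B(2)])
  then obtain e where e: "bij_betw e {..<dim T} B"
    using ex_bij_betw_nat_finite[of B] cB by (auto simp: atLeast0LessThan)
  let ?e = "restrict e {..<dim T}"
  have im: "?e ` {..<dim T} = B" using e by (simp add: bij_betw_def)
  show thesis
  proof (rule that[of ?e])
    show "?e \<in> frames (dim T)"
      using e B(2) im unfolding frames_def by (auto simp: bij_betw_def inj_on_def)
    show "span (?e ` {..<dim T}) = T" using sB im by simp
    show "pmap (?e i) = ?e i" if "i < dim T" for i using that B(1) im by blast
  qed
qed

end

section \<open>Polynomial maps\<close>

context restricted_lie_algebra
begin

definition polymap :: "('x \<Rightarrow> 'k) set \<Rightarrow> ('x \<Rightarrow> 'g) \<Rightarrow> bool" where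
  "polymap F u \<longleftrightarrow> (\<forall>l. linform l \<longrightarrow> (\<lambda>x. l (u x)) \<in> polyfuns F)"

lemma polymapD: "polymap F u \<Longrightarrow> linform l \<Longrightarrow> (\<lambda>x. l (u x)) \<in> polyfuns F"
  by (simp add: polymap_def)

lemma polymap_const: "polymap F (\<lambda>_. v)"
  by (simp add: polymap_def polyfuns_const)

lemma polymap_add: "polymap F u \<Longrightarrow> polymap F v \<Longrightarrow> polymap F (\<lambda>x. u x + v x)"
  by (simp add: polymap_def linform_add polyfuns_add)

lemma polymap_scale: "f \<in> polyfuns F \<Longrightarrow> polymap F u \<Longrightarrow> polymap F (\<lambda>x. f x *s u x)"
  by (simp add: polymap_def linform_scale polyfuns_mult)

lemma polymap_sum: "(\<And>i. i \<in> A \<Longrightarrow> polymap F (u i)) \<Longrightarrow> polymap F (\<lambda>x. \<Sum>i\<in>A. u i x)"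
  by (induction A rule: infinite_finite_induct) (simp_all add: polymap_const polymap_add)

lemma polymap_coord: "polymap F u \<Longrightarrow> (\<lambda>x. representation Basis (u x) b) \<in> polyfuns F"
  by (rule polymapD[OF _ linform_coord])

lemma polymap_eval: "i \<in> A \<Longrightarrow> polymap (eval_coords A) (\<lambda>\<phi>. \<phi> i)"
  unfolding polymap_def eval_coords_def by (intro allI impI polyfuns_coord) blast

lemma polyfuns_eval_coordsI:
  assumes "c \<in> eval_coords A" "\<And>i. i \<in> A \<Longrightarrow> polymap F (\<lambda>x. a x i)"
  shows "(\<lambda>x. c (a x)) \<in> polyfuns F"
proof -
  obtain l i where "c = (\<lambda>\<phi>. l (\<phi> i))" "i \<in> A" "linform l"
    using assms(1) unfolding eval_coords_def by blast
  then show ?thesis using polymapD[OF assms(2)] by simp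
qed

lemma polyfuns_eval_coords_cong:
  assumes "f \<in> polyfuns (eval_coords A)" "\<And>i. i \<in> A \<Longrightarrow> x i = y i"
  shows "f x = f y"
  using assms(1) by induction (auto simp: eval_coords_def assms(2))

lemma polymap_linear:
  assumes "Vector_Spaces.linear scale scale f" "polymap F u"
  shows "polymap F (\<lambda>x. f (u x))"
  unfolding polymap_def
proof (intro allI impI)
  fix l assume "linform l"
  then have "linform (l \<circ> f)" by (rule Vector_Spaces.linear_compose[OF assms(1)])
  from polymapD[OF assms(2) this] show "(\<lambda>x. l (f (u x))) \<in> polyfuns F" by simp
qed

lemma polymap_bracket:
  assumes "polymap F u" "polymap F v"
  shows "polymap F (\<lambda>x. bracket (u x) (v x))"
proof -
  let ?r = "representation Basis"
  have "bracket x y = (\<Sum>b\<in>Basis. \<Sum>c\<in>Basis. ?r x b *s ?r y c *s bracket b c)" for x y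
  proof -
    have "bracket x y = (\<Sum>b\<in>Basis. ?r x b *s bracket b y)"
      using bracket_sum_left[of "\<lambda>b. ?r x b *s b" Basis y]
      by (simp add: Basis_expansion bracket_scale_left)
    moreover have "bracket b y = (\<Sum>c\<in>Basis. ?r y c *s bracket b c)" for b
      using bracket_sum_right[of b "\<lambda>c. ?r y c *s c" Basis]
      by (simp add: Basis_expansion bracket_scale_right)
    ultimately show ?thesis by (simp only: scale_sum_right)
  qed
  then have "(\<lambda>x. bracket (u x) (v x)) =
      (\<lambda>x. \<Sum>b\<in>Basis. \<Sum>c\<in>Basis. ?r (u x) b *s ?r (v x) c *s bracket b c)" by (intro ext)
  then show ?thesis
    using polymap_coord[OF assms(1)] polymap_coord[OF assms(2)]
    by (simp only:) (intro polymap_sum polymap_scale polymap_const)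
qed

lemma polymap_jacobson_coeff:
  assumes "polymap F u" "polymap F v"
  shows "polymap F (\<lambda>x. jacobson_coeff bracket (u x) (v x) n j)"
proof (induction n arbitrary: j)
  case 0
  then show ?case using assms(1) by (cases "j = 0") (simp_all add: polymap_const)
next
  case (Suc n)
  have "polymap F (\<lambda>x. if j = 0 then 0 else bracket (u x) (jacobson_coeff bracket (u x) (v x) n (j - 1)))"
    using polymap_bracket[OF assms(1) Suc] by (cases "j = 0") (simp_all add: polymap_const)
  then show ?case
    unfolding jacobson_coeff.simps by (intro polymap_add polymap_bracket assms(2) Suc)
qed

text \<open>The p-map is not additive on the whole algebra. Basis vectors are split off one at a
  time, and every correction term of Jacobson's formula is an iterated bracket, hence
  polynomial.\<close>

lemma polymap_pmap:
  assumes u: "polymap F u"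
  shows "polymap F (\<lambda>x. pmap (u x))"
proof -
  let ?r = "representation Basis"
  have "polymap F (\<lambda>x. pmap (\<Sum>b\<in>A. ?r (u x) b *s b))" if "finite A" for A
    using that
  proof (induction A rule: finite_induct)
    case empty
    then show ?case by (simp add: polymap_const)
  next
    case (insert a A)
    have s: "polymap F (\<lambda>x. ?r (u x) b *s b)" for b
      by (intro polymap_scale polymap_const polymap_coord u)
    have "polymap F (\<lambda>x. pmap (?r (u x) a *s a + (\<Sum>b\<in>A. ?r (u x) b *s b)))"
      unfolding pmap_add pmap_scale
      by (intro polymap_add polymap_sum insert.IH polymap_scale polymap_jacobson_coeff s
          polymap_const polyfuns_power polyfuns_const polymap_coord u)
    then show ?case using insert.hyps by simp
  qed
  from this[OF finite_Basis] show ?thesis by (simp only: Basis_expansion)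
qed

end

section \<open>Determinants and cofactors as polynomial functions\<close>

lemma polyfuns_det:
  fixes A :: "'x \<Rightarrow> 'k::field mat"
  assumes "\<And>x. A x \<in> carrier_mat n n" "\<And>i j. i < n \<Longrightarrow> j < n \<Longrightarrow> (\<lambda>x. A x $$ (i, j)) \<in> polyfuns F"
  shows "(\<lambda>x. det (A x)) \<in> polyfuns F"
proof -
  have "(\<lambda>x. det (A x)) = (\<lambda>x. \<Sum>p\<in>{p. p permutes {0..<n}}. signof p * (\<Prod>i = 0..<n. A x $$ (i, p i)))"
    using det_def'[OF assms(1)] by (intro ext)
  moreover have "(\<lambda>x. A x $$ (i, p i)) \<in> polyfuns F" if "p permutes {0..<n}" "i \<in> {0..<n}" for p i
    using that permutes_in_image[OF that(1), of i] by (intro assms(2)) auto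
  ultimately show ?thesis
    by (simp only:) (intro polyfuns_sum polyfuns_mult polyfuns_const polyfuns_prod, auto)
qed

lemma polyfuns_cofactor:
  fixes A :: "'x \<Rightarrow> 'k::field mat"
  assumes A: "\<And>x. A x \<in> carrier_mat n n" "\<And>i j. i < n \<Longrightarrow> j < n \<Longrightarrow> (\<lambda>x. A x $$ (i, j)) \<in> polyfuns F"
    and ij: "i < n" "j < n"
  shows "(\<lambda>x. cofactor (A x) i j) \<in> polyfuns F"
proof -
  have "(\<lambda>x. det (mat_delete (A x) i j)) \<in> polyfuns F"
  proof (rule polyfuns_det)
    show "mat_delete (A x) i j \<in> carrier_mat (n - 1) (n - 1)" for x
      using mat_delete_carrier[OF A(1)] .
    fix a b assume ab: "a < n - 1" "b < n - 1"
    let ?a = "if a < i then a else Suc a" and ?b = "if b < j then b else Suc b"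
    have "mat_delete (A x) i j $$ (a, b) = A x $$ (?a, ?b)" for x
      using ab A(1)[of x] by (simp add: mat_delete_def)
    moreover have "(\<lambda>x. A x $$ (?a, ?b)) \<in> polyfuns F" using ab by (intro A(2)) auto
    ultimately show "(\<lambda>x. mat_delete (A x) i j $$ (a, b)) \<in> polyfuns F" by (simp only:)
  qed
  then show ?thesis unfolding cofactor_def by (intro polyfuns_mult polyfuns_const)
qed


section \<open>Frames and embeddings of tori\<close>

context restricted_lie_algebra
begin

lemma frames_iff:
  "x \<in> frames d \<longleftrightarrow> x \<in> extensional {..<d} \<and>
     (\<forall>u. (\<Sum>i<d. u i *s x i) = 0 \<longrightarrow> (\<forall>i<d. u i = 0))"
proof
  assume x: "x \<in> frames d"
  then have xf: "inj_on x {..<d}" "independent (x ` {..<d})" by (auto simp: frames_def)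
  obtain L where L: "\<And>i. linform (L i)"
      "\<And>i j. i < d \<Longrightarrow> j < d \<Longrightarrow> L i (x j) = (if i = j then 1 else 0)"
    by (rule dual_forms[OF xf]) (rule that)
  have "u j = 0" if u: "(\<Sum>i<d. u i *s x i) = 0" and j: "j < d" for u j
  proof -
    have "L j (\<Sum>i<d. u i *s x i) = (\<Sum>i<d. u i * (if j = i then 1 else 0))"
      using L j by (simp add: linform_simps)
    also have "\<dots> = u j" using j by (simp add: sum.delta' mult_ac if_distrib[of "\<lambda>x. _ * x"] cong: if_cong)
    finally show ?thesis using u L(1)[of j] by (simp add: linform_zero)
  qed
  then show "x \<in> extensional {..<d} \<and> (\<forall>u. (\<Sum>i<d. u i *s x i) = 0 \<longrightarrow> (\<forall>i<d. u i = 0))"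
    using x by (auto simp: frames_def)
next
  assume x: "x \<in> extensional {..<d} \<and> (\<forall>u. (\<Sum>i<d. u i *s x i) = 0 \<longrightarrow> (\<forall>i<d. u i = 0))"
  then have lin: "u i = 0" if "(\<Sum>i<d. u i *s x i) = 0" "i < d" for u i using that by blast
  have inj: "inj_on x {..<d}"
  proof (rule inj_onI, rule ccontr)
    fix i j assume ij: "i \<in> {..<d}" "j \<in> {..<d}" "x i = x j" "i \<noteq> j"
    let ?u = "\<lambda>k. (if k = i then 1 else 0) - (if k = j then 1 else 0) :: 'k"
    have "(\<Sum>k<d. ?u k *s x k) = (\<Sum>k<d. if k = i then x k else 0) - (\<Sum>k<d. if k = j then x k else 0)"
      unfolding sum_subtractf[symmetric] by (intro sum.cong) auto
    also have "\<dots> = 0" using ij by simp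
    finally show False using lin[of ?u i] ij by simp
  qed
  have "independent (x ` {..<d})"
  proof
    assume "dependent (x ` {..<d})"
    then obtain u where u: "\<exists>v\<in>x ` {..<d}. u v \<noteq> 0" "(\<Sum>v\<in>x ` {..<d}. u v *s v) = 0"
      using dependent_finite[of "x ` {..<d}"] by auto
    have "(\<Sum>i<d. u (x i) *s x i) = 0" using u(2) by (simp add: sum.reindex[OF inj])
    then have "\<And>i. i < d \<Longrightarrow> u (x i) = 0" by (rule lin)
    then show False using u(1) by auto
  qed
  then show "x \<in> frames d" using x inj by (simp add: frames_def)
qed

lemma frames_coeff_zero:
  "x \<in> frames d \<Longrightarrow> (\<Sum>i<d. u i *s x i) = 0 \<Longrightarrow> i < d \<Longrightarrow> u i = 0"
  unfolding frames_iff by (elim conjE allE[of _ u]) simp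

lemma frame_in_span: "i < d \<Longrightarrow> e i \<in> span (e ` {..<d})"
  by (rule span_base) simp

lemma frame_dual:
  assumes "x \<in> frames d"
  obtains L where "\<And>i. linform (L i)"
    "\<And>i j. i < d \<Longrightarrow> j < d \<Longrightarrow> L i (x j) = (if i = j then 1 else 0)"
    "\<And>v. v \<in> span (x ` {..<d}) \<Longrightarrow> v = (\<Sum>i<d. L i v *s x i)"
proof -
  have xf: "inj_on x {..<d}" "independent (x ` {..<d})" using assms by (auto simp: frames_def)
  obtain L where L: "\<And>i. linform (L i)"
      "\<And>i j. i < d \<Longrightarrow> j < d \<Longrightarrow> L i (x j) = (if i = j then 1 else 0)"
    by (rule dual_forms[OF xf]) (rule that)
  have ex: "v = (\<Sum>i<d. L i v *s x i)" if v: "v \<in> span (x ` {..<d})" for v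
  proof -
    obtain a where a: "v = (\<Sum>i<d. a i *s x i)"
      using v span_insert_lessThan_image[of v "{}" x d] by auto
    have "L j v = a j" if j: "j < d" for j
    proof -
      have "L j v = (\<Sum>i<d. a i * (if j = i then 1 else 0))"
        unfolding a using L j by (simp add: linform_simps)
      also have "\<dots> = a j" using j by (simp add: sum.delta' if_distrib[of "\<lambda>x. _ * x"] cong: if_cong)
      finally show ?thesis .
    qed
    then show ?thesis by (subst a) (intro sum.cong, auto)
  qed
  show thesis by (rule that[OF L ex])
qed

lemma frame_span_eq:
  assumes "x \<in> frames d" "x ` {..<d} \<subseteq> T" "subspace T" "dim T = d"
  shows "span (x ` {..<d}) = T"
proof -
  have "dim (x ` {..<d}) = d"
    using assms(1) by (auto simp: frames_def dim_eq_card_independent card_image)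
  then have "span (x ` {..<d}) = span T" using assms by (intro dim_eq_span) auto
  then show ?thesis using assms(3) span_eq_iff by simp
qed

lemma hom_on_sum:
  assumes "hom_on A f" "subspace A"
  shows "(\<And>i. i \<in> I \<Longrightarrow> x i \<in> A) \<Longrightarrow> f (\<Sum>i\<in>I. c i *s x i) = (\<Sum>i\<in>I. c i *s f (x i))"
proof (induction I rule: infinite_finite_induct)
  case (insert a I)
  have "(\<Sum>i\<in>I. c i *s x i) \<in> A" "c a *s x a \<in> A"
    using insert.prems assms(2) by (auto intro!: subspace_sum subspace_scale)
  then show ?case using insert assms(1) by (simp add: hom_on_def)
next
  case empty
  have "f (0 *s 0) = 0 *s f 0" using assms subspace_0[of A] unfolding hom_on_def by blast
  then show ?case by simp
next
  case (infinite I)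
  have "f (0 *s 0) = 0 *s f 0" using assms subspace_0[of A] unfolding hom_on_def by blast
  then show ?case using infinite by simp
qed

text \<open>For semisimplicity, the preimage in \<open>T\<close> of a p-subalgebra containing
  \<open>pmap (f x)\<close> is a p-subalgebra containing \<open>pmap x\<close>, hence
  \<open>x\<close>.\<close>

lemma hom_on_image_torus:
  assumes T: "torus T" and f: "hom_on T f"
  shows "torus (f ` T)"
proof -
  have T': "subspace T" "p_subalgebra T" using T by (auto simp: torus_def p_subalgebra_def)
  have add: "f x + f y = f (x + y)" and sc: "c *s f x = f (c *s x)"
    and br: "bracket (f x) (f y) = f (bracket x y)" and pm: "pmap (f x) = f (pmap x)"
    if "x \<in> T" "y \<in> T" for x y c
    using f that by (auto simp: hom_on_def)
  have f0: "f 0 = 0" using sc[of 0 0 0] subspace_0[OF T'(1)] by simp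
  have "p_subalgebra (f ` T)"
    unfolding p_subalgebra_def subspace_def
  proof (intro conjI ballI allI)
    show "0 \<in> f ` T" using f0 subspace_0[OF T'(1)] by force
  qed (use T' in \<open>auto simp: add sc br pm p_subalgebra_def subspace_def\<close>)
  moreover have "semisimple (f x)" if x: "x \<in> T" for x
    unfolding semisimple_def hull_def
  proof (rule InterI)
    fix H assume "H \<in> {H. p_subalgebra H \<and> {pmap (f x)} \<subseteq> H}"
    then have H: "p_subalgebra H" "f (pmap x) \<in> H" using pm[OF x x] by auto
    let ?K = "{y \<in> T. f y \<in> H}"
    have "p_subalgebra ?K"
      unfolding p_subalgebra_def subspace_def
      using T'(2) H(1) f0 by (auto simp: add[symmetric] sc[symmetric] br[symmetric] pm[symmetric]
          p_subalgebra_def subspace_def)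
    moreover have "{pmap x} \<subseteq> ?K" using H(2) torus_pmap[OF T x] by simp
    ultimately have "p_subalgebra hull {pmap x} \<subseteq> ?K" by (intro hull_minimal)
    then show "f x \<in> H" using T x by (auto simp: torus_def semisimple_def)
  qed
  ultimately show ?thesis
    using torus_bracket[OF T] br f0 by (auto simp: torus_def)
qed

lemma hom_on_frame:
  assumes T: "torus T" and f: "hom_on T f" "inj_on f T" and e: "e \<in> frames d" "span (e ` {..<d}) = T"
  shows "(\<lambda>i\<in>{..<d}. f (e i)) \<in> frames d" "span ((\<lambda>i\<in>{..<d}. f (e i)) ` {..<d}) = f ` T"
    "dim (f ` T) = d"
proof -
  let ?x = "\<lambda>i\<in>{..<d}. f (e i)"
  have eT: "e i \<in> T" if "i < d" for i using frame_in_span[OF that, of e] e(2) by simp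
  have T': "subspace T" by (rule torus_subspace[OF T])
  have fsum: "(\<Sum>i<d. u i *s ?x i) = f (\<Sum>i<d. u i *s e i)" for u
    using hom_on_sum[OF f(1) T', of "{..<d}" e u] eT by simp
  have f0: "f 0 = 0" using hom_on_sum[OF f(1) T', of "{}" e] by simp
  show fr: "?x \<in> frames d"
    unfolding frames_iff
  proof (intro conjI allI impI)
    fix u i assume u: "(\<Sum>i<d. u i *s ?x i) = 0" and i: "i < d"
    have sT: "(\<Sum>i<d. u i *s e i) \<in> T" using eT T' by (intro subspace_sum subspace_scale) auto
    have feq: "f (\<Sum>i<d. u i *s e i) = f 0" using u unfolding fsum f0 .
    have "(\<Sum>i<d. u i *s e i) = 0" by (rule inj_onD[OF f(2) feq sT subspace_0[OF T']])
    from frames_coeff_zero[OF e(1) this i] show "u i = 0" .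
  qed simp
  show sp: "span (?x ` {..<d}) = f ` T"
  proof
    show "span (?x ` {..<d}) \<subseteq> f ` T"
      using eT by (intro span_minimal torus_subspace hom_on_image_torus[OF T f(1)]) auto
    obtain L where "\<And>i. linform (L i)"
      "\<And>i j. i < d \<Longrightarrow> j < d \<Longrightarrow> L i (e j) = (if i = j then 1 else 0)"
      and L: "\<And>v. v \<in> span (e ` {..<d}) \<Longrightarrow> v = (\<Sum>i<d. L i v *s e i)"
      by (rule frame_dual[OF e(1)]) (rule that)
    show "f ` T \<subseteq> span (?x ` {..<d})"
    proof
      fix y assume "y \<in> f ` T"
      then obtain v where v: "v \<in> T" "y = f v" by blast
      have "y = (\<Sum>i<d. L i v *s ?x i)" unfolding fsum v(2) using L[of v] v(1) e(2) by simp
      then show "y \<in> span (?x ` {..<d})" by (simp only:) (intro span_sum span_scale span_base imageI)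
    qed
  qed
  show "dim (f ` T) = d"
    unfolding sp[symmetric] dim_span using fr
    by (auto simp: frames_def dim_eq_card_independent card_image)
qed

text \<open>With \<open>L\<close> dual to a frame \<open>e\<close> of \<open>t\<close>, this is the
  linear map taking \<open>e i\<close> to \<open>x i\<close>. Being polynomial in \<open>x\<close>,
  it turns functions of embeddings into functions of tuples.\<close>

definition frame_map :: "'g set \<Rightarrow> (nat \<Rightarrow> 'g \<Rightarrow> 'k) \<Rightarrow> nat \<Rightarrow> (nat \<Rightarrow> 'g) \<Rightarrow> 'g \<Rightarrow> 'g" where
  "frame_map t L d x = (\<lambda>y\<in>t. \<Sum>i<d. L i y *s x i)"

lemma frame_map_restrict:
  assumes t: "torus t" and e: "e \<in> frames d" "span (e ` {..<d}) = t"
    and L: "\<And>v. v \<in> t \<Longrightarrow> v = (\<Sum>i<d. L i v *s e i)"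
    and \<phi>: "\<phi> \<in> extensional t" "hom_on t \<phi>" and x: "\<And>i. i < d \<Longrightarrow> x i = \<phi> (e i)"
  shows "frame_map t L d x = \<phi>"
proof (rule extensionalityI)
  show "frame_map t L d x \<in> extensional t" by (simp add: frame_map_def)
  fix y assume y: "y \<in> t"
  have eT: "e i \<in> t" if "i < d" for i using frame_in_span[OF that, of e] e(2) by simp
  have "\<phi> y = \<phi> (\<Sum>i<d. L i y *s e i)" using L[OF y] by simp
  also have "\<dots> = (\<Sum>i<d. L i y *s \<phi> (e i))"
    by (rule hom_on_sum[OF \<phi>(2) torus_subspace[OF t]]) (use eT in auto)
  finally show "frame_map t L d x y = \<phi> y" using y x by (simp add: frame_map_def)
qed (rule \<phi>(1))

text \<open>In coordinates with respect to a toral frame the p-map is the Frobenius map on each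
  coordinate. A linear map between tori carrying one toral frame to another therefore commutes with
  the p-maps.\<close>

lemma frame_map_embedding:
  assumes t: "torus t" and e: "e \<in> frames d" "span (e ` {..<d}) = t" "\<And>i. i < d \<Longrightarrow> pmap (e i) = e i"
    and L: "\<And>i. linform (L i)" "\<And>i j. i < d \<Longrightarrow> j < d \<Longrightarrow> L i (e j) = (if i = j then 1 else 0)"
      "\<And>v. v \<in> t \<Longrightarrow> v = (\<Sum>i<d. L i v *s e i)"
    and T: "torus T" "dim T = d" and x: "x \<in> frames d" "\<And>i. i < d \<Longrightarrow> x i \<in> T"
      "\<And>i. i < d \<Longrightarrow> pmap (x i) = x i"
  shows "frame_map t L d x \<in> embeddings t" "frame_map t L d x ` t = T"
proof -
  let ?f = "frame_map t L d x"
  have t': "subspace t" by (rule torus_subspace[OF t])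
  have eT: "e i \<in> t" if "i < d" for i using frame_in_span[OF that, of e] e(2) by simp
  have f: "?f y = (\<Sum>i<d. L i y *s x i)" if "y \<in> t" for y using that by (simp add: frame_map_def)
  have fT: "?f y \<in> T" if "y \<in> t" for y
    unfolding f[OF that] by (rule torus_sum[OF T(1)]) (use x(2) in auto)
  have Lsum: "L j (\<Sum>i<d. a i *s e i) = a j" if "j < d" for a j
  proof -
    have "L j (\<Sum>i<d. a i *s e i) = (\<Sum>i<d. a i * (if j = i then 1 else 0))"
      using L(2) that by (simp add: linform_simps[OF L(1)])
    then show ?thesis using that
      by (simp add: sum.delta' if_distrib[of "\<lambda>x. _ * x"] cong: if_cong)
  qed
  have Lp: "L j (pmap y) = L j y ^ CHAR('k)" if "y \<in> t" "j < d" for y j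
  proof -
    have "pmap y = pmap (\<Sum>i<d. L i y *s e i)" using L(3)[OF that(1)] by simp
    also have "\<dots> = (\<Sum>i<d. L i y ^ CHAR('k) *s pmap (e i))"
      by (rule torus_pmap_sum[OF t]) (use eT in auto)
    also have "\<dots> = (\<Sum>i<d. L i y ^ CHAR('k) *s e i)" using e(3) by simp
    finally show ?thesis using Lsum[OF that(2)] by simp
  qed
  have "hom_on t ?f"
    unfolding hom_on_def
  proof (intro conjI ballI allI)
    fix y z assume yz: "y \<in> t" "z \<in> t"
    show "?f (y + z) = ?f y + ?f z"
      using yz subspace_add[OF t' yz]
      by (simp add: f linform_add[OF L(1)] scale_left_distrib sum.distrib)
    show "?f (bracket y z) = bracket (?f y) (?f z)"
      using torus_bracket[OF t yz] torus_bracket[OF T(1) fT[OF yz(1)] fT[OF yz(2)]] subspace_0[OF t']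
      by (simp add: f linform_zero[OF L(1)])
  next
    fix c y assume y: "y \<in> t"
    show "?f (c *s y) = c *s ?f y"
      using y subspace_scale[OF t' y] by (simp add: f linform_scale[OF L(1)] scale_sum_right)
  next
    fix y assume y: "y \<in> t"
    have "pmap (?f y) = (\<Sum>i<d. L i y ^ CHAR('k) *s pmap (x i))"
      unfolding f[OF y] by (rule torus_pmap_sum[OF T(1)]) (use x(2) in auto)
    also have "\<dots> = ?f (pmap y)"
      unfolding f[OF torus_pmap[OF t y]] using x(3) Lp[OF y] by simp
    finally show "?f (pmap y) = pmap (?f y)" by simp
  qed
  moreover have inj: "inj_on ?f t"
  proof (rule inj_onI)
    fix y z assume yz: "y \<in> t" "z \<in> t" "?f y = ?f z"
    have "(\<Sum>i<d. (L i y - L i z) *s x i) = 0"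
      using yz by (simp add: f scale_left_diff_distrib sum_subtractf)
    then have "L i y - L i z = 0" if "i < d" for i
      using frames_coeff_zero[OF x(1), of "\<lambda>i. L i y - L i z" i] that by simp
    then have "(\<Sum>i<d. L i y *s e i) = (\<Sum>i<d. L i z *s e i)" by (intro sum.cong) auto
    then show "y = z" using L(3)[OF yz(1)] L(3)[OF yz(2)] by simp
  qed
  moreover have "?f \<in> extensional t" by (simp add: frame_map_def)
  ultimately show "?f \<in> embeddings t" by (simp add: embeddings_def)
  have "span ((\<lambda>i\<in>{..<d}. ?f (e i)) ` {..<d}) = ?f ` t"
    by (rule hom_on_frame(2)[OF t \<open>hom_on t ?f\<close> inj e(1,2)])
  moreover have "?f (e i) = x i" if "i < d" for i
  proof -
    have "?f (e i) = (\<Sum>j<d. L j (e i) *s x j)" by (rule f[OF eT[OF that]])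
    also have "\<dots> = (\<Sum>j<d. if j = i then x j else 0)"
      by (intro sum.cong) (use that L(2) in auto)
    finally show ?thesis using that by simp
  qed
  then have "(\<lambda>i\<in>{..<d}. ?f (e i)) ` {..<d} = x ` {..<d}" by (intro image_cong) auto
  moreover have "span (x ` {..<d}) = T"
    using x(2) by (intro frame_span_eq[OF x(1) _ torus_subspace[OF T(1)] T(2)]) auto
  ultimately show "?f ` t = T" by simp
qed

end

lemma pair_coords_fst: "f \<in> F \<Longrightarrow> (\<lambda>z. f (fst z)) \<in> pair_coords F I"
  unfolding pair_coords_def by (intro UnI1 CollectI exI[of _ f]) simp

lemma pair_coords_snd: "i \<in> I \<Longrightarrow> (\<lambda>z. snd z i) \<in> pair_coords F I"
  unfolding pair_coords_def by (intro UnI2 CollectI exI[of _ i]) simp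

text \<open>Fermat's little theorem for the prime field: integer combinations of commuting toral
  elements are toral. The lemma after it separates the integers below p, so that toral elements can
  be counted.\<close>

lemma of_nat_power_CHAR:
  assumes "prime CHAR('k::comm_semiring_1)"
  shows "(of_nat n :: 'k) ^ CHAR('k) = of_nat n"
proof (induction n)
  case 0
  then show ?case using prime_gt_0_nat[OF assms] by (simp add: power_0_left)
next
  case (Suc n)
  have "(of_nat (Suc n) :: 'k) ^ CHAR('k) = (1 + of_nat n) ^ CHAR('k)" by simp
  also have "\<dots> = 1 ^ CHAR('k) + of_nat n ^ CHAR('k)" by (rule freshmans_dream[OF assms refl])
  finally show ?case using Suc by simp
qed

lemma of_nat_inj_CHAR:
  assumes "(of_nat a :: 'k::ring_1) = of_nat b" "a < CHAR('k)" "b < CHAR('k)"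
  shows "a = b"
proof -
  have le: "b' \<le> a'" if ab: "(of_nat a' :: 'k) = of_nat b'" "b' < CHAR('k)" for a' b'
  proof (rule ccontr)
    assume n: "\<not> b' \<le> a'"
    have "(of_nat (b' - a') :: 'k) = of_nat b' - of_nat a'" using n by (intro of_nat_diff) simp
    then have "CHAR('k) dvd b' - a'" using ab(1) by (simp add: of_nat_eq_0_iff_char_dvd)
    then have "CHAR('k) \<le> b' - a'" using n by (intro dvd_imp_le) auto
    then show False using ab(2) by simp
  qed
  show ?thesis using le[OF assms(1,3)] le[OF assms(1)[symmetric] assms(2)] by simp
qed

section \<open>Density of the embeddings with image in an orbit\<close>

context restricted_lie_algebra
begin

lemma frame_span_dim: "x \<in> frames d \<Longrightarrow> dim (span (x ` {..<d})) = d"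
  by (auto simp: frames_def dim_eq_card_independent card_image)

lemma frame_sum_coeff:
  fixes d :: nat
  assumes "\<And>i. linform (L i)" "\<And>i j. i < d \<Longrightarrow> j < d \<Longrightarrow> L i (x j) = (if i = j then 1 else 0)" "j < d"
  shows "L j (\<Sum>i<d. u i *s x i) = u j"
proof -
  have "L j (\<Sum>i<d. u i *s x i) = (\<Sum>i<d. u i * L j (x i))"
    using assms(1) by (simp add: linform_simps)
  also have "\<dots> = (\<Sum>i<d. if i = j then u i else 0)"
    by (intro sum.cong) (use assms(2,3) in auto)
  finally show ?thesis using assms(3) by simp
qed

text \<open>Invertibility of the matrix \<open>a\<close> is expressed by its taking some frame to a
  frame; it is a property of the rows of \<open>a\<close> alone and so carries over to any other
  frame.\<close>

lemma frames_change:
  assumes v: "v \<in> frames d" and v': "v' \<in> frames d"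
    and w: "(\<lambda>i\<in>{..<d}. \<Sum>m<d. a (i, m) *s v m) \<in> frames d"
  shows "(\<lambda>i\<in>{..<d}. \<Sum>m<d. a (i, m) *s v' m) \<in> frames d"
    and "span ((\<lambda>i\<in>{..<d}. \<Sum>m<d. a (i, m) *s v' m) ` {..<d}) = span (v' ` {..<d})"
proof -
  let ?w' = "\<lambda>i\<in>{..<d}. \<Sum>m<d. a (i, m) *s v' m"
  have ex: "(\<Sum>i<d. u i *s (\<lambda>i\<in>{..<d}. \<Sum>m<d. a (i, m) *s z m) i) =
      (\<Sum>m<d. (\<Sum>i<d. u i * a (i, m)) *s z m)" for u z
  proof -
    have "(\<Sum>i<d. u i *s (\<lambda>i\<in>{..<d}. \<Sum>m<d. a (i, m) *s z m) i) =
        (\<Sum>i<d. \<Sum>m<d. (u i * a (i, m)) *s z m)"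
      by (simp add: scale_sum_right)
    also have "\<dots> = (\<Sum>m<d. \<Sum>i<d. (u i * a (i, m)) *s z m)" by (rule sum.swap)
    finally show ?thesis by (simp add: scale_sum_left)
  qed
  show fr: "?w' \<in> frames d"
    unfolding frames_iff
  proof (intro conjI allI impI)
    fix u i assume u: "(\<Sum>i<d. u i *s ?w' i) = 0" and i: "i < d"
    have "(\<Sum>i<d. u i * a (i, m)) = 0" if "m < d" for m
      using frames_coeff_zero[OF v', of "\<lambda>m. \<Sum>i<d. u i * a (i, m)" m] u that unfolding ex by simp
    then have "(\<Sum>i<d. u i *s (\<lambda>i\<in>{..<d}. \<Sum>m<d. a (i, m) *s v m) i) = 0" unfolding ex by simp
    from frames_coeff_zero[OF w this i] show "u i = 0" .
  qed simp
  have "?w' ` {..<d} \<subseteq> span (v' ` {..<d})"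
    by (auto intro!: span_sum span_scale frame_in_span)
  then show "span (?w' ` {..<d}) = span (v' ` {..<d})"
    by (intro frame_span_eq[OF fr]) (simp_all only: subspace_span frame_span_dim[OF v'])
qed

text \<open>The frames of a given subspace are related by base changes, so the preimage in the space
  of frames is the union, over all base changes \<open>a\<close>, of the open sets where
  \<open>q\<close> composed with \<open>a\<close> does not vanish.\<close>

lemma openin_Gr_top_nonvanishing:
  assumes q: "q \<in> polyfuns (eval_coords {..<d})"
  shows "openin (Gr_top d) {T. \<exists>w\<in>frames d. span (w ` {..<d}) = T \<and> q w \<noteq> 0}" (is "openin _ ?U")
  unfolding openin_Gr_top
proof (intro conjI)
  show "?U \<subseteq> Gr d" using span_frame_in_Gr by auto
  define A where "A a v = (\<lambda>i\<in>{..<d}. \<Sum>m<d. a (i, m) *s v m)" for a :: "nat \<times> nat \<Rightarrow> 'k" and v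
  define P where "P = {(\<lambda>v. q (A a v)) | a. \<exists>v\<in>frames d. A a v \<in> frames d}"
  have "P \<subseteq> polyfuns (eval_coords {..<d})"
  proof
    fix f assume "f \<in> P"
    then obtain a where f: "f = (\<lambda>v. q (A a v))" by (auto simp: P_def)
    show "f \<in> polyfuns (eval_coords {..<d})"
      unfolding f
    proof (rule polyfuns_subst[OF q], rule polyfuns_eval_coordsI)
      fix i assume "i \<in> {..<d}"
      then have "(\<lambda>v. A a v i) = (\<lambda>v. \<Sum>m<d. a (i, m) *s v m)" by (simp add: A_def)
      moreover have "polymap (eval_coords {..<d}) (\<lambda>v. \<Sum>m<d. a (i, m) *s v m)"
        by (intro polymap_sum polymap_scale polyfuns_const polymap_eval)
      ultimately show "polymap (eval_coords {..<d}) (\<lambda>v. A a v i)" by simp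
    qed
  qed
  moreover have "{v \<in> frames d. span (v ` {..<d}) \<in> ?U} = frames d - zero_locus (frames d) P"
  proof (intro Set.set_eqI iffI)
    fix v assume "v \<in> {v \<in> frames d. span (v ` {..<d}) \<in> ?U}"
    then obtain w where v: "v \<in> frames d" and w: "w \<in> frames d"
      "span (w ` {..<d}) = span (v ` {..<d})" "q w \<noteq> 0" by auto
    obtain L where "\<And>i. linform (L i)"
      "\<And>i j. i < d \<Longrightarrow> j < d \<Longrightarrow> L i (v j) = (if i = j then 1 else 0)"
      and L: "\<And>z. z \<in> span (v ` {..<d}) \<Longrightarrow> z = (\<Sum>i<d. L i z *s v i)"
      by (rule frame_dual[OF v]) (rule that)
    \<comment> \<open>The base change from \<open>v\<close> to \<open>w\<close>, read off in
      coordinates with respect to \<open>v\<close>.\<close>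
    let ?a = "\<lambda>(i, m). L m (w i)"
    have Av: "A ?a v = w"
    proof (rule extensionalityI)
      show "A ?a v \<in> extensional {..<d}" by (simp add: A_def)
      show "w \<in> extensional {..<d}" using w(1) by (simp add: frames_def)
      fix i assume "i \<in> {..<d}"
      then have i: "i < d" by simp
      have "w i \<in> span (v ` {..<d})" using frame_in_span[OF i, of w] w(2) by simp
      from L[OF this] show "A ?a v i = w i" using i by (simp add: A_def)
    qed
    have "(\<lambda>v. q (A ?a v)) \<in> P"
      unfolding P_def by (rule CollectI, rule exI[of _ ?a]) (intro conjI refl bexI[of _ v], simp_all only: Av w(1) v)
    moreover have "q (A ?a v) \<noteq> 0" using w(3) Av by simp
    ultimately show "v \<in> frames d - zero_locus (frames d) P" using v by (auto simp: zero_locus_def)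
  next
    fix v assume "v \<in> frames d - zero_locus (frames d) P"
    then obtain f where v: "v \<in> frames d" and f: "f \<in> P" "f v \<noteq> 0" by (auto simp: zero_locus_def)
    obtain a v0 where a: "f = (\<lambda>v. q (A a v))" "v0 \<in> frames d" "A a v0 \<in> frames d"
      using f(1) by (auto simp: P_def)
    have "A a v \<in> frames d" "span (A a v ` {..<d}) = span (v ` {..<d})"
      using frames_change[OF a(2) v, of a] a(3) by (simp_all add: A_def)
    moreover have "q (A a v) \<noteq> 0" using f(2) by (simp add: a(1))
    ultimately show "v \<in> {v \<in> frames d. span (v ` {..<d}) \<in> ?U}" using v by auto
  qed
  ultimately show "openin (zariski (frames d) (eval_coords {..<d})) {v \<in> frames d. span (v ` {..<d}) \<in> ?U}"
    unfolding openin_zariski by (intro exI[of _ P]) simp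
qed

text \<open>
  The coefficients \<open>c\<close> of toral elements with respect to a frame \<open>w\<close> of a torus satisfy
  equations that express \<open>c\<^sup>p\<close> linearly in \<open>c\<close>: compare \<open>x = \<Sum> c\<^sub>m w\<^sub>m\<close> with
  \<open>x = x\<^sup>[\<^sup>p\<^sup>] = \<Sum> c\<^sub>m\<^sup>p w\<^sub>m\<^sup>[\<^sup>p\<^sup>]\<close> and apply Cramer's rule.
\<close>

definition pmap_mat :: "(nat \<Rightarrow> 'g \<Rightarrow> 'k) \<Rightarrow> nat \<Rightarrow> (nat \<Rightarrow> 'g) \<Rightarrow> 'k mat" where
  "pmap_mat K d w = Matrix.mat d d (\<lambda>(m, j). K j (pmap (w m)))"

definition toral_coeff :: "(nat \<Rightarrow> 'g \<Rightarrow> 'k) \<Rightarrow> nat \<Rightarrow> nat \<times> nat \<Rightarrow> nat \<times> nat \<Rightarrow> (nat \<Rightarrow> 'g) \<Rightarrow> 'k" where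
  "toral_coeff K d i j w = (if fst i = fst j
     then \<Sum>k<d. K k (w (snd j)) * cofactor (pmap_mat K d w) (snd i) k else 0)"

lemma toral_coeff_relation:
  assumes K: "\<And>i. linform (K i)" and T: "torus T" and w: "\<And>m. m < d \<Longrightarrow> w m \<in> T"
    and tor: "\<And>i. i < d \<Longrightarrow> pmap (\<Sum>m<d. c (i, m) *s w m) = (\<Sum>m<d. c (i, m) *s w m)"
    and i: "i \<in> {..<d} \<times> {..<d}"
  shows "det (pmap_mat K d w) * c i ^ CHAR('k) = (\<Sum>j\<in>{..<d} \<times> {..<d}. toral_coeff K d i j w * c j)"
proof -
  obtain r n where rn: "i = (r, n)" "r < d" "n < d" using i by auto
  let ?p = "CHAR('k)" and ?M = "pmap_mat K d w"
  have M: "?M \<in> carrier_mat d d" by (simp add: pmap_mat_def)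
  have Mk: "?M $$ (m, k) = K k (pmap (w m))" if "m < d" "k < d" for m k
    using that by (simp add: pmap_mat_def)
  have "(\<Sum>m<d. c (r, m) ^ ?p *s pmap (w m)) = (\<Sum>m<d. c (r, m) *s w m)"
    using torus_pmap_sum[OF T, of "{..<d}" w "\<lambda>m. c (r, m)"] w tor[OF rn(2)] by simp
  then have "K k (\<Sum>m<d. c (r, m) ^ ?p *s pmap (w m)) = K k (\<Sum>m<d. c (r, m) *s w m)" for k by simp
  then have eq: "(\<Sum>m<d. c (r, m) ^ ?p * K k (pmap (w m))) = (\<Sum>m<d. c (r, m) * K k (w m))" for k
    by (simp add: linform_simps[OF K])
  have adj: "(\<Sum>k<d. ?M $$ (m, k) * cofactor ?M n k) = (if m = n then det ?M else 0)" if m: "m < d" for m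
  proof -
    have "(?M * adj_mat ?M) $$ (m, n) = (\<Sum>k<d. ?M $$ (m, k) * cofactor ?M n k)"
      using M m rn(3) adj_mat(1)[OF M]
      by (simp add: scalar_prod_def adj_mat_def atLeast0LessThan)
    moreover have "(?M * adj_mat ?M) $$ (m, n) = (if m = n then det ?M else 0)"
      unfolding adj_mat(2)[OF M] using m rn(3) by simp
    ultimately show ?thesis by simp
  qed
  have "det ?M * c (r, n) ^ ?p = (\<Sum>m<d. if m = n then c (r, m) ^ ?p * det ?M else 0)"
    using rn(3) by simp
  also have "\<dots> = (\<Sum>m<d. c (r, m) ^ ?p * (\<Sum>k<d. ?M $$ (m, k) * cofactor ?M n k))"
    by (intro sum.cong refl) (simp add: adj)
  also have "\<dots> = (\<Sum>m<d. \<Sum>k<d. c (r, m) ^ ?p * K k (pmap (w m)) * cofactor ?M n k)"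
    by (simp add: sum_distrib_left Mk mult.assoc)
  also have "\<dots> = (\<Sum>k<d. \<Sum>m<d. c (r, m) ^ ?p * K k (pmap (w m)) * cofactor ?M n k)"
    by (rule sum.swap)
  also have "\<dots> = (\<Sum>k<d. (\<Sum>m<d. c (r, m) * K k (w m)) * cofactor ?M n k)"
    by (simp only: sum_distrib_right[symmetric] eq)
  also have "\<dots> = (\<Sum>k<d. \<Sum>m<d. c (r, m) * K k (w m) * cofactor ?M n k)"
    by (simp only: sum_distrib_right)
  also have "\<dots> = (\<Sum>m<d. \<Sum>k<d. c (r, m) * K k (w m) * cofactor ?M n k)" by (rule sum.swap)
  also have "\<dots> = (\<Sum>m<d. toral_coeff K d i (r, m) w * c (r, m))"
    by (intro sum.cong refl) (simp add: toral_coeff_def rn sum_distrib_left sum_distrib_right mult_ac)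
  \<comment> \<open>The coefficients \<open>toral_coeff\<close> vanish between different rows: the
    equations for one toral element do not involve the others.\<close>
  also have "\<dots> = (\<Sum>r'<d. if r' = r then \<Sum>m<d. toral_coeff K d i (r', m) w * c (r', m) else 0)"
    using rn(2) by simp
  also have "\<dots> = (\<Sum>r'<d. \<Sum>m<d. toral_coeff K d i (r', m) w * c (r', m))"
    by (intro sum.cong refl) (auto simp: toral_coeff_def rn)
  also have "\<dots> = (\<Sum>j\<in>{..<d} \<times> {..<d}. toral_coeff K d i j w * c j)"
    by (simp add: sum.cartesian_product)
  finally show ?thesis by (simp add: rn)
qed

lemma polyfuns_pmap_mat:
  assumes "\<And>i. linform (K i)" "m < d" "k < d"
  shows "(\<lambda>w. pmap_mat K d w $$ (m, k)) \<in> polyfuns (eval_coords {..<d})"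
proof -
  have "polymap (eval_coords {..<d}) (\<lambda>w. pmap (w m))"
    using assms(2) by (intro polymap_pmap polymap_eval) simp
  from polymapD[OF this assms(1)] show ?thesis using assms by (simp add: pmap_mat_def)
qed

lemma polyfuns_det_pmap_mat:
  "(\<And>i. linform (K i)) \<Longrightarrow> (\<lambda>w. det (pmap_mat K d w)) \<in> polyfuns (eval_coords {..<d})"
  by (rule polyfuns_det[of _ d]) (simp_all add: polyfuns_pmap_mat, simp add: pmap_mat_def)

lemma polyfuns_toral_coeff:
  assumes K: "\<And>i. linform (K i)" and ij: "i \<in> {..<d} \<times> {..<d}" "j \<in> {..<d} \<times> {..<d}"
  shows "toral_coeff K d i j \<in> polyfuns (eval_coords {..<d})"
proof -
  have "(\<lambda>w. cofactor (pmap_mat K d w) (snd i) k) \<in> polyfuns (eval_coords {..<d})" if "k < d" for k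
    using ij that by (intro polyfuns_cofactor[of _ d] polyfuns_pmap_mat K) (auto simp: pmap_mat_def)
  moreover have "(\<lambda>w. K k (w (snd j))) \<in> polyfuns (eval_coords {..<d})" for k
    using ij by (intro polymapD[OF polymap_eval K]) auto
  ultimately show ?thesis
    unfolding toral_coeff_def by (intro polyfuns_if polyfuns_sum polyfuns_mult polyfuns_const) auto
qed

text \<open>The tuples are integer combinations of the toral frame \<open>e\<close> with
  coefficients below p, which makes \<open>p^(d * d)\<close> of them. They are recorded in
  coordinates with respect to \<open>w\<close>, whose own members need not be toral.\<close>

lemma toral_tuples:
  assumes T: "torus T" and w: "w \<in> frames d" "span (w ` {..<d}) = T"
    and e: "e \<in> frames d" "span (e ` {..<d}) = T" "\<And>i. i < d \<Longrightarrow> pmap (e i) = e i"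
  obtains V where "finite V" "CHAR('k) ^ card ({..<d} \<times> {..<d}) \<le> card V"
    "V \<subseteq> extensional ({..<d} \<times> {..<d})"
    "\<And>c i. c \<in> V \<Longrightarrow> i < d \<Longrightarrow> pmap (\<Sum>m<d. c (i, m) *s w m) = (\<Sum>m<d. c (i, m) *s w m)"
proof -
  let ?I = "{..<d} \<times> {..<d}" and ?p = "CHAR('k)"
  obtain L where L: "\<And>i. linform (L i)"
    "\<And>i j. i < d \<Longrightarrow> j < d \<Longrightarrow> L i (w j) = (if i = j then 1 else 0)"
    "\<And>z. z \<in> span (w ` {..<d}) \<Longrightarrow> z = (\<Sum>i<d. L i z *s w i)"
    by (rule frame_dual[OF w(1)]) (rule that)
  obtain E where E: "\<And>i. linform (E i)"
    "\<And>i j. i < d \<Longrightarrow> j < d \<Longrightarrow> E i (e j) = (if i = j then 1 else 0)"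
    "\<And>z. z \<in> span (e ` {..<d}) \<Longrightarrow> z = (\<Sum>i<d. E i z *s e i)"
    by (rule frame_dual[OF e(1)]) (rule that)
  define x where "x a i = (\<Sum>j<d. of_nat (a (i, j)) *s e j)" for a :: "nat \<times> nat \<Rightarrow> nat" and i
  have eT: "e i \<in> T" if "i < d" for i using frame_in_span[OF that, of e] e(2) by simp
  have xT: "x a i \<in> T" for a i unfolding x_def by (rule torus_sum[OF T]) (use eT in auto)
  have xtor: "pmap (x a i) = x a i" for a i
  proof -
    have "pmap (x a i) = (\<Sum>j<d. of_nat (a (i, j)) ^ ?p *s pmap (e j))"
      unfolding x_def by (rule torus_pmap_sum[OF T]) (use eT in auto)
    then show ?thesis using e(3) by (simp add: x_def of_nat_power_CHAR[OF prime_CHAR])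
  qed
  define c where "c a = (\<lambda>(i, m)\<in>?I. L m (x a i))" for a
  have cx: "(\<Sum>m<d. c a (i, m) *s w m) = x a i" if "i < d" for a i
    using L(3)[of "x a i"] xT that by (simp add: c_def w(2))
  let ?A = "?I \<rightarrow>\<^sub>E {..<?p}"
  have "inj_on c ?A"
  proof (rule inj_onI, rule extensionalityI)
    fix a b assume ab: "a \<in> ?A" "b \<in> ?A" "c a = c b"
    show "a \<in> extensional ?I" "b \<in> extensional ?I" using ab by (auto simp: PiE_def)
    fix k assume k: "k \<in> ?I"
    obtain i j where ij: "k = (i, j)" "i < d" "j < d" using k by auto
    have "x a i = x b i" using cx[OF ij(2), of a] cx[OF ij(2), of b] ab(3) by simp
    moreover have "E j (x b i) = of_nat (b (i, j))" for b
      unfolding x_def by (rule frame_sum_coeff[of E d e j "\<lambda>j. of_nat (b (i, j))", OF E(1,2) ij(3)])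
    ultimately have "(of_nat (a (i, j)) :: 'k) = of_nat (b (i, j))" by metis
    moreover have "a k < ?p" "b k < ?p" using ab k by auto
    ultimately show "a k = b k" unfolding ij(1) by (rule of_nat_inj_CHAR)
  qed
  then have "card (c ` ?A) = ?p ^ card ?I" by (simp add: card_image card_PiE)
  moreover have "finite (c ` ?A)" by (intro finite_imageI finite_PiE) auto
  moreover have "c ` ?A \<subseteq> extensional ?I" by (auto simp: c_def)
  moreover have "pmap (\<Sum>m<d. v (i, m) *s w m) = (\<Sum>m<d. v (i, m) *s w m)" if "v \<in> c ` ?A" "i < d" for v i
    using that cx xtor by auto
  ultimately show thesis by (intro that[of "c ` ?A"]) auto
qed

text \<open>On toral tuples over a frame \<open>w\<close>, the function \<open>F\<close> has a
  normal form in the coefficients \<open>c\<close> with factors \<open>h \<alpha> w\<close>.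
  Nonvanishing at \<open>w0\<close> leaves some \<open>h \<alpha> w0\<close> nonzero, whereas
  vanishing on all toral tuples of a torus forces, by interpolation, \<open>h \<alpha> w = 0\<close>
  wherever \<open>\<delta> w\<close> is invertible.\<close>

lemma toral_function_leading_coefficient:
  assumes w0: "w0 \<in> frames d" "torus (span (w0 ` {..<d}))" "\<And>i. i < d \<Longrightarrow> pmap (w0 i) = w0 i"
    and F: "F \<in> polyfuns (eval_coords {..<d})" "F w0 \<noteq> 0"
  obtains q where "q \<in> polyfuns (eval_coords {..<d})" "q w0 \<noteq> 0"
    "\<And>w T e. w \<in> frames d \<Longrightarrow> torus T \<Longrightarrow> span (w ` {..<d}) = T \<Longrightarrow>
      e \<in> frames d \<Longrightarrow> span (e ` {..<d}) = T \<Longrightarrow> \<forall>i<d. pmap (e i) = e i \<Longrightarrow>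
      \<forall>x. (\<forall>i<d. x i \<in> T \<and> pmap (x i) = x i) \<longrightarrow> F x = 0 \<Longrightarrow> q w = 0"
proof -
  let ?R = "eval_coords {..<d} :: ((nat \<Rightarrow> 'g) \<Rightarrow> 'k) set" and ?I = "{..<d} \<times> {..<d}" and ?p = "CHAR('k)"
  obtain K where K: "\<And>i. linform (K i)"
    "\<And>i j. i < d \<Longrightarrow> j < d \<Longrightarrow> K i (w0 j) = (if i = j then 1 else 0)"
    "\<And>z. z \<in> span (w0 ` {..<d}) \<Longrightarrow> z = (\<Sum>i<d. K i z *s w0 i)"
    by (rule frame_dual[OF w0(1)]) (rule that)
  \<comment> \<open>The forms \<open>K\<close> stay those dual to \<open>w0\<close> for every
    \<open>w\<close>, which keeps \<open>\<delta>\<close> polynomial. Its value at \<open>w0\<close>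
    is 1 because \<open>w0\<close> is toral.\<close>
  define \<delta> where "\<delta> w = det (pmap_mat K d w)" for w
  have \<delta>: "\<delta> \<in> polyfuns ?R" unfolding \<delta>_def by (rule polyfuns_det_pmap_mat[OF K(1)])
  define y where "y z i = (\<Sum>m<d. snd z (i, m) *s fst z m)" for z :: "(nat \<Rightarrow> 'g) \<times> (nat \<times> nat \<Rightarrow> 'k)" and i :: nat
  define M where "M = {z. fst z \<in> frames d \<and> torus (span (fst z ` {..<d})) \<and>
    (\<forall>i<d. pmap (y z i) = y z i)}"
  \<comment> \<open>Extended by zero outside the index set, since the reduction asks for polynomial
    coefficients at all index pairs.\<close>
  define B where "B i j = (if i \<in> ?I \<and> j \<in> ?I then toral_coeff K d i j else (\<lambda>_. 0))" for i j
  have B: "B i j \<in> polyfuns ?R" for i j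
    using polyfuns_toral_coeff[OF K(1)] by (simp add: B_def polyfuns_const)
  have rel: "\<delta> w * c i ^ ?p = (\<Sum>j\<in>?I. B i j w * c j)" if "(w, c) \<in> M" "i \<in> ?I" for w c i
  proof -
    have "\<delta> w * c i ^ ?p = (\<Sum>j\<in>?I. toral_coeff K d i j w * c j)"
      unfolding \<delta>_def
      by (rule toral_coeff_relation[OF K(1), of "span (w ` {..<d})"])
         (use that frame_in_span[of _ d w] in \<open>auto simp: M_def y_def\<close>)
    also have "\<dots> = (\<Sum>j\<in>?I. B i j w * c j)" by (intro sum.cong refl) (use that(2) in \<open>simp add: B_def\<close>)
    finally show ?thesis .
  qed
  have H: "(\<lambda>z. F (y z)) \<in> polyfuns (pair_coords ?R ?I)"
  proof (rule polyfuns_subst[OF F(1)], rule polyfuns_eval_coordsI)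
    fix i assume i: "i \<in> {..<d}"
    have "(\<lambda>z. snd z (i, m)) \<in> polyfuns (pair_coords ?R ?I)" if "m < d" for m
      using i that by (intro polyfuns_coord pair_coords_snd) simp
    moreover have "polymap (pair_coords ?R ?I) (\<lambda>z. fst z m)" if "m < d" for m
      unfolding polymap_def
    proof (intro allI impI polyfuns_coord)
      fix l assume "linform l"
      then have "(\<lambda>w. l (w m)) \<in> ?R" using that unfolding eval_coords_def by blast
      then show "(\<lambda>z. l (fst z m)) \<in> pair_coords ?R ?I" by (rule pair_coords_fst)
    qed
    ultimately show "polymap (pair_coords ?R ?I) (\<lambda>z. y z i)"
      unfolding y_def by (intro polymap_sum polymap_scale) auto
  qed
  have fin: "finite ?I" by simp
  have "\<exists>N h. (\<forall>\<alpha>. h \<alpha> \<in> polyfuns ?R) \<and> (\<forall>w c. (w, c) \<in> M \<longrightarrow>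
      \<delta> w ^ N * F (y (w, c)) = (\<Sum>\<alpha>\<in>?I \<rightarrow>\<^sub>E {..<?p}. h \<alpha> w * monom_fun ?I \<alpha> c))"
    by (rule additive_normal_form[OF fin CHAR_ge_2 \<delta> B rel H])
  then obtain N h where Nh: "(\<forall>\<alpha>. h \<alpha> \<in> polyfuns ?R) \<and> (\<forall>w c. (w, c) \<in> M \<longrightarrow>
      \<delta> w ^ N * F (y (w, c)) = (\<Sum>\<alpha>\<in>?I \<rightarrow>\<^sub>E {..<?p}. h \<alpha> w * monom_fun ?I \<alpha> c))"
    by (elim exE)
  have h: "h \<alpha> \<in> polyfuns ?R" for \<alpha> using Nh by (elim conjE) (erule allE)
  have NF: "\<delta> w ^ N * F (y (w, c)) = (\<Sum>\<alpha>\<in>?I \<rightarrow>\<^sub>E {..<?p}. h \<alpha> w * monom_fun ?I \<alpha> c)"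
    if "(w, c) \<in> M" for w c
    by (rule mp[OF spec[OF spec[OF conjunct2[OF Nh]]] that])
  have mat1: "pmap_mat K d w0 = 1\<^sub>m d"
    using w0(3) K(2) by (intro eq_matI) (auto simp: pmap_mat_def)
  then have \<delta>0: "\<delta> w0 = 1" by (simp add: \<delta>_def)
  \<comment> \<open>The identity matrix: the tuple it describes over \<open>w0\<close> is
    \<open>w0\<close> itself.\<close>
  define c0 :: "nat \<times> nat \<Rightarrow> 'k" where "c0 = (\<lambda>(i, m). if i = m then 1 else 0)"
  have y0: "y (w0, c0) i = w0 i" if "i < d" for i
  proof -
    have "y (w0, c0) i = (\<Sum>m<d. if m = i then w0 m else 0)"
      unfolding y_def c0_def by (intro sum.cong) auto
    then show ?thesis using that by simp
  qed
  have "(w0, c0) \<in> M" unfolding M_def using w0 y0 by simp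
  from NF[OF this] have "F (y (w0, c0)) = (\<Sum>\<alpha>\<in>?I \<rightarrow>\<^sub>E {..<?p}. h \<alpha> w0 * monom_fun ?I \<alpha> (c0))"
    by (simp add: \<delta>0)
  moreover have "F (y (w0, c0)) = F w0" by (rule polyfuns_eval_coords_cong[OF F(1)]) (simp add: y0)
  ultimately have "(\<Sum>\<alpha>\<in>?I \<rightarrow>\<^sub>E {..<?p}. h \<alpha> w0 * monom_fun ?I \<alpha> (c0)) \<noteq> 0" using F(2) by simp
  then obtain \<alpha> where \<alpha>: "\<alpha> \<in> ?I \<rightarrow>\<^sub>E {..<?p}" "h \<alpha> w0 \<noteq> 0"
    using sum.neutral[of "?I \<rightarrow>\<^sub>E {..<?p}" "\<lambda>\<alpha>. h \<alpha> w0 * monom_fun ?I \<alpha> (c0)"] by auto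
  show thesis
  \<comment> \<open>The factor \<open>\<delta>\<close> disposes of the frames at which the equations
    cannot be solved for the p-th powers.\<close>
  proof (rule that[of "\<lambda>w. \<delta> w * h \<alpha> w"])
    show "(\<lambda>w. \<delta> w * h \<alpha> w) \<in> polyfuns ?R" using \<delta> h by (rule polyfuns_mult)
    show "\<delta> w0 * h \<alpha> w0 \<noteq> 0" using \<alpha>(2) \<delta>0 by simp
    fix w T e
    assume w: "w \<in> frames d" and T: "torus T" "span (w ` {..<d}) = T"
      and e: "e \<in> frames d" "span (e ` {..<d}) = T" "\<forall>i<d. pmap (e i) = e i"
      and F0: "\<forall>x. (\<forall>i<d. x i \<in> T \<and> pmap (x i) = x i) \<longrightarrow> F x = 0"
    show "\<delta> w * h \<alpha> w = 0"
    proof (cases "\<delta> w = 0")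
      case False
      obtain V where V: "finite V" "?p ^ card ?I \<le> card V" "V \<subseteq> extensional ?I"
        "\<And>c i. c \<in> V \<Longrightarrow> i < d \<Longrightarrow> pmap (\<Sum>m<d. c (i, m) *s w m) = (\<Sum>m<d. c (i, m) *s w m)"
        by (rule toral_tuples[OF T(1) w T(2) e(1,2)]) (simp add: e(3), rule that)
      have VM: "(w, c) \<in> M" if "c \<in> V" for c
        unfolding M_def using w T V(4)[OF that] by (simp add: y_def)
      have wT: "w m \<in> T" if "m < d" for m using frame_in_span[OF that, of w] T(2) by simp
      have "h \<alpha> w = 0"
      proof (rule additive_monomials_independent[OF fin CHAR_ge_2 V(1,2) _ _ _ \<alpha>(1),
            where B = "\<lambda>i j. B i j w / \<delta> w" and u = "\<lambda>\<alpha>. h \<alpha> w"])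
        fix c c' assume "c \<in> V" "c' \<in> V" "\<And>i. i \<in> ?I \<Longrightarrow> c i = c' i"
        then show "c = c'" using V(3) by (intro extensionalityI[of c ?I c']) auto
      next
        fix c i assume "c \<in> V" "i \<in> ?I"
        from rel[OF VM[OF this(1)] this(2)] False
        show "c i ^ ?p = (\<Sum>j\<in>?I. B i j w / \<delta> w * c j)"
          by (simp add: sum_divide_distrib[symmetric] nonzero_eq_divide_eq mult.commute)
      next
        fix c assume c: "c \<in> V"
        have "F (y (w, c)) = 0"
        proof (rule F0[rule_format], intro conjI)
          show "y (w, c) i \<in> T" for i
            unfolding y_def by (rule torus_sum[OF T(1)]) (use wT in auto)
          show "pmap (y (w, c) i) = y (w, c) i" if "i < d" for i
            using V(4)[OF c that] by (simp add: y_def)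
        qed
        with NF[OF VM[OF c]]
        show "(\<Sum>\<alpha>\<in>?I \<rightarrow>\<^sub>E {..<?p}. h \<alpha> w * monom_fun ?I \<alpha> c) = 0" by simp
      qed
      then show ?thesis by simp
    qed simp
  qed
qed

section \<open>Lifting density from tori to embeddings\<close>

definition orbit_embeddings :: "'g set \<Rightarrow> ('g \<Rightarrow> 'g) set" where
  "orbit_embeddings t = {\<phi> \<in> embeddings t. \<phi> ` t \<in> (\<lambda>g. g ` t) ` G}"

lemma G_hom_on: "g \<in> G \<Longrightarrow> hom_on A g"
  using G_subset by (auto simp: Autp_def hom_on_def)

lemma G_bij: "g \<in> G \<Longrightarrow> bij g"
  using G_subset Autp_UNIV(2) by blast

end

context restricted_lie_algebra_alg_closed
begin

lemma vanishing_on_orbit_embeddings: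
  assumes gen: "generic_torus t" and \<phi>0: "\<phi>0 \<in> embeddings t"
    and f: "f \<in> polyfuns (eval_coords t)" "\<And>\<phi>. \<phi> \<in> orbit_embeddings t \<Longrightarrow> f \<phi> = 0"
  shows "f \<phi>0 = 0"
proof (rule ccontr)
  assume f0: "f \<phi>0 \<noteq> 0"
  have t: "torus t" "t \<in> Tor" and dt: "dim t = \<mu>" using gen by (auto simp: generic_torus_def Tor_def)
  define d where "d = dim t"
  obtain e where e: "e \<in> frames d" "span (e ` {..<d}) = t" "\<And>i. i < d \<Longrightarrow> pmap (e i) = e i"
    by (rule torus_toral_basis[OF t(1), folded d_def]) (rule that)
  obtain L where L: "\<And>i. linform (L i)"
    "\<And>i j. i < d \<Longrightarrow> j < d \<Longrightarrow> L i (e j) = (if i = j then 1 else 0)"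
    "\<And>v. v \<in> span (e ` {..<d}) \<Longrightarrow> v = (\<Sum>i<d. L i v *s e i)"
    by (rule frame_dual[OF e(1)]) (rule that)
  note L = L(1,2) L(3)[unfolded e(2)]
  have eT: "e i \<in> t" if "i < d" for i using frame_in_span[OF that, of e] e(2) by simp
  have \<phi>: "\<phi>0 \<in> extensional t" "hom_on t \<phi>0" "inj_on \<phi>0 t" using \<phi>0 by (auto simp: embeddings_def)
  define w0 where "w0 = (\<lambda>i\<in>{..<d}. \<phi>0 (e i))"
  note w0 = hom_on_frame[OF t(1) \<phi>(2,3) e(1,2), folded w0_def]
  have T0: "torus (\<phi>0 ` t)" by (rule hom_on_image_torus[OF t(1) \<phi>(2)])
  have T0': "torus (span (w0 ` {..<d}))" using T0 by (simp only: w0(2))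
  have w0tor: "pmap (w0 i) = w0 i" if "i < d" for i
  proof -
    have "\<phi>0 (pmap (e i)) = pmap (\<phi>0 (e i))" using \<phi>(2) eT[OF that] by (simp add: hom_on_def)
    then show ?thesis using that e(3) by (simp add: w0_def)
  qed
  obtain K where K: "\<And>i. linform (K i)"
    "\<And>i j. i < d \<Longrightarrow> j < d \<Longrightarrow> K i (w0 j) = (if i = j then 1 else 0)"
    "\<And>z. z \<in> span (w0 ` {..<d}) \<Longrightarrow> z = (\<Sum>i<d. K i z *s w0 i)"
    by (rule frame_dual[OF w0(1)]) (rule that)
  define A where "A x = Matrix.mat d d (\<lambda>(i, j). K i (x j))" for x :: "nat \<Rightarrow> 'g"
  \<comment> \<open>The determinant is 1 at \<open>w0\<close> and vanishes on dependent tuples, for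
    which \<open>frame_map\<close> is not an embedding and nothing is known about
    \<open>f\<close>.\<close>
  define F where "F x = f (frame_map t L d x) * det (A x)" for x
  let ?R = "eval_coords {..<d} :: ((nat \<Rightarrow> 'g) \<Rightarrow> 'k) set"
  have F: "F \<in> polyfuns ?R"
    unfolding F_def
  proof (rule polyfuns_mult)
    show "(\<lambda>x. f (frame_map t L d x)) \<in> polyfuns ?R"
    proof (rule polyfuns_subst[where a = "frame_map t L d", OF f(1)])
      fix c :: "('g \<Rightarrow> 'g) \<Rightarrow> 'k" assume c: "c \<in> eval_coords t"
      show "(\<lambda>x. c (frame_map t L d x)) \<in> polyfuns ?R"
    proof (rule polyfuns_eval_coordsI[OF c])
      fix z assume "z \<in> t"
      then have "(\<lambda>x. frame_map t L d x z) = (\<lambda>x. \<Sum>i<d. L i z *s x i)" by (simp add: frame_map_def)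
      moreover have "polymap ?R (\<lambda>x. \<Sum>i<d. L i z *s x i)"
        by (intro polymap_sum polymap_scale polyfuns_const polymap_eval)
      ultimately show "polymap ?R (\<lambda>x. frame_map t L d x z)" by simp
    qed
    qed
    show "(\<lambda>x. det (A x)) \<in> polyfuns ?R"
    proof (rule polyfuns_det)
      show "A x \<in> carrier_mat d d" for x by (simp add: A_def)
      show "(\<lambda>x. A x $$ (i, j)) \<in> polyfuns ?R" if "i < d" "j < d" for i j
        using that polymapD[OF polymap_eval[of j "{..<d}"] K(1)] by (simp add: A_def)
    qed
  qed
  have "A w0 = 1\<^sub>m d" using K(2) by (intro eq_matI) (auto simp: A_def)
  moreover have "frame_map t L d w0 = \<phi>0"
    by (rule frame_map_restrict[OF t(1) e(1,2) L(3) \<phi>(1,2)]) (simp_all add: w0_def)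
  ultimately have "F w0 \<noteq> 0" using f0 by (simp add: F_def)
  obtain q where q: "q \<in> polyfuns ?R" "q w0 \<noteq> 0"
    "\<And>w T e. w \<in> frames d \<Longrightarrow> torus T \<Longrightarrow> span (w ` {..<d}) = T \<Longrightarrow>
      e \<in> frames d \<Longrightarrow> span (e ` {..<d}) = T \<Longrightarrow> \<forall>i<d. pmap (e i) = e i \<Longrightarrow>
      \<forall>x. (\<forall>i<d. x i \<in> T \<and> pmap (x i) = x i) \<longrightarrow> F x = 0 \<Longrightarrow> q w = 0"
    by (rule toral_function_leading_coefficient[OF w0(1) T0' _ F \<open>F w0 \<noteq> 0\<close>])
       (rule w0tor, assumption, rule that)
  have q0: "q w = 0" if w: "w \<in> frames d" and g: "g \<in> G" "span (w ` {..<d}) = g ` t" for w g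
  proof -
    have ginj: "inj_on g t" using G_bij[OF g(1)] by (meson bij_is_inj inj_on_subset subset_UNIV)
    have gt: "torus (g ` t)" by (rule hom_on_image_torus[OF t(1) G_hom_on[OF g(1)]])
    note ge = hom_on_frame[OF t(1) G_hom_on[OF g(1)] ginj e(1,2)]
    have etor: "\<forall>i<d. pmap ((\<lambda>i\<in>{..<d}. g (e i)) i) = (\<lambda>i\<in>{..<d}. g (e i)) i"
    proof (intro allI impI)
      fix i assume i: "i < d"
      have "g (pmap (e i)) = pmap (g (e i))" using G_hom_on[OF g(1), of UNIV] by (simp add: hom_on_def)
      then show "pmap ((\<lambda>i\<in>{..<d}. g (e i)) i) = (\<lambda>i\<in>{..<d}. g (e i)) i"
        using i e(3)[OF i] by simp
    qed
    have "\<forall>x. (\<forall>i<d. x i \<in> g ` t \<and> pmap (x i) = x i) \<longrightarrow> F x = 0"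
    proof (intro allI impI)
      fix x assume x0: "\<forall>i<d. x i \<in> g ` t \<and> pmap (x i) = x i"
      have x: "x i \<in> g ` t" "pmap (x i) = x i" if "i < d" for i using x0 that by simp_all
      let ?x = "restrict x {..<d}"
      have Fx: "F x = F ?x" by (rule polyfuns_eval_coords_cong[OF F]) simp
      show "F x = 0"
      proof (cases "?x \<in> frames d")
        case True
        have x': "?x i \<in> g ` t" "pmap (?x i) = ?x i" if "i < d" for i using x that by simp_all
        have fm: "frame_map t L d ?x \<in> embeddings t" "frame_map t L d ?x ` t = g ` t"
          by (rule frame_map_embedding[OF t(1) e L gt ge(3) True x']; assumption)+
        have "frame_map t L d ?x ` t \<in> (\<lambda>g. g ` t) ` G" 
          unfolding fm(2) using imageI[OF g(1), of "\<lambda>g. g ` t"] .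
        with fm(1) have "frame_map t L d ?x \<in> orbit_embeddings t"
          unfolding orbit_embeddings_def by (intro CollectI conjI)
        then show ?thesis unfolding Fx by (simp add: F_def f(2))
      next
        case False
        then have "\<not> (\<forall>u. (\<Sum>i<d. u i *s ?x i) = 0 \<longrightarrow> (\<forall>i<d. u i = 0))"
          unfolding frames_iff by simp
        then obtain u k where u: "(\<Sum>i<d. u i *s ?x i) = 0" "k < d" "u k \<noteq> 0"
          by (simp only: not_all not_imp) (elim exE conjE)
        have A: "A ?x \<in> carrier_mat d d" by (simp add: A_def)
        have "A ?x *\<^sub>v Matrix.vec d u = 0\<^sub>v d"
        proof (rule eq_vecI)
          fix i assume "i < dim_vec (0\<^sub>v d :: 'k Matrix.vec)"
          then have i: "i < d" by simp
          have "K i (\<Sum>j<d. u j *s ?x j) = (\<Sum>j<d. u j * K i (?x j))"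
            by (simp only: linform_simps[OF K(1)])
          then have "(\<Sum>j<d. u j * K i (?x j)) = 0" using u(1) by (simp add: linform_zero[OF K(1)])
          then show "vec_index (A ?x *\<^sub>v Matrix.vec d u) i = vec_index (0\<^sub>v d) i"
            using i by (simp add: A_def scalar_prod_def atLeast0LessThan mult.commute)
        qed (simp add: A_def)
        moreover have "Matrix.vec d u \<noteq> 0\<^sub>v d" 
        proof
          assume "Matrix.vec d u = 0\<^sub>v d"
          then have "vec_index (Matrix.vec d u) k = vec_index (0\<^sub>v d) k" by simp
          then show False using u(2,3) by simp
        qed
        ultimately have "det (A ?x) = 0"
          unfolding det_0_iff_vec_prod_zero[OF A] by (intro exI[of _ "Matrix.vec d u"]) simp
        then show ?thesis unfolding Fx by (simp add: F_def)
      qed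
    qed
    with etor show ?thesis by (intro q(3)[OF w gt g(2) ge(1,2)])
  qed
  let ?U = "{T. \<exists>w\<in>frames d. span (w ` {..<d}) = T \<and> q w \<noteq> 0}"
  have d\<mu>: "d = \<mu>" using dt by (simp add: d_def)
  have "openin (Gr_top \<mu>) ?U" using openin_Gr_top_nonvanishing[OF q(1)] by (simp only: d\<mu>)
  then have U: "openin (subtopology (Gr_top \<mu>) Tor) (?U \<inter> Tor)" by (rule openin_subtopology_Int)
  have "\<phi>0 ` t \<in> Tor" using T0 w0(3) d\<mu> by (simp add: Tor_def)
  then have clo: "\<phi>0 ` t \<in> subtopology (Gr_top \<mu>) Tor closure_of ((\<lambda>g. g ` t) ` G)"
    using gen by (simp add: generic_torus_def)
  have inU: "\<phi>0 ` t \<in> ?U \<inter> Tor" using w0(1,2) q(2) \<open>\<phi>0 ` t \<in> Tor\<close> by auto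
  from conjunct2[OF clo[unfolded in_closure_of]] inU U
  have "\<exists>T\<in>(\<lambda>g. g ` t) ` G. T \<in> ?U \<inter> Tor" by (elim allE[of _ "?U \<inter> Tor"]) simp
  then obtain g w where "g \<in> G" "w \<in> frames d" "span (w ` {..<d}) = g ` t" "q w \<noteq> 0"
    by auto
  with q0 show False by simp
qed

end

section \<open>The identity component\<close>

context restricted_lie_algebra
begin

text \<open>The Boolean index tags two matrices, \<open>True\<close> for an automorphism and
  \<open>False\<close> for its candidate inverse, so that both form one point of an affine
  space.\<close>

definition matrix_coords :: "((bool \<times> 'g \<times> 'g \<Rightarrow> 'k) \<Rightarrow> 'k) set" where
  "matrix_coords = {(\<lambda>v. v i) | i. i \<in> UNIV \<times> Basis \<times> Basis}"

definition lin_of :: "(bool \<times> 'g \<times> 'g \<Rightarrow> 'k) \<Rightarrow> bool \<Rightarrow> 'g \<Rightarrow> 'g" where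
  "lin_of v s x = (\<Sum>b\<in>Basis. \<Sum>c\<in>Basis. (v (s, b, c) * representation Basis x b) *s c)"

definition matrix_of :: "('g \<Rightarrow> 'g) \<Rightarrow> ('g \<Rightarrow> 'g) \<Rightarrow> bool \<times> 'g \<times> 'g \<Rightarrow> 'k" where
  "matrix_of f f' = (\<lambda>(s, b, c). representation Basis ((if s then f else f') b) c)"

lemma finite_matrix_coords: "finite matrix_coords"
proof -
  have "matrix_coords = (\<lambda>i v. v i) ` (UNIV \<times> Basis \<times> Basis)" unfolding matrix_coords_def by auto
  moreover have "finite (UNIV \<times> Basis \<times> Basis :: (bool \<times> 'g \<times> 'g) set)" using finite_Basis by simp
  ultimately show ?thesis by (simp only: finite_imageI)
qed

lemma lin_of_matrix_of:
  assumes "Vector_Spaces.linear scale scale f" "Vector_Spaces.linear scale scale f'"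
  shows "lin_of (matrix_of f f') s = (if s then f else f')"
proof
  fix x
  let ?f = "if s then f else f'"
  have f: "?f (u + v) = ?f u + ?f v" "?f (c *s u) = c *s ?f u" for u v c
    using assms by (simp_all add: Vector_Spaces.linear_iff)
  have sum: "?f (\<Sum>b\<in>A. u b) = (\<Sum>b\<in>A. ?f (u b))" for A :: "'g set" and u
  proof (induction A rule: infinite_finite_induct)
    case (insert a A)
    then show ?case using f(1)[of "u a" "\<Sum>b\<in>A. u b"] by simp
  qed (use f(2)[of 0 0] in simp_all)
  have "lin_of (matrix_of f f') s x =
      (\<Sum>b\<in>Basis. representation Basis x b *s (\<Sum>c\<in>Basis. representation Basis (?f b) c *s c))"
    by (simp add: lin_of_def matrix_of_def scale_sum_right mult.commute)
  also have "\<dots> = (\<Sum>b\<in>Basis. ?f (representation Basis x b *s b))"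
    by (simp only: Basis_expansion f(2))
  also have "\<dots> = ?f (\<Sum>b\<in>Basis. representation Basis x b *s b)" by (simp only: sum)
  finally show "lin_of (matrix_of f f') s x = ?f x" by (simp only: Basis_expansion)
qed

lemma polymap_lin_of: "polymap matrix_coords u \<Longrightarrow> polymap matrix_coords (\<lambda>v. lin_of v s (u v))"
  unfolding lin_of_def
  by (intro polymap_sum polymap_scale polyfuns_mult polymap_const polymap_coord polyfuns_coord)
     (auto simp: matrix_coords_def)

lemma polyfuns_lin_of:
  assumes "f \<in> polyfuns (eval_coords UNIV)"
  shows "(\<lambda>v. f (lin_of v s)) \<in> polyfuns matrix_coords"
proof (rule polyfuns_subst[where a = "\<lambda>v. lin_of v s", OF assms])
  fix c :: "('g \<Rightarrow> 'g) \<Rightarrow> 'k" assume c: "c \<in> eval_coords UNIV"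
  show "(\<lambda>v. c (lin_of v s)) \<in> polyfuns matrix_coords"
    by (rule polyfuns_eval_coordsI[OF c]) (intro polymap_lin_of polymap_const)
qed

lemma noetherian_Autp: "noetherian_locus (Autp UNIV) (eval_coords UNIV)"
proof (rule noetherian_locus_image)
  show "noetherian_locus UNIV matrix_coords"
    by (rule noetherian_locus_finite[OF finite_matrix_coords])
  show "Autp UNIV \<subseteq> (\<lambda>v. lin_of v True) ` UNIV"
  proof
    fix f assume "f \<in> Autp UNIV"
    then have eq: "lin_of (matrix_of f f) True = f" using lin_of_matrix_of Autp_UNIV(3) by simp
    show "f \<in> (\<lambda>v. lin_of v True) ` UNIV"
      using rangeI[of "\<lambda>v. lin_of v True" "matrix_of f f"] unfolding eq .
  qed
  show "(\<lambda>v. c (lin_of v True)) \<in> polyfuns matrix_coords" if "c \<in> eval_coords UNIV" for c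
    by (rule polyfuns_lin_of[OF polyfuns_coord[OF that]])
qed

lemma continuous_Aut_left_mult:
  assumes a: "a \<in> Autp UNIV"
  shows "continuous_map Aut_top Aut_top (\<lambda>f. a \<circ> f)"
  unfolding Aut_top_def
proof (rule continuous_map_zariski)
  show "(\<lambda>f. a \<circ> f) \<in> Autp UNIV \<rightarrow> Autp UNIV" using Autp_UNIV(4)[OF a] by blast
  fix c :: "('g \<Rightarrow> 'g) \<Rightarrow> 'k" assume c: "c \<in> eval_coords UNIV"
  have "(\<lambda>f. c (a \<circ> f)) \<in> polyfuns (eval_coords UNIV)"
  proof (rule polyfuns_eval_coordsI[OF c])
    show "polymap (eval_coords UNIV) (\<lambda>f. (a \<circ> f) i)" for i
      unfolding o_apply by (intro polymap_linear[OF Autp_UNIV(3)[OF a]] polymap_eval) simp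
  qed
  then show "c \<circ> (\<lambda>f. a \<circ> f) \<in> polyfuns (eval_coords UNIV)" by (simp add: o_def)
qed

lemma topspace_Aut_top [simp]: "topspace Aut_top = Autp UNIV"
  by (simp add: Aut_top_def)

text \<open>The left translation by \<open>y \<circ> inv_into UNIV x\<close> takes \<open>x\<close>
  to \<open>y\<close> and is polynomial with polynomial inverse, so the automorphism group is
  homogeneous; it is noetherian because automorphisms are given by matrix entries.\<close>

lemma irreducible_G: "irreduciblein Aut_top G"
proof -
  obtain \<A> where A: "finite \<A>" "\<forall>A\<in>\<A>. closedin Aut_top A \<and> irreduciblein Aut_top A" "\<Union>\<A> = Autp UNIV"
    using zariski_noetherian_finite_irreducible_cover[OF noetherian_Autp]
    unfolding Aut_top_def by (elim exE conjE)
  show ?thesis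
    unfolding G_def
  proof (rule homogeneous_connected_component_irreducible[OF A(1)])
    show "id \<in> topspace Aut_top" by (simp add: Autp_UNIV(1))
    fix x y assume "x \<in> topspace Aut_top" "y \<in> topspace Aut_top"
    then have xy: "x \<in> Autp UNIV" "y \<in> Autp UNIV" by simp_all
    let ?a = "y \<circ> inv_into UNIV x" and ?b = "x \<circ> inv_into UNIV y"
    have ab: "?a \<in> Autp UNIV" "?b \<in> Autp UNIV" using xy Autp_UNIV(4,5) by blast+
    have ba: "?b \<circ> (?a \<circ> z) = z" for z
      using Autp_UNIV(2)[OF xy(1)] Autp_UNIV(2)[OF xy(2)]
      by (simp add: fun_eq_iff bij_is_inj bij_is_surj surj_f_inv_f)
    have ax: "?a \<circ> x = y"
      using Autp_UNIV(2)[OF xy(1)] by (simp add: fun_eq_iff bij_is_inj)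
    show "\<exists>f g. continuous_map Aut_top Aut_top f \<and> continuous_map Aut_top Aut_top g \<and>
        (\<forall>z\<in>topspace Aut_top. g (f z) = z) \<and> f x = y"
      by (rule exI[of _ "\<lambda>f. ?a \<circ> f"], rule exI[of _ "\<lambda>f. ?b \<circ> f"], intro conjI ballI ba ax
          continuous_Aut_left_mult ab)
  qed (use A in auto)
qed


section \<open>Orbits of embeddings\<close>

definition G_act :: "'g set \<Rightarrow> ('g \<Rightarrow> 'g) \<Rightarrow> ('g \<Rightarrow> 'g) \<Rightarrow> ('g \<Rightarrow> 'g)" where
  "G_act t g \<phi> = (\<lambda>x\<in>t. g (\<phi> x))"

definition G_orbit :: "'g set \<Rightarrow> ('g \<Rightarrow> 'g) \<Rightarrow> ('g \<Rightarrow> 'g) set" where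
  "G_orbit t \<phi> = (\<lambda>g. G_act t g \<phi>) ` G"

lemma topspace_embeddings_top [simp]: "topspace (embeddings_top t) = embeddings t"
  by (simp add: embeddings_top_def)

lemma G_act_embedding:
  assumes t: "p_subalgebra t" and g: "g \<in> Autp UNIV" and \<phi>: "\<phi> \<in> embeddings t"
  shows "G_act t g \<phi> \<in> embeddings t"
proof -
  note t = t[unfolded p_subalgebra_def]
  have g': "hom_on UNIV g" "inj g" using g Autp_UNIV(2)[OF g] by (auto simp: Autp_def bij_is_inj)
  have \<phi>': "hom_on t \<phi>" "inj_on \<phi> t" using \<phi> by (auto simp: embeddings_def)
  have "hom_on t (G_act t g \<phi>)"
    using t g'(1) \<phi>'(1) subspace_add[of t] subspace_scale[of t]
    unfolding hom_on_def G_act_def by simp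
  moreover have "inj_on (G_act t g \<phi>) t"
    using g'(2) \<phi>'(2) by (auto simp: inj_on_def G_act_def)
  ultimately show ?thesis by (simp add: embeddings_def G_act_def)
qed

lemma irreducible_G_orbit:
  assumes t: "p_subalgebra t" and \<phi>: "\<phi> \<in> embeddings t"
  shows "irreduciblein (embeddings_top t) (G_orbit t \<phi>)"
  unfolding G_orbit_def
proof (rule irreduciblein_image[OF irreducible_G])
  show "continuous_map Aut_top (embeddings_top t) (\<lambda>g. G_act t g \<phi>)"
    unfolding Aut_top_def embeddings_top_def
  proof (rule continuous_map_zariski)
    show "(\<lambda>g. G_act t g \<phi>) \<in> Autp UNIV \<rightarrow> embeddings t" using G_act_embedding[OF t _ \<phi>] by blast
    fix c :: "('g \<Rightarrow> 'g) \<Rightarrow> 'k" assume c: "c \<in> eval_coords t"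
    have "(\<lambda>g. c (G_act t g \<phi>)) \<in> polyfuns (eval_coords UNIV)"
    proof (rule polyfuns_eval_coordsI[OF c])
      show "polymap (eval_coords UNIV) (\<lambda>g. G_act t g \<phi> i)" if "i \<in> t" for i
        using that polymap_eval[of "\<phi> i" UNIV] by (simp add: G_act_def)
    qed
    then show "c \<circ> (\<lambda>g. G_act t g \<phi>) \<in> polyfuns (eval_coords UNIV)" by (simp add: o_def)
  qed
qed

lemma linform_eqI:
  assumes "\<And>l. linform l \<Longrightarrow> l x = l y"
  shows "x = y"
proof -
  have "representation Basis x b = representation Basis y b" for b
    using assms[OF linform_coord] .
  then have "(\<Sum>b\<in>Basis. representation Basis x b *s b) = (\<Sum>b\<in>Basis. representation Basis y b *s b)"
    by (simp only:)
  then show ?thesis by (simp only: Basis_expansion)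
qed

lemma lin_of_add: "lin_of v s (x + y) = lin_of v s x + lin_of v s y"
  and lin_of_scale: "lin_of v s (c *s x) = c *s lin_of v s x"
  by (simp_all add: lin_of_def linform_add[OF linform_coord] linform_scale[OF linform_coord]
      distrib_left scale_left_distrib sum.distrib scale_sum_right mult.left_commute)

lemma polyfuns_linform_diff:
  "linform l \<Longrightarrow> polymap F u \<Longrightarrow> polymap F w \<Longrightarrow> (\<lambda>x. l (u x) - l (w x)) \<in> polyfuns F"
  by (intro polyfuns_diff polymapD)

text \<open>
  Adjoining the entries of the inverse matrix makes \<open>G\<close> the image of a Zariski closed set.
\<close>

lemma G_matrix_equations:
  obtains P where "finite P" "P \<subseteq> polyfuns matrix_coords"
    "\<And>v. v \<in> zero_locus UNIV P \<Longrightarrow> lin_of v True \<in> G"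
    "\<And>g. g \<in> G \<Longrightarrow> matrix_of g (inv_into UNIV g) \<in> zero_locus UNIV P"
proof -
  have "closedin Aut_top G" unfolding G_def by (rule closedin_connected_component_of)
  then obtain R where R: "R \<subseteq> polyfuns (eval_coords UNIV)" "G = zero_locus (Autp UNIV) R"
    unfolding Aut_top_def closedin_zariski by (elim exE conjE)
  let ?f = "\<lambda>v. lin_of v True" and ?f' = "\<lambda>v. lin_of v False"
  \<comment> \<open>Linearity is built into \<open>lin_of\<close>. The families impose compatibility
    with the bracket and the p-map, inverseness on both sides, and the equations \<open>R\<close> of
    the closed set \<open>G\<close>.\<close>
  define Q1 where "Q1 = {(\<lambda>v. l (?f v (bracket x y)) - l (bracket (?f v x) (?f v y))) | l x y. linform l}"
  define Q2 where "Q2 = {(\<lambda>v. l (?f v (pmap x)) - l (pmap (?f v x))) | l x. linform l}"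
  define Q3 where "Q3 = {(\<lambda>v. l (?f v (?f' v x)) - l x) | l x. linform l}"
  define Q4 where "Q4 = {(\<lambda>v. l (?f' v (?f v x)) - l x) | l x. linform l}"
  define Q5 where "Q5 = (\<lambda>f v. f (?f v)) ` R"
  let ?Q = "Q1 \<union> Q2 \<union> Q3 \<union> Q4 \<union> Q5"
  note pm = polymap_lin_of polymap_const polymap_bracket polymap_pmap
  have "Q1 \<subseteq> polyfuns matrix_coords"
  proof
    fix f assume "f \<in> Q1"
    then obtain l x y where f: "f = (\<lambda>v. l (?f v (bracket x y)) - l (bracket (?f v x) (?f v y)))" and l: "linform l"
      unfolding Q1_def by blast
    show "f \<in> polyfuns matrix_coords" unfolding f by (rule polyfuns_linform_diff[OF l]) (intro pm)+
  qed
  moreover have "Q2 \<subseteq> polyfuns matrix_coords"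
  proof
    fix f assume "f \<in> Q2"
    then obtain l x where f: "f = (\<lambda>v. l (?f v (pmap x)) - l (pmap (?f v x)))" and l: "linform l"
      unfolding Q2_def by blast
    show "f \<in> polyfuns matrix_coords" unfolding f by (rule polyfuns_linform_diff[OF l]) (intro pm)+
  qed
  moreover have "Q3 \<subseteq> polyfuns matrix_coords"
  proof
    fix f assume "f \<in> Q3"
    then obtain l x where f: "f = (\<lambda>v. l (?f v (?f' v x)) - l x)" and l: "linform l"
      unfolding Q3_def by blast
    show "f \<in> polyfuns matrix_coords" unfolding f by (rule polyfuns_linform_diff[OF l]) (intro pm)+
  qed
  moreover have "Q4 \<subseteq> polyfuns matrix_coords"
  proof
    fix f assume "f \<in> Q4"
    then obtain l x where f: "f = (\<lambda>v. l (?f' v (?f v x)) - l x)" and l: "linform l"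
      unfolding Q4_def by blast
    show "f \<in> polyfuns matrix_coords" unfolding f by (rule polyfuns_linform_diff[OF l]) (intro pm)+
  qed
  moreover have "Q5 \<subseteq> polyfuns matrix_coords"
    unfolding Q5_def using polyfuns_lin_of[OF subsetD[OF R(1)]] by (rule image_subsetI)
  ultimately have "?Q \<subseteq> polyfuns matrix_coords" by (intro Un_least)
  \<comment> \<open>The system runs over all vectors and linear forms; a finite subsystem is needed
    for constructibility.\<close>
  from noetherian_locusD[OF noetherian_locus_finite[OF finite_matrix_coords] this]
  obtain P where P: "P \<subseteq> ?Q" "finite P" "zero_locus UNIV P = zero_locus UNIV ?Q" .
  show thesis
  proof (rule that[of P])
    show "finite P" by (rule P(2))
    show "P \<subseteq> polyfuns matrix_coords" using P(1) \<open>?Q \<subseteq> polyfuns matrix_coords\<close> by (rule subset_trans)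
    fix v assume "v \<in> zero_locus UNIV P"
    then have v: "\<And>f. f \<in> ?Q \<Longrightarrow> f v = 0" unfolding P(3) by (simp add: zero_locus_def)
    have 1: "?f v (bracket x y) = bracket (?f v x) (?f v y)" for x y
    proof (rule linform_eqI)
      fix l assume l: "linform l"
      have "(\<lambda>v. l (?f v (bracket x y)) - l (bracket (?f v x) (?f v y))) \<in> Q1"
        unfolding Q1_def by (rule CollectI, rule exI[of _ l], rule exI[of _ x], rule exI[of _ y], simp add: l)
      then show "l (?f v (bracket x y)) = l (bracket (?f v x) (?f v y))" using v by fastforce
    qed
    have 2: "?f v (pmap x) = pmap (?f v x)" for x
    proof (rule linform_eqI)
      fix l assume l: "linform l"
      have "(\<lambda>v. l (?f v (pmap x)) - l (pmap (?f v x))) \<in> Q2"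
        unfolding Q2_def by (rule CollectI, rule exI[of _ l], rule exI[of _ x], simp add: l)
      then show "l (?f v (pmap x)) = l (pmap (?f v x))" using v by fastforce
    qed
    have 3: "?f v (?f' v x) = x" for x
    proof (rule linform_eqI)
      fix l assume l: "linform l"
      have "(\<lambda>v. l (?f v (?f' v x)) - l x) \<in> Q3"
        unfolding Q3_def by (rule CollectI, rule exI[of _ l], rule exI[of _ x], simp add: l)
      then show "l (?f v (?f' v x)) = l x" using v by fastforce
    qed
    have 4: "?f' v (?f v x) = x" for x
    proof (rule linform_eqI)
      fix l assume l: "linform l"
      have "(\<lambda>v. l (?f' v (?f v x)) - l x) \<in> Q4"
        unfolding Q4_def by (rule CollectI, rule exI[of _ l], rule exI[of _ x], simp add: l)
      then show "l (?f' v (?f v x)) = l x" using v by fastforce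
    qed
    have 5: "f (?f v) = 0" if "f \<in> R" for f
    proof -
      have "(\<lambda>v. f (?f v)) \<in> Q5" unfolding Q5_def using that by (rule imageI)
      then show ?thesis using v by fastforce
    qed
    have "bij (?f v)" using 3 4 by (intro o_bij[of "?f' v"]) (auto simp: fun_eq_iff)
    then have "?f v \<in> Autp UNIV"
      using 1 2 by (simp add: Autp_def Bij_UNIV hom_on_def lin_of_add lin_of_scale)
    then show "?f v \<in> G" unfolding R(2) using 5 by (simp add: zero_locus_def)
  next
    fix g assume g: "g \<in> G"
    then have gA: "g \<in> Autp UNIV" using G_subset by blast
    let ?v = "matrix_of g (inv_into UNIV g)"
    have v: "lin_of ?v True = g" "lin_of ?v False = inv_into UNIV g"
      using lin_of_matrix_of[OF Autp_UNIV(3)[OF gA] Autp_UNIV(3)[OF Autp_UNIV(5)[OF gA]]] by simp_all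
    have "bij g" by (rule Autp_UNIV(2)[OF gA])
    then have inv: "g (inv_into UNIV g x) = x" "inv_into UNIV g (g x) = x" for x
      by (simp_all add: bij_is_inj bij_is_surj surj_f_inv_f)
    have hom: "g (bracket x y) = bracket (g x) (g y)" "g (pmap x) = pmap (g x)" for x y
      using gA by (auto simp: Autp_def hom_on_def)
    have R0: "f g = 0" if "f \<in> R" for f using g that unfolding R(2) by (simp add: zero_locus_def)
    have "f ?v = 0" if "f \<in> ?Q" for f
      using that by (auto simp: Q1_def Q2_def Q3_def Q4_def Q5_def v inv hom R0)
    then show "?v \<in> zero_locus UNIV P" unfolding P(3) by (simp add: zero_locus_def)
  qed
qed

end

context restricted_lie_algebra_alg_closed
begin

text \<open>The orbit is the projection of the pairs of an embedding \<open>\<psi>\<close> and a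
  matrix point encoding some \<open>g\<close> in \<open>G\<close> with
  \<open>\<psi> = g \<phi>\<close>. Agreement need only be tested on a frame of \<open>t\<close>, so
  finitely many equations suffice and Chevalley's theorem applies.\<close>

lemma G_orbit_constructible:
  assumes t: "torus t" and \<phi>: "\<phi> \<in> embeddings t"
  shows "\<exists>C\<in>constructible (eval_coords t). G_orbit t \<phi> = embeddings t \<inter> C"
proof -
  define d where "d = dim t"
  obtain e where e: "e \<in> frames d" "span (e ` {..<d}) = t" "\<And>i. i < d \<Longrightarrow> pmap (e i) = e i"
    by (rule torus_toral_basis[OF t, folded d_def]) (rule that)
  obtain L where "\<And>i. linform (L i)"
    "\<And>i j. i < d \<Longrightarrow> j < d \<Longrightarrow> L i (e j) = (if i = j then 1 else 0)"
    and L: "\<And>v. v \<in> span (e ` {..<d}) \<Longrightarrow> v = (\<Sum>i<d. L i v *s e i)"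
    by (rule frame_dual[OF e(1)]) (rule that)
  have eT: "e i \<in> t" if "i < d" for i using frame_in_span[OF that, of e] e(2) by simp
  have pt: "p_subalgebra t" using t by (simp add: torus_def)
  obtain P where P: "finite P" "P \<subseteq> polyfuns matrix_coords"
    "\<And>v. v \<in> zero_locus UNIV P \<Longrightarrow> lin_of v True \<in> G"
    "\<And>g. g \<in> G \<Longrightarrow> matrix_of g (inv_into UNIV g) \<in> zero_locus UNIV P"
    by (rule G_matrix_equations) (rule that)
  let ?I = "UNIV \<times> Basis \<times> Basis :: (bool \<times> 'g \<times> 'g) set"
  let ?F = "pair_coords (eval_coords t) ?I"
  have pull_snd: "(\<lambda>z. f (snd z)) \<in> polyfuns ?F" if "f \<in> polyfuns matrix_coords" for f
  proof (rule polyfuns_subst[where a = snd, OF that])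
    fix c :: "(bool \<times> 'g \<times> 'g \<Rightarrow> 'k) \<Rightarrow> 'k" assume "c \<in> matrix_coords"
    then obtain i where i: "i \<in> ?I" "c = (\<lambda>v. v i)" unfolding matrix_coords_def by blast
    then show "(\<lambda>z. c (snd z)) \<in> polyfuns ?F" by (simp only:) (intro polyfuns_coord pair_coords_snd)
  qed
  have pull_fst: "(\<lambda>z. f (fst z)) \<in> polyfuns ?F" if "f \<in> polyfuns (eval_coords t)" for f
    by (rule polyfuns_subst[where a = fst, OF that]) (intro polyfuns_coord pair_coords_fst)
  define q where "q i b = (\<lambda>z. representation Basis (fst z (e i)) b
      - representation Basis (lin_of (snd z) True (\<phi> (e i))) b)"
    for i b and z :: "('g \<Rightarrow> 'g) \<times> (bool \<times> 'g \<times> 'g \<Rightarrow> 'k)"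
  have q: "q i b \<in> polyfuns ?F" if "i < d" for i b
  proof -
    have "(\<lambda>\<psi>. representation Basis (\<psi> (e i)) b) \<in> polyfuns (eval_coords t)"
      by (intro polymap_coord polymap_eval eT that)
    moreover have "(\<lambda>v. representation Basis (lin_of v True (\<phi> (e i))) b) \<in> polyfuns matrix_coords"
      by (intro polymap_coord polymap_lin_of polymap_const)
    ultimately show ?thesis unfolding q_def by (rule polyfuns_diff[OF pull_fst pull_snd])
  qed
  define Q where "Q = (\<lambda>f z. f (snd z)) ` P \<union> (\<lambda>(i, b). q i b) ` ({..<d} \<times> Basis)"
  have "Q \<subseteq> polyfuns ?F" unfolding Q_def using q pull_snd[OF subsetD[OF P(2)]] by auto
  moreover have "finite Q" unfolding Q_def using P(1) finite_Basis by simp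
  ultimately have "zero_locus UNIV Q \<in> constructible ?F" by (intro constructible_zero_locus)
  then have "{\<psi>. \<exists>v. (\<psi>, v) \<in> zero_locus UNIV Q} \<in> constructible (eval_coords t)"
    by (rule constructible_projection[rotated]) (simp add: finite_Basis)
  moreover have "G_orbit t \<phi> = embeddings t \<inter> {\<psi>. \<exists>v. (\<psi>, v) \<in> zero_locus UNIV Q}"
  proof (intro equalityI subsetI IntI CollectI)
    fix \<psi> assume "\<psi> \<in> G_orbit t \<phi>"
    then obtain g where g: "g \<in> G" "\<psi> = G_act t g \<phi>" by (auto simp: G_orbit_def)
    have gA: "g \<in> Autp UNIV" using g(1) G_subset by blast
    show "\<psi> \<in> embeddings t" unfolding g(2) by (rule G_act_embedding[OF pt gA \<phi>])
    let ?v = "matrix_of g (inv_into UNIV g)"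
    have v: "lin_of ?v True = g"
      using lin_of_matrix_of[OF Autp_UNIV(3)[OF gA] Autp_UNIV(3)[OF Autp_UNIV(5)[OF gA]]] by simp
    have "f ?v = 0" if "f \<in> P" for f using P(4)[OF g(1)] that by (simp add: zero_locus_def)
    moreover have "q i b (\<psi>, ?v) = 0" if "i < d" for i b
      using eT[OF that] by (simp add: q_def v g(2) G_act_def)
    ultimately have "(\<psi>, ?v) \<in> zero_locus UNIV Q" by (auto simp: zero_locus_def Q_def)
    then show "\<exists>v. (\<psi>, v) \<in> zero_locus UNIV Q" by (rule exI[of _ ?v])
  next
    fix \<psi> assume "\<psi> \<in> embeddings t \<inter> {\<psi>. \<exists>v. (\<psi>, v) \<in> zero_locus UNIV Q}"
    then obtain v where \<psi>: "\<psi> \<in> embeddings t" and vQ: "(\<psi>, v) \<in> zero_locus UNIV Q" by blast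
    have Q0: "f (\<psi>, v) = 0" if "f \<in> Q" for f using vQ that unfolding zero_locus_def by blast
    have "f v = 0" if f: "f \<in> P" for f
    proof -
      have "(\<lambda>z. f (snd z)) \<in> Q" unfolding Q_def by (intro UnI1 imageI f)
      from Q0[OF this] show ?thesis by simp
    qed
    then have "v \<in> zero_locus UNIV P" by (simp add: zero_locus_def)
    then have g: "lin_of v True \<in> G" by (rule P(3))
    then have gA: "lin_of v True \<in> Autp UNIV" using G_subset by blast
    have "representation Basis (\<psi> (e i)) b = representation Basis (lin_of v True (\<phi> (e i))) b"
      if "i < d" "b \<in> Basis" for i b
    proof -
      have "(case (i, b) of (i, b) \<Rightarrow> q i b) \<in> Q"
        unfolding Q_def by (intro UnI2 imageI) (use that in simp)
      then have "q i b (\<psi>, v) = 0" using Q0 by simp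
      then show ?thesis by (simp add: q_def)
    qed
    then have "(\<Sum>b\<in>Basis. representation Basis (\<psi> (e i)) b *s b) =
        (\<Sum>b\<in>Basis. representation Basis (lin_of v True (\<phi> (e i))) b *s b)" if "i < d" for i
      using that by (intro sum.cong) auto
    then have ei: "\<psi> (e i) = lin_of v True (\<phi> (e i))" if "i < d" for i
      using that by (simp only: Basis_expansion)
    have "\<psi> = G_act t (lin_of v True) \<phi>"
    proof -
      let ?\<psi> = "G_act t (lin_of v True) \<phi>"
      have E: "\<psi> \<in> extensional t" "hom_on t \<psi>" "?\<psi> \<in> extensional t" "hom_on t ?\<psi>"
        using \<psi> G_act_embedding[OF pt gA \<phi>] by (auto simp: embeddings_def)
      have L': "v = (\<Sum>i<d. L i v *s e i)" if "v \<in> t" for v using L[of v] that e(2) by simp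
      have "frame_map t L d (\<lambda>i. \<psi> (e i)) = \<psi>"
        by (rule frame_map_restrict[OF t e(1,2) L' E(1,2)]) simp_all
      moreover have "frame_map t L d (\<lambda>i. \<psi> (e i)) = ?\<psi>"
        by (rule frame_map_restrict[OF t e(1,2) L' E(3,4)]) (use ei eT in \<open>simp_all add: G_act_def\<close>)
      ultimately show ?thesis by simp
    qed
    then show "\<psi> \<in> G_orbit t \<phi>"
      unfolding G_orbit_def using imageI[OF g, of "\<lambda>g. G_act t g \<phi>"] by simp
  qed
  ultimately show ?thesis by blast
qed

text \<open>Inside the common closure, the points where \<open>q\<close> is nonzero all belong to
  the first orbit. They form a nonempty open part, which the second orbit meets by density.\<close>

lemma G_orbits_meet:
  assumes t: "torus t" and \<phi>: "\<phi> \<in> embeddings t" "\<psi> \<in> embeddings t"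
    and cl: "embeddings_top t closure_of G_orbit t \<phi> = embeddings_top t closure_of G_orbit t \<psi>"
  shows "G_orbit t \<phi> \<inter> G_orbit t \<psi> \<noteq> {}"
proof -
  have pt: "p_subalgebra t" using t by (simp add: torus_def)
  obtain C where C: "C \<in> constructible (eval_coords t)" "G_orbit t \<phi> = embeddings t \<inter> C"
    using G_orbit_constructible[OF t \<phi>(1)] by blast
  from irreducible_constructible_open_in_closure[OF C
      irreducible_G_orbit[OF pt \<phi>(1), unfolded embeddings_top_def]]
  obtain q where "q \<in> polyfuns (eval_coords t)" and "(\<exists>x\<in>G_orbit t \<phi>. q x \<noteq> 0) \<and>
    (\<forall>y\<in>embeddings_top t closure_of G_orbit t \<phi>. q y \<noteq> 0 \<longrightarrow> y \<in> G_orbit t \<phi>)"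
    unfolding embeddings_top_def[symmetric] by (elim bexE)
  then obtain x where q: "q \<in> polyfuns (eval_coords t)" "x \<in> G_orbit t \<phi>" "q x \<noteq> 0"
    and op: "\<And>y. y \<in> embeddings_top t closure_of G_orbit t \<phi> \<Longrightarrow> q y \<noteq> 0 \<Longrightarrow> y \<in> G_orbit t \<phi>"
    by (elim conjE bexE) simp
  let ?T = "embeddings_top t"
  have sub: "G_orbit t \<xi> \<subseteq> embeddings t" if "\<xi> \<in> embeddings t" for \<xi>
    using irreducible_G_orbit[OF pt that] by (simp add: irreduciblein_def)
  let ?D = "{y \<in> embeddings t. q y \<noteq> 0}"
  have x: "x \<in> ?T closure_of G_orbit t \<psi>"
    using closure_of_subset[of "G_orbit t \<phi>" ?T] sub[OF \<phi>(1)] q(2) cl by auto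
  have D: "openin ?T ?D"
    unfolding embeddings_top_def openin_zariski
    using q(1) by (intro exI[of _ "{q}"]) (auto simp: zero_locus_def)
  have "x \<in> ?D" using q(2,3) sub[OF \<phi>(1)] by auto
  with conjunct2[OF x[unfolded in_closure_of]] D have "\<exists>y\<in>G_orbit t \<psi>. y \<in> ?D"
    by (elim allE[of _ ?D]) (simp add: Bex_def)
  then obtain y where y: "y \<in> G_orbit t \<psi>" "q y \<noteq> 0" by auto
  have "y \<in> ?T closure_of G_orbit t \<psi>"
    using closure_of_subset[of "G_orbit t \<psi>" ?T] sub[OF \<phi>(2)] y(1) by auto
  then have "y \<in> G_orbit t \<phi>" using op y(2) cl by simp
  with y(1) show ?thesis by blast
qed

end

section \<open>The two group actions on the embeddings\<close>

context restricted_lie_algebra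
begin

lemma G_comp: "a \<in> G \<Longrightarrow> b \<in> G \<Longrightarrow> a \<circ> b \<in> G"
  using subgroup.m_closed[OF G_subgroup, of a b] G_bij by simp

lemma G_inv: "a \<in> G \<Longrightarrow> inv_into UNIV a \<in> G"
  using subgroup.m_inv_closed[OF G_subgroup, of a] G_bij by simp

lemma G_inv_apply: "g \<in> G \<Longrightarrow> g (inv_into UNIV g x) = x" "g \<in> G \<Longrightarrow> inv_into UNIV g (g x) = x"
  using G_bij[of g] by (simp_all add: bij_is_inj bij_is_surj surj_f_inv_f)

lemma G_act_G_act: "G_act t g (G_act t g' \<phi>) = G_act t (g \<circ> g') \<phi>"
  by (auto simp: G_act_def)

lemma G_orbit_eq:
  assumes "g \<in> G"
  shows "G_orbit t (G_act t g \<phi>) = G_orbit t \<phi>"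
proof
  show "G_orbit t (G_act t g \<phi>) \<subseteq> G_orbit t \<phi>"
    using G_comp[OF _ assms] by (auto simp: G_orbit_def G_act_G_act)
  show "G_orbit t \<phi> \<subseteq> G_orbit t (G_act t g \<phi>)"
  proof
    fix \<psi> assume "\<psi> \<in> G_orbit t \<phi>"
    then obtain h where h: "h \<in> G" "\<psi> = G_act t h \<phi>" by (auto simp: G_orbit_def)
    have "\<psi> = G_act t (h \<circ> inv_into UNIV g) (G_act t g \<phi>)"
      unfolding h(2) by (auto simp: G_act_def G_inv_apply(2)[OF assms])
    then show "\<psi> \<in> G_orbit t (G_act t g \<phi>)"
      using G_comp[OF h(1) G_inv[OF assms]] by (auto simp: G_orbit_def)
  qed
qed

lemma Autp_extensional: "h \<in> Autp t \<Longrightarrow> h \<in> extensional t"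
  by (simp add: Autp_def Bij_def)

lemma Autp_mult:
  "h \<in> Autp t \<Longrightarrow> k \<in> Autp t \<Longrightarrow> h \<otimes>\<^bsub>Autp_group t\<^esub> k = compose t h k"
  by (simp add: BijGroup_def Autp_def)

lemma Autp_one: "\<one>\<^bsub>Autp_group t\<^esub> = (\<lambda>x\<in>t. x)"
  by (simp add: BijGroup_def)

lemma Autp_apply: "h \<in> Autp t \<Longrightarrow> x \<in> t \<Longrightarrow> h x \<in> t"
  by (auto simp: Autp_def Bij_def bij_betw_def)

lemma Autp_inv:
  assumes t: "p_subalgebra t" and h: "h \<in> Autp t"
  shows "inv\<^bsub>Autp_group t\<^esub> h \<in> Autp t"
    "x \<in> t \<Longrightarrow> (inv\<^bsub>Autp_group t\<^esub> h) (h x) = x"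
    "x \<in> t \<Longrightarrow> h ((inv\<^bsub>Autp_group t\<^esub> h) x) = x"
proof -
  interpret A: group "Autp_group t" by (rule group_Autp[OF t])
  show k: "inv\<^bsub>Autp_group t\<^esub> h \<in> Autp t" using A.inv_closed[of h] h by simp
  have "compose t (inv\<^bsub>Autp_group t\<^esub> h) h = (\<lambda>x\<in>t. x)"
    using A.l_inv[of h] h unfolding Autp_mult[OF k h] Autp_one by simp
  then show "x \<in> t \<Longrightarrow> (inv\<^bsub>Autp_group t\<^esub> h) (h x) = x" by (metis compose_eq restrict_apply')
  have "compose t h (inv\<^bsub>Autp_group t\<^esub> h) = (\<lambda>x\<in>t. x)"
    using A.r_inv[of h] h unfolding Autp_mult[OF h k] Autp_one by simp
  then show "x \<in> t \<Longrightarrow> h ((inv\<^bsub>Autp_group t\<^esub> h) x) = x" by (metis compose_eq restrict_apply')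
qed

lemma Aut_act_eq: "Aut_act t h \<phi> = (\<lambda>x\<in>t. \<phi> ((inv\<^bsub>Autp_group t\<^esub> h) x))"
  by (simp add: Aut_act_def compose_def)

lemma Aut_act_mult:
  assumes t: "p_subalgebra t" and h: "h \<in> Autp t" "h' \<in> Autp t"
  shows "Aut_act t (h \<otimes>\<^bsub>Autp_group t\<^esub> h') \<phi> = Aut_act t h (Aut_act t h' \<phi>)"
proof -
  interpret A: group "Autp_group t" by (rule group_Autp[OF t])
  have "inv\<^bsub>Autp_group t\<^esub> (h \<otimes>\<^bsub>Autp_group t\<^esub> h') = compose t (inv\<^bsub>Autp_group t\<^esub> h') (inv\<^bsub>Autp_group t\<^esub> h)"
    using A.inv_mult_group[of h h'] h Autp_mult[OF Autp_inv(1)[OF t h(2)] Autp_inv(1)[OF t h(1)]] by simp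
  then show ?thesis
    using Autp_apply[OF Autp_inv(1)[OF t h(1)]] by (auto simp: Aut_act_eq compose_eq intro!: restrict_ext)
qed

lemma Aut_act_one:
  assumes t: "p_subalgebra t" and \<phi>: "\<phi> \<in> extensional t"
  shows "Aut_act t \<one>\<^bsub>Autp_group t\<^esub> \<phi> = \<phi>"
proof -
  interpret A: group "Autp_group t" by (rule group_Autp[OF t])
  show ?thesis
    unfolding Aut_act_eq A.inv_one unfolding Autp_one
    by (rule extensionalityI[OF _ \<phi>]) simp_all
qed

lemma Aut_act_embedding:
  assumes t: "p_subalgebra t" and h: "h \<in> Autp t" and \<phi>: "\<phi> \<in> embeddings t"
  shows "Aut_act t h \<phi> \<in> embeddings t"
proof -
  note t' = t[unfolded p_subalgebra_def]
  define k where "k = inv\<^bsub>Autp_group t\<^esub> h"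
  have k: "k \<in> Autp t" unfolding k_def by (rule Autp_inv(1)[OF t h])
  have k': "hom_on t k" "inj_on k t" using k by (auto simp: Autp_def Bij_def bij_betw_def)
  have \<phi>': "hom_on t \<phi>" "inj_on \<phi> t" using \<phi> by (auto simp: embeddings_def)
  have "hom_on t (\<lambda>x\<in>t. \<phi> (k x))"
    using t' k'(1) \<phi>'(1) subspace_add[of t] subspace_scale[of t] Autp_apply[OF k]
    unfolding hom_on_def by simp
  moreover have "inj_on (\<lambda>x\<in>t. \<phi> (k x)) t"
    using k'(2) \<phi>'(2) Autp_apply[OF k] by (auto simp: inj_on_def)
  ultimately show ?thesis by (simp add: embeddings_def Aut_act_eq k_def[symmetric])
qed

lemma continuous_Aut_act:
  assumes t: "p_subalgebra t" and h: "h \<in> Autp t"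
  shows "continuous_map (embeddings_top t) (embeddings_top t) (Aut_act t h)"
  unfolding embeddings_top_def
proof (rule continuous_map_zariski)
  show "Aut_act t h \<in> embeddings t \<rightarrow> embeddings t" using Aut_act_embedding[OF t h] by blast
  fix c :: "('g \<Rightarrow> 'g) \<Rightarrow> 'k" assume c: "c \<in> eval_coords t"
  have "(\<lambda>\<phi>. c (Aut_act t h \<phi>)) \<in> polyfuns (eval_coords t)"
  proof (rule polyfuns_eval_coordsI[OF c])
    show "polymap (eval_coords t) (\<lambda>\<phi>. Aut_act t h \<phi> i)" if "i \<in> t" for i
      using that polymap_eval[OF Autp_apply[OF Autp_inv(1)[OF t h] that]] by (simp add: Aut_act_eq)
  qed
  then show "c \<circ> Aut_act t h \<in> polyfuns (eval_coords t)" by (simp add: o_def)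
qed

lemma Aut_act_inverse:
  assumes t: "p_subalgebra t" and h: "h \<in> Autp t" and \<phi>: "\<phi> \<in> embeddings t"
  shows "Aut_act t (inv\<^bsub>Autp_group t\<^esub> h) (Aut_act t h \<phi>) = \<phi>"
    "Aut_act t h (Aut_act t (inv\<^bsub>Autp_group t\<^esub> h) \<phi>) = \<phi>"
proof -
  interpret A: group "Autp_group t" by (rule group_Autp[OF t])
  have \<phi>: "\<phi> \<in> extensional t" using \<phi> by (simp add: embeddings_def)
  show "Aut_act t (inv\<^bsub>Autp_group t\<^esub> h) (Aut_act t h \<phi>) = \<phi>"
    unfolding Aut_act_mult[OF t Autp_inv(1)[OF t h] h, symmetric]
    using A.l_inv[of h] h Aut_act_one[OF t \<phi>] by simp
  show "Aut_act t h (Aut_act t (inv\<^bsub>Autp_group t\<^esub> h) \<phi>) = \<phi>"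
    unfolding Aut_act_mult[OF t h Autp_inv(1)[OF t h], symmetric]
    using A.r_inv[of h] h Aut_act_one[OF t \<phi>] by simp
qed

lemma Aut_act_closure_of:
  assumes t: "p_subalgebra t" and h: "h \<in> Autp t" and A: "A \<subseteq> embeddings t"
  shows "Aut_act t h ` (embeddings_top t closure_of A) = embeddings_top t closure_of (Aut_act t h ` A)"
proof -
  have "homeomorphic_maps (embeddings_top t) (embeddings_top t) (Aut_act t h)
      (Aut_act t (inv\<^bsub>Autp_group t\<^esub> h))"
    unfolding homeomorphic_maps_def topspace_embeddings_top
    by (intro conjI ballI continuous_Aut_act t h Autp_inv(1) Aut_act_inverse)
  then have "homeomorphic_map (embeddings_top t) (embeddings_top t) (Aut_act t h)"
    unfolding homeomorphic_map_maps by (rule exI[of _ "Aut_act t (inv\<^bsub>Autp_group t\<^esub> h)"])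
  then have "embeddings_top t closure_of (Aut_act t h ` A) = Aut_act t h ` (embeddings_top t closure_of A)"
    by (rule homeomorphic_map_closure_of) (simp add: A)
  then show ?thesis by (rule sym)
qed

text \<open>One group acts by composition on the left and the other on the right, so the actions
  commute.\<close>

lemma Aut_act_G_orbit:
  assumes t: "p_subalgebra t" and h: "h \<in> Autp t"
  shows "Aut_act t h ` G_orbit t \<phi> = G_orbit t (Aut_act t h \<phi>)"
proof -
  have "Aut_act t h (G_act t g \<phi>) = G_act t g (Aut_act t h \<phi>)" for g
    unfolding Aut_act_eq G_act_def
    by (rule restrict_ext) (simp add: Autp_apply[OF Autp_inv(1)[OF t h]])
  then show ?thesis by (simp only: G_orbit_def image_image)
qed

lemma inclusion_embedding: "(\<lambda>x\<in>t. x) \<in> embeddings t" if "p_subalgebra t"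
  using that subspace_add[of t] subspace_scale[of t]
  by (auto simp: embeddings_def hom_on_def p_subalgebra_def inj_on_def)

text \<open>The set \<open>X0\<close> of the overview. \<open>X_comp\<close> is given by a
  description, so nothing is known about it until \<open>X_comp_eq\<close> identifies the
  two.\<close>

definition inclusion_component :: "'g set \<Rightarrow> ('g \<Rightarrow> 'g) set" where
  "inclusion_component t = embeddings_top t closure_of G_orbit t (\<lambda>x\<in>t. x)"

lemma G_orbit_subset: "p_subalgebra t \<Longrightarrow> \<phi> \<in> embeddings t \<Longrightarrow> G_orbit t \<phi> \<subseteq> embeddings t"
  using irreducible_G_orbit by (auto simp: irreduciblein_def)

lemma Aut_act_inclusion_component:
  assumes t: "p_subalgebra t" and h: "h \<in> Autp t"
  shows "Aut_act t h ` inclusion_component t =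
    embeddings_top t closure_of G_orbit t (Aut_act t h (\<lambda>x\<in>t. x))"
  unfolding inclusion_component_def
    Aut_act_closure_of[OF t h G_orbit_subset[OF t inclusion_embedding[OF t]]] Aut_act_G_orbit[OF t h] ..

lemma restrict_G_Autp:
  assumes t: "p_subalgebra t" and g: "g \<in> G" and \<phi>: "\<phi> \<in> embeddings t" "\<phi> ` t = g ` t"
  shows "(\<lambda>x\<in>t. inv_into UNIV g (\<phi> x)) \<in> Autp t"
proof -
  let ?k = "\<lambda>x\<in>t. inv_into UNIV g (\<phi> x)"
  have "G_act t (inv_into UNIV g) \<phi> \<in> embeddings t"
    using G_act_embedding[OF t _ \<phi>(1)] G_inv[OF g] G_subset by blast
  then have k: "hom_on t ?k" "inj_on ?k t" by (simp_all add: G_act_def embeddings_def)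
  have "?k ` t = inv_into UNIV g ` (\<phi> ` t)" by (auto simp: image_image)
  also have "\<dots> = t" unfolding \<phi>(2) by (simp add: image_image G_inv_apply(2)[OF g])
  finally have "?k ` t = t" .
  then show ?thesis using k by (simp add: Autp_def Bij_def bij_betw_def)
qed

text \<open>If \<open>\<phi>\<close> and \<open>g\<close> have the same image of \<open>t\<close>,
  then \<open>g\<close> inverse after \<open>\<phi>\<close> is an automorphism of \<open>t\<close>.
  It acts on the inclusion through its inverse, which is why \<open>h\<close> is the inverse of
  \<open>?k\<close>.\<close>

lemma orbit_embeddings_cover:
  assumes t: "p_subalgebra t" and \<phi>: "\<phi> \<in> orbit_embeddings t"
  shows "\<exists>h\<in>Autp t. \<phi> \<in> G_orbit t (Aut_act t h (\<lambda>x\<in>t. x))"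
proof -
  obtain g where \<phi>': "\<phi> \<in> embeddings t" and g: "g \<in> G" "\<phi> ` t = g ` t"
    using \<phi> by (auto simp: orbit_embeddings_def)
  let ?k = "\<lambda>x\<in>t. inv_into UNIV g (\<phi> x)"
  have k: "?k \<in> Autp t" by (rule restrict_G_Autp[OF t g(1) \<phi>' g(2)])
  interpret A: group "Autp_group t" by (rule group_Autp[OF t])
  define h where "h = inv\<^bsub>Autp_group t\<^esub> ?k"
  have h: "h \<in> Autp t" unfolding h_def by (rule Autp_inv(1)[OF t k])
  have hk: "inv\<^bsub>Autp_group t\<^esub> h = ?k" unfolding h_def using A.inv_inv[of ?k] k by simp
  have "Aut_act t h (\<lambda>x\<in>t. x) = ?k"
    unfolding Aut_act_eq hk by (rule restrict_ext) (use Autp_apply[OF k] in simp)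
  then have "G_act t g (Aut_act t h (\<lambda>x\<in>t. x)) = (\<lambda>x\<in>t. \<phi> x)"
    unfolding G_act_def by (intro restrict_ext) (simp add: G_inv_apply(1)[OF g(1)])
  also have "\<dots> = \<phi>" using \<phi>' by (simp add: embeddings_def extensional_restrict)
  finally have "\<phi> \<in> G_orbit t (Aut_act t h (\<lambda>x\<in>t. x))"
    unfolding G_orbit_def using imageI[OF g(1), of "\<lambda>g. G_act t g (Aut_act t h (\<lambda>x\<in>t. x))"] by simp
  then show ?thesis using h by blast
qed

lemma closure_of_zariski_dense:
  assumes "A \<subseteq> X" "x \<in> X" "\<And>f. f \<in> polyfuns F \<Longrightarrow> (\<And>a. a \<in> A \<Longrightarrow> f a = 0) \<Longrightarrow> f x = (0 :: 'b::field)"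
  shows "x \<in> zariski X F closure_of A"
proof -
  have "closedin (zariski X F) (zariski X F closure_of A)" by simp
  then obtain R where R: "R \<subseteq> polyfuns F" "zariski X F closure_of A = zero_locus X R"
    unfolding closedin_zariski by (elim exE conjE)
  have A: "A \<subseteq> zero_locus X R" unfolding R(2)[symmetric] using assms(1) by (simp add: closure_of_subset)
  have "f x = 0" if "f \<in> R" for f
    by (rule assms(3)) (use R(1) A that in \<open>auto simp: zero_locus_def\<close>)
  then show ?thesis unfolding R(2) using assms(2) by (simp add: zero_locus_def)
qed

end

context restricted_lie_algebra_alg_closed
begin

section \<open>Finitely many translates and the component of the inclusion\<close>

text \<open>In a toral frame the coefficients of a toral element are roots of
  \<open>T^p - T\<close>, so a torus has finitely many toral elements. An automorphism is determined
  by the toral images of the frame.\<close>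

lemma finite_Autp:
  assumes t: "torus t"
  shows "finite (Autp t)"
proof -
  define d where "d = dim t"
  obtain e where e: "e \<in> frames d" "span (e ` {..<d}) = t" "\<And>i. i < d \<Longrightarrow> pmap (e i) = e i"
    by (rule torus_toral_basis[OF t, folded d_def]) (rule that)
  obtain L where L: "\<And>i. linform (L i)"
    "\<And>i j. i < d \<Longrightarrow> j < d \<Longrightarrow> L i (e j) = (if i = j then 1 else 0)"
    "\<And>v. v \<in> span (e ` {..<d}) \<Longrightarrow> v = (\<Sum>i<d. L i v *s e i)"
    by (rule frame_dual[OF e(1)]) (rule that)
  have eT: "e i \<in> t" if "i < d" for i using frame_in_span[OF that, of e] e(2) by simp
  let ?R = "{c. poly (monom 1 CHAR('k) - [:0, 1:]) c = (0::'k)}"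
  have "coeff (monom 1 CHAR('k) - [:0, 1 :: 'k:]) 1 = -1" using CHAR_ge_2 by simp
  then have "monom 1 CHAR('k) - [:0, 1 :: 'k:] \<noteq> 0" by (metis coeff_0 neg_equal_0_iff_equal zero_neq_one)
  then have "finite ?R" by (rule poly_roots_finite)
  define s where "s c = (\<Sum>i<d. c i *s e i)" for c
  let ?S = "s ` ({..<d} \<rightarrow>\<^sub>E ?R)"
  have "finite ?S" using \<open>finite ?R\<close> by (intro finite_imageI finite_PiE) auto
  have S: "x \<in> ?S" if x: "x \<in> t" "pmap x = x" for x
  proof -
    have xL: "x = (\<Sum>i<d. L i x *s e i)" using L(3)[of x] x(1) e(2) by simp
    have "pmap (\<Sum>i<d. L i x *s e i) = (\<Sum>i<d. L i x ^ CHAR('k) *s pmap (e i))"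
      by (rule torus_pmap_sum[OF t]) (use eT in auto)
    then have xp: "x = (\<Sum>i<d. L i x ^ CHAR('k) *s e i)" using x(2) xL e(3) by simp
    have "L j x \<in> ?R" if j: "j < d" for j
    proof -
      have "L j x = L j (\<Sum>i<d. L i x ^ CHAR('k) *s e i)" using xp by simp
      also have "\<dots> = L j x ^ CHAR('k)" by (rule frame_sum_coeff[OF L(1,2) j])
      finally show ?thesis by (simp add: poly_monom)
    qed
    then have "(\<lambda>i\<in>{..<d}. L i x) \<in> {..<d} \<rightarrow>\<^sub>E ?R" by auto
    moreover have "s (\<lambda>i\<in>{..<d}. L i x) = x" unfolding s_def using xL by simp
    ultimately show ?thesis by (metis imageI)
  qed
  define r where "r h = (\<lambda>i\<in>{..<d}. h (e i))" for h :: "'g \<Rightarrow> 'g"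
  have hom: "h \<in> extensional t" "hom_on t h" if "h \<in> Autp t" for h
    using that by (auto simp: Autp_def Bij_def)
  have "r ` Autp t \<subseteq> {..<d} \<rightarrow>\<^sub>E ?S"
  proof (intro image_subsetI PiE_I)
    fix h i assume h: "h \<in> Autp t" and i: "i \<in> {..<d}"
    have i': "i < d" using i by simp
    have "h (pmap (e i)) = pmap (h (e i))" using hom(2)[OF h] eT[OF i'] by (simp add: hom_on_def)
    then show "r h i \<in> ?S"
      unfolding r_def using i S[OF Autp_apply[OF h eT[OF i']]] e(3)[OF i'] by simp
  qed (simp add: r_def)
  moreover have "finite ({..<d} \<rightarrow>\<^sub>E ?S)" using \<open>finite ?S\<close> by (intro finite_PiE) auto
  ultimately have "finite (r ` Autp t)" by (rule finite_subset)
  moreover have "inj_on r (Autp t)"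
  proof (rule inj_onI)
    fix h h' assume h: "h \<in> Autp t" "h' \<in> Autp t" "r h = r h'"
    have L': "v = (\<Sum>i<d. L i v *s e i)" if "v \<in> t" for v using L(3)[of v] that e(2) by simp
    have ei: "h (e i) = h' (e i)" if "i < d" for i using fun_cong[OF h(3), of i] that by (simp add: r_def)
    have "frame_map t L d (\<lambda>i. h (e i)) = h"
      by (rule frame_map_restrict[OF t e(1,2) L' hom(1,2)[OF h(1)]]) simp_all
    moreover have "frame_map t L d (\<lambda>i. h (e i)) = h'"
      by (rule frame_map_restrict[OF t e(1,2) L' hom(1,2)[OF h(2)]]) (simp_all add: ei)
    ultimately show "h = h'" by simp
  qed
  ultimately show ?thesis by (rule finite_imageD)
qed

context
  fixes t
  assumes gen: "generic_torus t"
begin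

private abbreviation "X0 \<equiv> inclusion_component t"

lemma generic_torus: "torus t" and generic_p_subalgebra: "p_subalgebra t"
  using gen by (auto simp: generic_torus_def Tor_def torus_def)

private lemmas tor = generic_torus and pt = generic_p_subalgebra

lemma embeddings_cover: "embeddings t \<subseteq> (\<Union>h\<in>Autp t. Aut_act t h ` X0)"
proof
  fix \<phi> assume \<phi>: "\<phi> \<in> embeddings t"
  have sub: "orbit_embeddings t \<subseteq> embeddings t" by (auto simp: orbit_embeddings_def)
  have "\<phi> \<in> embeddings_top t closure_of orbit_embeddings t"
    unfolding embeddings_top_def
    by (rule closure_of_zariski_dense[OF sub \<phi>]) (rule vanishing_on_orbit_embeddings[OF gen \<phi>])
  moreover have "closedin (embeddings_top t) (\<Union>h\<in>Autp t. Aut_act t h ` X0)"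
    using finite_Autp[OF tor] Aut_act_inclusion_component[OF pt] by (intro closedin_Union) auto
  moreover have "orbit_embeddings t \<subseteq> (\<Union>h\<in>Autp t. Aut_act t h ` X0)"
  proof
    fix \<psi> assume "\<psi> \<in> orbit_embeddings t"
    then obtain h where h: "h \<in> Autp t" "\<psi> \<in> G_orbit t (Aut_act t h (\<lambda>x\<in>t. x))"
      using orbit_embeddings_cover[OF pt] by blast
    have "G_orbit t (Aut_act t h (\<lambda>x\<in>t. x)) \<subseteq> Aut_act t h ` X0"
      unfolding Aut_act_inclusion_component[OF pt h(1)]
      using G_orbit_subset[OF pt Aut_act_embedding[OF pt h(1) inclusion_embedding[OF pt]]]
      by (simp add: closure_of_subset)
    then show "\<psi> \<in> (\<Union>h\<in>Autp t. Aut_act t h ` X0)" using h by blast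
  qed
  ultimately show "\<phi> \<in> (\<Union>h\<in>Autp t. Aut_act t h ` X0)"
    using closure_of_minimal[of "orbit_embeddings t"] by blast
qed

text \<open>Among the finitely many translates choose a maximal one \<open>a X0\<close>. It is
  contained in \<open>a h X0\<close>, hence equal to it, and \<open>a\<close> can be
  cancelled.\<close>

lemma Aut_act_component_ascending:
  assumes h: "h \<in> Autp t" and sub: "X0 \<subseteq> Aut_act t h ` X0"
  shows "Aut_act t h ` X0 = X0"
proof -
  interpret A: group "Autp_group t" by (rule group_Autp[OF pt])
  have X0E: "X0 \<subseteq> embeddings t"
    using closure_of_subset_topspace[of "embeddings_top t"]
    unfolding inclusion_component_def by auto
  let ?F = "(\<lambda>a. Aut_act t a ` X0) ` Autp t"
  have "finite ?F" by (rule finite_imageI[OF finite_Autp[OF tor]])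
  moreover have "?F \<noteq> {}" using h by blast
  ultimately have "\<exists>M\<in>?F. \<forall>N\<in>?F. M \<subseteq> N \<longrightarrow> M = N" by (rule finite_has_maximal)
  then obtain a where a: "a \<in> Autp t"
    and max: "\<And>b. b \<in> Autp t \<Longrightarrow> Aut_act t a ` X0 \<subseteq> Aut_act t b ` X0 \<Longrightarrow> Aut_act t a ` X0 = Aut_act t b ` X0"
    by (rule bexE) (erule imageE, auto)
  have ah: "a \<otimes>\<^bsub>Autp_group t\<^esub> h \<in> Autp t" using A.m_closed[of a h] a h by simp
  have img: "Aut_act t (a \<otimes>\<^bsub>Autp_group t\<^esub> h) ` X0 = Aut_act t a ` Aut_act t h ` X0"
    by (simp only: image_image) (rule image_cong[OF refl Aut_act_mult[OF pt a h]])
  have "Aut_act t a ` X0 = Aut_act t (a \<otimes>\<^bsub>Autp_group t\<^esub> h) ` X0"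
    by (rule max[OF ah]) (unfold img, rule image_mono[OF sub])
  then have eq: "Aut_act t a ` X0 = Aut_act t a ` Aut_act t h ` X0" unfolding img .
  have inj: "inj_on (Aut_act t a) (embeddings t)"
    by (rule inj_on_inverseI[where g = "Aut_act t (inv\<^bsub>Autp_group t\<^esub> a)"]) (rule Aut_act_inverse(1)[OF pt a])
  have hX0: "Aut_act t h ` X0 \<subseteq> embeddings t"
    using Aut_act_embedding[OF pt h] X0E by blast
  show ?thesis using inj_on_image_eq_iff[OF inj hX0 X0E] eq by simp
qed

lemma inclusion_in_component: "(\<lambda>x\<in>t. x) \<in> X0"
proof -
  have "G_act t id (\<lambda>x\<in>t. x) = (\<lambda>x\<in>t. x)" by (auto simp: G_act_def)
  then have "(\<lambda>x\<in>t. x) \<in> G_orbit t (\<lambda>x\<in>t. x)"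
    unfolding G_orbit_def using imageI[OF id_in_G, of "\<lambda>g. G_act t g (\<lambda>x\<in>t. x)"] by simp
  then show ?thesis
    unfolding inclusion_component_def
    using closure_of_subset[of "G_orbit t (\<lambda>x\<in>t. x)" "embeddings_top t"]
      G_orbit_subset[OF pt inclusion_embedding[OF pt]] by auto
qed

lemma irreducible_inclusion_component: "irreduciblein (embeddings_top t) X0"
  unfolding inclusion_component_def
  by (rule irreduciblein_closure_of[OF irreducible_G_orbit[OF pt inclusion_embedding[OF pt]]])

lemma irreducible_in_translate:
  assumes D: "irreduciblein (embeddings_top t) D"
  obtains h where "h \<in> Autp t" "D \<subseteq> Aut_act t h ` X0"
proof -
  have "\<exists>A\<in>(\<lambda>h. Aut_act t h ` X0) ` Autp t. D \<subseteq> A"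
  proof (rule irreduciblein_finite_cover[OF D])
    show "finite ((\<lambda>h. Aut_act t h ` X0) ` Autp t)" using finite_Autp[OF tor] by simp
    show "closedin (embeddings_top t) A" if "A \<in> (\<lambda>h. Aut_act t h ` X0) ` Autp t" for A
      using that Aut_act_inclusion_component[OF pt] by auto
    have "D \<subseteq> embeddings t" using D by (simp add: irreduciblein_def)
    then show "D \<subseteq> \<Union>((\<lambda>h. Aut_act t h ` X0) ` Autp t)" using embeddings_cover by (rule subset_trans)
  qed
  then show thesis using that by auto
qed

text \<open>
  A translate \<open>h \<cdot> X0\<close> containing the inclusion contains its \<open>G\<close>-orbit and hence \<open>X0\<close>; as the
  translates are finitely many, it equals \<open>X0\<close>. This replaces the appeal to smoothness for the
  disjointness of the irreducible components.
\<close>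

lemma translate_through_inclusion:
  assumes h: "h \<in> Autp t" and i: "(\<lambda>x\<in>t. x) \<in> Aut_act t h ` X0"
  shows "Aut_act t h ` X0 = X0"
proof (rule Aut_act_component_ascending[OF h])
  let ?\<psi> = "Aut_act t h (\<lambda>x\<in>t. x)" and ?E = "embeddings_top t"
  have \<psi>: "?\<psi> \<in> embeddings t" by (rule Aut_act_embedding[OF pt h inclusion_embedding[OF pt]])
  have "G_act t g \<phi> \<in> ?E closure_of G_orbit t ?\<psi>" if g: "g \<in> G" and \<phi>: "\<phi> \<in> ?E closure_of G_orbit t ?\<psi>" for g \<phi>
  proof -
    have "continuous_map ?E ?E (G_act t g)"
      unfolding embeddings_top_def
    proof (rule continuous_map_zariski)
      have gA: "g \<in> Autp UNIV" using g G_subset by blast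
      show "G_act t g \<in> embeddings t \<rightarrow> embeddings t" using G_act_embedding[OF pt gA] by blast
      fix c :: "('g \<Rightarrow> 'g) \<Rightarrow> 'k" assume c: "c \<in> eval_coords t"
      have "(\<lambda>\<phi>. c (G_act t g \<phi>)) \<in> polyfuns (eval_coords t)"
      proof (rule polyfuns_eval_coordsI[OF c])
        show "polymap (eval_coords t) (\<lambda>\<phi>. G_act t g \<phi> i)" if "i \<in> t" for i
          using that polymap_linear[OF Autp_UNIV(3)[OF gA] polymap_eval[OF that]] by (simp add: G_act_def)
      qed
      then show "c \<circ> G_act t g \<in> polyfuns (eval_coords t)" by (simp add: o_def)
    qed
    then have "G_act t g ` (?E closure_of G_orbit t ?\<psi>) \<subseteq> ?E closure_of (G_act t g ` G_orbit t ?\<psi>)"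
      by (rule continuous_map_image_closure_subset)
    moreover have "G_act t g ` G_orbit t ?\<psi> \<subseteq> G_orbit t ?\<psi>"
      using G_comp[OF g] by (auto simp: G_orbit_def G_act_G_act)
    then have "?E closure_of (G_act t g ` G_orbit t ?\<psi>) \<subseteq> ?E closure_of G_orbit t ?\<psi>"
      by (rule closure_of_mono)
    ultimately show ?thesis using \<phi> by blast
  qed
  then have "G_orbit t (\<lambda>x\<in>t. x) \<subseteq> ?E closure_of G_orbit t ?\<psi>"
    using i unfolding Aut_act_inclusion_component[OF pt h] G_orbit_def[of t "\<lambda>x\<in>t. x"] by (intro image_subsetI)
  then have "?E closure_of G_orbit t (\<lambda>x\<in>t. x) \<subseteq> ?E closure_of G_orbit t ?\<psi>"
    by (rule closure_of_minimal) simp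
  then show "X0 \<subseteq> Aut_act t h ` X0"
    by (simp only: Aut_act_inclusion_component[OF pt h]) (simp only: inclusion_component_def)
qed

text \<open>Every irreducible set lies in some translate of \<open>X0\<close>, and a translate
  through the inclusion is \<open>X0\<close> itself. This gives both the maximality of
  \<open>X0\<close> and its uniqueness.\<close>

lemma X_comp_eq: "X_comp t = X0"
  unfolding X_comp_def
proof (rule the_equality)
  have max: "D = X0" if D: "irreduciblein (embeddings_top t) D" "X0 \<subseteq> D" for D
  proof -
    obtain h where h: "h \<in> Autp t" "D \<subseteq> Aut_act t h ` X0" by (rule irreducible_in_translate[OF D(1)])
    have "(\<lambda>x\<in>t. x) \<in> Aut_act t h ` X0" by (rule subsetD[OF subset_trans[OF D(2) h(2)] inclusion_in_component])
    then have "Aut_act t h ` X0 = X0" by (rule translate_through_inclusion[OF h(1)])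
    then show ?thesis using D(2) h(2) by simp
  qed
  then show "X0 \<in> irreducible_components_of (embeddings_top t) \<and> (\<lambda>x\<in>t. x) \<in> X0"
    using irreducible_inclusion_component inclusion_in_component
    by (auto simp: irreducible_components_of_def)
  fix C assume C: "C \<in> irreducible_components_of (embeddings_top t) \<and> (\<lambda>x\<in>t. x) \<in> C"
  then have irr: "irreduciblein (embeddings_top t) C"
    and Cmax: "\<And>D. irreduciblein (embeddings_top t) D \<Longrightarrow> C \<subseteq> D \<Longrightarrow> D = C"
    by (auto simp: irreducible_components_of_def)
  obtain h where h: "h \<in> Autp t" "C \<subseteq> Aut_act t h ` X0" by (rule irreducible_in_translate[OF irr])
  have "(\<lambda>x\<in>t. x) \<in> Aut_act t h ` X0" by (rule subsetD[OF h(2) conjunct2[OF C]])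
  then have "Aut_act t h ` X0 = X0" by (rule translate_through_inclusion[OF h(1)])
  then show "C = X0" using Cmax[OF irreducible_inclusion_component] h(2) by simp
qed

section \<open>The Weyl group as a stabilizer\<close>

lemma Nor_restrict:
  assumes g: "g \<in> Nor t"
  shows "restrict g t \<in> Autp t"
proof -
  have gG: "g \<in> G" "g ` t = t" using g by (auto simp: Nor_def)
  have "inj_on g t" using G_bij[OF gG(1)] by (meson bij_is_inj inj_on_subset subset_UNIV)
  moreover have "hom_on t (restrict g t)"
    using G_hom_on[OF gG(1), of UNIV] pt subspace_add[of t] subspace_scale[of t]
    by (auto simp: hom_on_def p_subalgebra_def)
  ultimately show ?thesis using gG(2) by (simp add: Autp_def Bij_def bij_betw_def inj_on_restrict_eq)
qed

lemma Nor_restrict_hom: "(\<lambda>g. restrict g t) \<in> hom (Nor_group t) (Autp_group t)"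
proof (rule homI)
  show "restrict g t \<in> carrier (Autp_group t)" if "g \<in> carrier (Nor_group t)" for g
    using that Nor_restrict by simp
  fix g g' assume "g \<in> carrier (Nor_group t)" "g' \<in> carrier (Nor_group t)"
  then have g: "g \<in> Nor t" "g' \<in> Nor t" by simp_all
  have mult: "g \<otimes>\<^bsub>Nor_group t\<^esub> g' = g \<circ> g'" using Nor_bij g by simp
  have g't: "g' x \<in> t" if "x \<in> t" for x using g(2) that by (auto simp: Nor_def)
  have "restrict (g \<circ> g') t = compose t (restrict g t) (restrict g' t)"
    using g't by (auto simp: compose_def restrict_def fun_eq_iff)
  then show "restrict (g \<otimes>\<^bsub>Nor_group t\<^esub> g') t = restrict g t \<otimes>\<^bsub>Autp_group t\<^esub> restrict g' t"
    unfolding mult Autp_mult[OF Nor_restrict[OF g(1)] Nor_restrict[OF g(2)]] .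
qed

text \<open>Stability of \<open>X0\<close> makes the orbits of the inclusion and of its translate by
  \<open>h\<close> dense in the same set, so they share a point; the two group elements leading to
  it combine to an element of \<open>G\<close> inducing \<open>h\<close>.\<close>

lemma S_eq: "S t = (\<lambda>g. restrict g t) ` Nor t"
proof (intro equalityI subsetI)
  fix h assume "h \<in> S t"
  then have h: "h \<in> Autp t" "Aut_act t h ` X0 = X0" by (auto simp: S_def X_comp_eq)
  let ?k = "inv\<^bsub>Autp_group t\<^esub> h"
  have i: "(\<lambda>x\<in>t. x) \<in> embeddings t" by (rule inclusion_embedding[OF pt])
  have "embeddings_top t closure_of G_orbit t (Aut_act t h (\<lambda>x\<in>t. x)) = X0"
    unfolding Aut_act_inclusion_component[OF pt h(1), symmetric] by (rule h(2))
  then have "embeddings_top t closure_of G_orbit t (Aut_act t h (\<lambda>x\<in>t. x)) =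
      embeddings_top t closure_of G_orbit t (\<lambda>x\<in>t. x)"
    by (simp only: inclusion_component_def)
  from G_orbits_meet[OF tor Aut_act_embedding[OF pt h(1) i] i this]
  obtain g g' where g: "g \<in> G" "g' \<in> G" "G_act t g (Aut_act t h (\<lambda>x\<in>t. x)) = G_act t g' (\<lambda>x\<in>t. x)"
    by (auto simp: G_orbit_def)
  have gk: "g (?k x) = g' x" if "x \<in> t" for x
    using fun_cong[OF g(3), of x] that Autp_apply[OF Autp_inv(1)[OF pt h(1)] that]
    by (simp add: G_act_def Aut_act_eq)
  \<comment> \<open>From \<open>g (?k x) = g' x\<close> with \<open>?k\<close> inverse to
    \<open>h\<close>, substituting \<open>h x\<close> for \<open>x\<close> gives
    \<open>g x = g' (h x)\<close>.\<close>
  let ?n = "inv_into UNIV g' \<circ> g"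
  have nh: "?n x = h x" if "x \<in> t" for x
  proof -
    have "g x = g' (h x)"
      using gk[OF Autp_apply[OF h(1) that]] Autp_inv(2)[OF pt h(1) that] by simp
    then show ?thesis by (simp add: G_inv_apply(2)[OF g(2)])
  qed
  have "?n \<in> G" by (rule G_comp[OF G_inv[OF g(2)] g(1)])
  moreover have "?n ` t = h ` t" by (rule image_cong[OF refl nh])
  moreover have "h ` t = t" using h(1) by (auto simp: Autp_def Bij_def bij_betw_def)
  ultimately have "?n \<in> Nor t" by (simp add: Nor_def)
  moreover have "restrict ?n t = h"
    using Autp_extensional[OF h(1)] nh by (intro extensionalityI[of _ t]) simp_all
  ultimately show "h \<in> (\<lambda>g. restrict g t) ` Nor t"
    using imageI[of ?n "Nor t" "\<lambda>g. restrict g t"] by simp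
next
  fix h assume "h \<in> (\<lambda>g. restrict g t) ` Nor t"
  then obtain g where g: "g \<in> Nor t" "h = restrict g t" by blast
  have gG: "g \<in> G" "g ` t = t" using g(1) by (auto simp: Nor_def)
  have h: "h \<in> Autp t" unfolding g(2) by (rule Nor_restrict[OF g(1)])
  let ?k = "inv\<^bsub>Autp_group t\<^esub> h"
  have k: "?k x = inv_into UNIV g x" if x: "x \<in> t" for x
  proof -
    have kt: "?k x \<in> t" by (rule Autp_apply[OF Autp_inv(1)[OF pt h] x])
    have "h (?k x) = x" by (rule Autp_inv(3)[OF pt h x])
    then have "g (?k x) = x" using kt by (simp add: g(2))
    then show ?thesis using G_inv_apply(2)[OF gG(1), of "?k x"] by simp
  qed
  \<comment> \<open>Translating the inclusion by a restriction of \<open>g\<close> stays in its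
    \<open>G\<close>-orbit, and equal orbits have equal closures.\<close>
  have "Aut_act t h (\<lambda>x\<in>t. x) = G_act t (inv_into UNIV g) (\<lambda>x\<in>t. x)"
    unfolding Aut_act_eq G_act_def using k Autp_apply[OF Autp_inv(1)[OF pt h]]
    by (intro restrict_ext) simp
  then have "G_orbit t (Aut_act t h (\<lambda>x\<in>t. x)) = G_orbit t (\<lambda>x\<in>t. x)"
    using G_orbit_eq[OF G_inv[OF gG(1)]] by simp
  then have "Aut_act t h ` X0 = X0"
    by (simp only: Aut_act_inclusion_component[OF pt h]) (simp only: inclusion_component_def)
  then show "h \<in> S t" using h by (simp add: S_def X_comp_eq)
qed

lemma Weyl_group_iso:
  "\<exists>\<Phi>\<in>iso (W t) (S_group t). \<forall>g\<in>Nor t. \<Phi> (Cent t #>\<^bsub>Nor_group t\<^esub> g) = restrict g t"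
proof -
  interpret N: group "Nor_group t" by (rule group_Nor)
  interpret A: group "Autp_group t" by (rule group_Autp[OF pt])
  let ?r = "\<lambda>g. restrict g t"
  interpret NA: group_hom "Nor_group t" "Autp_group t" ?r
    by unfold_locales (rule Nor_restrict_hom)
  have "subgroup (?r ` carrier (Nor_group t)) (Autp_group t)" by (rule NA.img_is_subgroup)
  then have "subgroup (S t) (Autp_group t)" by (simp add: S_eq)
  then have "group (Autp_group t\<lparr>carrier := S t\<rparr>)" by (rule subgroup.subgroup_is_group) (rule A.group_axioms)
  then have SG: "group (S_group t)" by simp
  have "?r \<in> hom (Nor_group t) (S_group t)"
    using Nor_restrict_hom by (auto simp: hom_def S_eq)
  then interpret NS: group_hom "Nor_group t" "S_group t" ?r
    using SG by (intro group_hom.intro group_hom_axioms.intro N.group_axioms)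
  have ker: "kernel (Nor_group t) (S_group t) ?r = Cent t"
  proof (intro equalityI subsetI)
    fix g assume "g \<in> kernel (Nor_group t) (S_group t) ?r"
    then have g: "g \<in> Nor t" "restrict g t = (\<lambda>x\<in>t. x)" by (auto simp: kernel_def BijGroup_def)
    have "g x = x" if "x \<in> t" for x using fun_cong[OF g(2), of x] that by simp
    then show "g \<in> Cent t" using g(1) by (simp add: Cent_def Nor_def)
  next
    fix g assume g: "g \<in> Cent t"
    then have "g ` t = t" by (auto simp: Cent_def image_iff)
    moreover have "restrict g t = (\<lambda>x\<in>t. x)" using g by (intro restrict_ext) (simp add: Cent_def)
    ultimately show "g \<in> kernel (Nor_group t) (S_group t) ?r"
      using g by (simp add: kernel_def BijGroup_def Nor_def Cent_def)
  qed
  \<comment> \<open>The map of the first isomorphism theorem; restriction is constant on each coset,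
    so the image is a singleton and its element is the value required.\<close>
  let ?\<Phi> = "\<lambda>C. the_elem (?r ` C)"
  have "?\<Phi> \<in> iso (Nor_group t Mod kernel (Nor_group t) (S_group t) ?r) (S_group t)"
    by (rule NS.FactGroup_iso_set) (simp add: S_eq)
  then have iso: "?\<Phi> \<in> iso (W t) (S_group t)" by (simp only: ker W_def)
  have val: "?\<Phi> (Cent t #>\<^bsub>Nor_group t\<^esub> g) = restrict g t" if g: "g \<in> Nor t" for g
  proof -
    have "?r ` (Cent t #>\<^bsub>Nor_group t\<^esub> g) = {restrict g t}"
    proof -
      have c: "restrict (c \<otimes>\<^bsub>Nor_group t\<^esub> g) t = restrict g t" if c: "c \<in> Cent t" for c
      proof -
        have "c \<in> Nor t" using c by (auto simp: Cent_def Nor_def)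
        then have "c \<otimes>\<^bsub>Nor_group t\<^esub> g = c \<circ> g" using Nor_bij g by simp
        moreover have "g x \<in> t" if "x \<in> t" for x using g that by (auto simp: Nor_def)
        ultimately show ?thesis using c by (auto simp: Cent_def intro!: restrict_ext)
      qed
      have "Cent t \<noteq> {}" using id_in_G by (auto simp: Cent_def)
      have "?r ` (Cent t #>\<^bsub>Nor_group t\<^esub> g) = (\<lambda>c. restrict (c \<otimes>\<^bsub>Nor_group t\<^esub> g) t) ` Cent t"
        unfolding r_coset_def by (simp only: image_UN image_insert image_empty UNION_singleton_eq_range image_image)
      also have "\<dots> = (\<lambda>c. restrict g t) ` Cent t" by (rule image_cong[OF refl c])
      also have "\<dots> = {restrict g t}" by (rule image_constant_conv[THEN trans]) (simp add: \<open>Cent t \<noteq> {}\<close>)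
      finally show ?thesis .
    qed
    then show ?thesis by simp
  qed
  show ?thesis by (rule bexI[OF _ iso]) (rule ballI[OF val])
qed

end

end

theorem theorem1p5:
  fixes scale :: "'k::alg_closed_field \<Rightarrow> 'g::ab_group_add \<Rightarrow> 'g"
    and Basis t :: "'g set"
    and bracket :: "'g \<Rightarrow> 'g \<Rightarrow> 'g"
    and pmap :: "'g \<Rightarrow> 'g"
  assumes "restricted_lie_algebra scale Basis bracket pmap"
    and "t \<in> restricted_lie_algebra.Tor scale bracket pmap"
    and "restricted_lie_algebra.generic_torus scale bracket pmap t"
  shows "(\<lambda>g. restrict g t) \<in>
           hom (restricted_lie_algebra.Nor_group scale bracket pmap t)
               (restricted_lie_algebra.Autp_group scale bracket pmap t) \<and>
         (\<exists>\<Phi> \<in> iso (restricted_lie_algebra.W scale bracket pmap t)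
                    (restricted_lie_algebra.S_group scale bracket pmap t).
            \<forall>g \<in> restricted_lie_algebra.Nor scale bracket pmap t.
              \<Phi> (restricted_lie_algebra.Cent scale bracket pmap t
                   #>\<^bsub>restricted_lie_algebra.Nor_group scale bracket pmap t\<^esub> g) = restrict g t)"
proof -
  interpret restricted_lie_algebra_alg_closed scale Basis bracket pmap
    using assms(1) by (rule restricted_lie_algebra_alg_closed.intro)
  show ?thesis using Nor_restrict_hom[OF assms(3)] Weyl_group_iso[OF assms(3)] ..
qed

end
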